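(* Let $E$ be a real Hilbert space with inner product $\langle\cdot,\cdot\rangle_E$ and $\|\cdot\|_E=\sqrt{\langle\cdot,\cdot\rangle_E}$. Let $(E,\mathcal D,\mathcal J)$ be a symplectic Banach triple, $\langle\cdot,\cdot\rangle$ a continuous scalar product on $E$ with norm $\|\cdot\|$ and completion $\hat E$, $H\in C^2(E,\mathbb R)\cap\mathrm{Dif}(\mathcal D,\mathcal J)$, $G$ a Lie group with a globally Hamiltonian action $\Phi$ on $E$ with $\mathrm{Ad}^*$-equivariant momentum map $F\in C^2(E,\mathbb R^m)$, and suppose $H\circ\Phi_g=H$ for all $g\in G$. Suppose that for all $g\in G$, $\Phi_g$ is linear and preserves both $\langle\cdot,\cdot\rangle$ and $\|\cdot\|_E$. For $\xi\in\mathfrak g$ let $\mathcal L_\xi=H-\xi\cdot F$. Let $T$ and $E_2$ be as defined in the context. Suppose there exist $\xi_*\in\mathfrak g$ and $u_*\in\mathcal D\cap E_2$ such that $D_{u_*}\mathcal L_{\xi_*}=0$. Suppose in addition: (a) there exist $\varepsilon,C>0$ such that $D^2_{u_*}\mathcal L_{\xi_*}(v,v)\ge\varepsilon\|v\|_E^2-C\|v\|^2$ for all $v\in E$; (b) for all $u\in E_2$ and all $\xi\in\mathfrak g$ there exists $\nabla\mathcal L_\xi(u)\in\hat E$ such that $D_u\mathcal L_\xi(v)=\langle\nabla\mathcal L_\xi(u),v\rangle$ for all $v\in E$; (c) the function $(\xi,v)\in\mathfrak g\times E_2\mapsto\nabla\mathcal L_\xi(v)\in\hat E$ belongs to $C^1(\mathfrak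 g\times E_2;\hat E)$; (d) for all $v\in E_2$, the map $g\in G\mapsto\Phi_g(v)\in E$ is $C^1$; (e) $F$ is regular at $u_*$, i.e. $D_{u_*}F$ has maximal rank; (f) for all $\mu$ in a neighbourhood of $\mu_*=F(u_* )$, $\dim\mathfrak g_\mu=\dim\mathfrak g_{\mu_*}$. If in addition (i) $\mathcal D(\nabla^2\mathcal L_{\xi_*}(u_* ))=\mathcal D(T^2)$, (ii) $\mathrm{Ker}\,D^2_{u_*}\mathcal L_{\xi_*}=T_{u_*}\mathcal O_{u_*}$, (iii) $\inf\big(\sigma(\nabla^2\mathcal L_{\xi_*}(u_* ))\cap(0,+\infty)\big)>0$, (iv) $n(D^2_{u_*}\mathcal L_{\xi_*})<+\infty$, then there exist a neighbourhood $\Omega$ of $\xi_*$ in $\mathfrak g$ and a $C^1$ map $\xi\in\Omega\mapsto u_\xi\in E$ with $u_{\xi_*}=u_*$ such that $D_{u_\xi}H-\xi\cdot D_{u_\xi}F=0$ for all $\xi\in\Omega$. The map $\xi\mapsto u_\xi$ is an injective immersion.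
   Context: Symplectic setting. Let $E$ be a real Banach space with norm $\|\cdot\|_E$. A domain $\mathcal D$ is a dense subset of $E$. A symplector is an injective continuous linear map $\mathcal J:E\to E^*$ with $(\mathcal Ju)(v)=-(\mathcal Jv)(u)$; then $(E,\mathcal D,\mathcal J)$ is called a symplectic Banach triple. $\mathrm{Dif}(\mathcal D,\mathcal J)$ is the set of functions $H:E\to\mathbb R$ differentiable at each $u\in\mathcal D$ with $D_uH$ in the range of $\mathcal J$ for all $u\in\mathcal D$. A Hamiltonian flow for $H\in\mathrm{Dif}(\mathcal D,\mathcal J)$ is a separately continuous map $\Phi^H:\mathbb R\times E\to E$ such that $\Phi^H_{t+s}=\Phi^H_t\circ\Phi^H_s$, $\Phi^H_0=\mathrm{Id}$, $\Phi^H_t(\mathcal D)=\mathcal D$, and for $u\in\mathcal D$ the curve $u(t)=\Phi^H_t(u)$ is differentiable and is the unique solution of $\mathcal J\dot u(t)=D_{u(t)}H$, $u(0)=u$. Group action. $G$ is a connected matrix Lie group with Lie algebra $\mathfrak g$, $m=\dim\mathfrak g$, $\mathrm{Ad}_g\xi=g\xi g^{-1}$; $\mathfrak g$ and $\mathfrak g^*$ are identified with $\mathbb R^m$ and $\cdot$ is the canonical inner product of $\mathbb R^m$. An action $\Phi$ of $G$ on $E$ is globally Hamiltonian if: each $\Phi_g\in C^1(E,E)$ satisfies $(\mathcal JD_u\Phi_g v)(D_u\Phi_g w)=(\mathcal Jv)(w)$ for all $u\in\mathcal D$, $v,w\in E$; $\Phi_g(\mathcal D)=\mathcal D$; and for each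 $\xi\in\mathfrak g$ there is $F_\xi\in C^1(E,\mathbb R)\cap\mathrm{Dif}(\mathcal D,\mathcal J)$, linear in $\xi$, such that $\Phi_{\exp(t\xi)}=\Phi_t^{F_\xi}$ is a Hamiltonian flow. The momentum map is $F:E\to\mathbb R^m\simeq\mathfrak g^*$ with $F_\xi=\xi\cdot F$; it is $\mathrm{Ad}^*$-equivariant if $F_\xi\circ\Phi_g=F_{\mathrm{Ad}_{g^{-1}}\xi}$ for all $g,\xi$, i.e. $F\circ\Phi_g=\mathrm{Ad}^*_gF$. For $u\in\mathcal D$, $X_\eta(u)=\frac{d}{dt}\Phi_{\exp(t\eta)}(u)|_{t=0}$. For $\mu\in\mathfrak g^*$: $G_\mu=\{g\in G:\mathrm{Ad}^*_g\mu=\mu\}$ with Lie algebra $\mathfrak g_\mu$. For $u\in\mathcal D$ with $\mu=F(u)$: $\mathcal O_u=\Phi_{G_\mu}(u)$ and $T_u\mathcal O_u=\{X_\eta(u):\eta\in\mathfrak g_\mu\}$. Scalar product. A scalar product $\langle\cdot,\cdot\rangle$ on $E$ is continuous if $|\langle v,w\rangle|\le\|v\|_E\|w\|_E$. Put $\|v\|=\sqrt{\langle v,v\rangle}$ and let $\hat E\supset E$ be the completion (closure) of $E$ for $\|\cdot\|$, a Hilbert space. The operator $T$. View $\langle\cdot,\cdot\rangle_E$ as a closed form on $\hat E$ with form domain $E$. There is a unique unbounded positive self-adjoint operator $T^2$ on $\hat E$ with domain $\mathcal D(T^2)$ such that $\langle u,v\rangle_E=\langle u,T^2v\rangle$ for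 $u,v\in\mathcal D(T^2)$; with $T$ its positive square root, $E=\mathcal D(T)$ and $\langle u,v\rangle_E=\langle Tu,Tv\rangle$. For $\lambda\in\mathbb R$, $E_\lambda$ is the closure of $\mathcal D(T^\lambda)$ for the norm $\|u\|_\lambda=\|T^\lambda u\|$. In particular $E_1=E$, $E_0=\hat E$, and $E_2=\mathcal D(T^2)$ with norm $\|T^2u\|$. Hessians. $n(D^2_u\mathcal L_\xi)$ is the Morse index: the dimension of a maximal negative definite subspace of $E$ for the symmetric bilinear form $D^2_u\mathcal L_\xi$. The kernel of a symmetric bilinear form $B$ on $E$ is $\{v\in E:B(v,w)=0\ \forall w\in E\}$. Under the inequality $D^2_u\mathcal L_\xi(v,v)\ge\varepsilon\|v\|_E^2-C\|v\|^2$, $\nabla^2\mathcal L_\xi(u)$ is the self-adjoint operator on $\hat E$ with domain $\mathcal D(\nabla^2\mathcal L_\xi(u))=\{z\in E:\exists w\in\hat E,\ D^2_u\mathcal L_\xi(z,v)=\langle w,v\rangle\ \forall v\in E\}$ and $\nabla^2\mathcal L_\xi(u)z=w$. $\sigma$ denotes the spectrum. *)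

theory Defs
  imports "HOL-Analysis.Analysis"
begin

subsection \<open>Differential calculus\<close>

text \<open>The set \<open>S\<close> is meant to be open.\<close>

definition C1_on :: "'a::real_normed_vector set \<Rightarrow> ('a \<Rightarrow> 'b::real_normed_vector) \<Rightarrow> bool" where
  "C1_on S f \<longleftrightarrow>
     (\<exists>f' :: 'a \<Rightarrow> 'a \<Rightarrow>\<^sub>L 'b.
        (\<forall>x\<in>S. (f has_derivative blinfun_apply (f' x)) (at x)) \<and> continuous_on S f')"

definition C2_on :: "'a::real_normed_vector set \<Rightarrow> ('a \<Rightarrow> 'b::real_normed_vector) \<Rightarrow> bool" where
  "C2_on S f \<longleftrightarrow>
     (\<exists>f' :: 'a \<Rightarrow> 'a \<Rightarrow>\<^sub>L 'b.
        (\<forall>x\<in>S. (f has_derivative blinfun_apply (f' x)) (at x)) \<and> C1_on S f')"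

definition second_deriv ::
    "('a::real_normed_vector \<Rightarrow> real) \<Rightarrow> 'a \<Rightarrow> 'a \<Rightarrow> 'a \<Rightarrow> real" where
  "second_deriv f u v w =
     blinfun_apply (frechet_derivative (\<lambda>x. Blinfun (frechet_derivative f (at x))) (at u) v) w"


subsection \<open>Symplectic Banach triples and Hamiltonian flows\<close>

definition symplectic_triple ::
    "'e::banach set \<Rightarrow> ('e \<Rightarrow>\<^sub>L ('e \<Rightarrow>\<^sub>L real)) \<Rightarrow> bool" where
  "symplectic_triple D J \<longleftrightarrow>
     closure D = UNIV \<and> inj (blinfun_apply J) \<and> (\<forall>u v. J u v = - (J v u))"

definition Dif :: "'e::banach set \<Rightarrow> ('e \<Rightarrow>\<^sub>L ('e \<Rightarrow>\<^sub>L real)) \<Rightarrow> ('e \<Rightarrow> real) set" where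
  "Dif D J = {H. \<forall>u\<in>D. \<exists>d\<in>range (blinfun_apply J). (H has_derivative blinfun_apply d) (at u)}"

text \<open>Solutions are curves in the domain \<open>D\<close>, where the derivative of an element of
  \<open>Dif D J\<close> is known to exist.\<close>

definition hamilton_solution ::
    "'e::banach set \<Rightarrow> ('e \<Rightarrow>\<^sub>L ('e \<Rightarrow>\<^sub>L real)) \<Rightarrow> ('e \<Rightarrow> real) \<Rightarrow> 'e \<Rightarrow> (real \<Rightarrow> 'e) \<Rightarrow> bool" where
  "hamilton_solution D J H u c \<longleftrightarrow>
     c 0 = u \<and>
     (\<forall>t. c t \<in> D \<and>
          (\<exists>c'. (c has_vector_derivative c') (at t) \<and>
                (H has_derivative blinfun_apply (J c')) (at (c t))))"

definition hamiltonian_flow ::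
    "'e::banach set \<Rightarrow> ('e \<Rightarrow>\<^sub>L ('e \<Rightarrow>\<^sub>L real)) \<Rightarrow> ('e \<Rightarrow> real) \<Rightarrow> (real \<Rightarrow> 'e \<Rightarrow> 'e) \<Rightarrow> bool" where
  "hamiltonian_flow D J H \<phi> \<longleftrightarrow>
     (\<forall>t. continuous_on UNIV (\<phi> t)) \<and>
     (\<forall>u. continuous_on UNIV (\<lambda>t. \<phi> t u)) \<and>
     (\<forall>t s. \<phi> (t + s) = \<phi> t \<circ> \<phi> s) \<and>
     \<phi> 0 = id \<and>
     (\<forall>t. \<phi> t ` D = D) \<and>
     (\<forall>u\<in>D. hamilton_solution D J H u (\<lambda>t. \<phi> t u) \<and>
            (\<forall>c. hamilton_solution D J H u c \<longrightarrow> c = (\<lambda>t. \<phi> t u)))"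


subsection \<open>Matrix Lie groups\<close>

definition matrix_exp :: "complex^'n^'n \<Rightarrow> complex^'n^'n" where
  "matrix_exp A = (\<Sum>k. (1 / fact k) *\<^sub>R (((**) A) ^^ k) (mat 1))"

text \<open>A matrix Lie group is a subgroup of \<open>GL(n, \<complex>)\<close> that is closed in \<open>GL(n, \<complex>)\<close>;
  this includes the closed subgroups of \<open>GL(n, \<real>)\<close>.\<close>

definition matrix_lie_group :: "(complex^'n^'n) set \<Rightarrow> bool" where
  "matrix_lie_group G \<longleftrightarrow>
     closedin (top_of_set {A. invertible A}) G \<and>
     mat 1 \<in> G \<and> (\<forall>g\<in>G. \<forall>h\<in>G. g ** h \<in> G) \<and> (\<forall>g\<in>G. matrix_inv g \<in> G)"

definition lie_algebra :: "(complex^'n^'n) set \<Rightarrow> (complex^'n^'n) set" where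
  "lie_algebra G = {X. \<forall>t::real. matrix_exp (t *\<^sub>R X) \<in> G}"

text \<open>A linear isomorphism \<open>\<iota>\<close> from \<open>\<real>\<^sup>m\<close> onto the Lie algebra makes the identification of the
  latter (and, through the inner product, of its dual) with \<open>\<real>\<^sup>m\<close> explicit; from here on,
  Lie algebra elements and their duals are vectors of \<open>\<real>\<^sup>m\<close>.\<close>

definition lie_algebra_coords ::
    "(complex^'n^'n) set \<Rightarrow> (real^'m \<Rightarrow> complex^'n^'n) \<Rightarrow> bool" where
  "lie_algebra_coords G \<iota> \<longleftrightarrow> linear \<iota> \<and> inj \<iota> \<and> range \<iota> = lie_algebra G"

definition Ad :: "(real^'m \<Rightarrow> complex^'n^'n) \<Rightarrow> complex^'n^'n \<Rightarrow> real^'m \<Rightarrow> real^'m" where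
  "Ad \<iota> g \<xi> = inv \<iota> (g ** \<iota> \<xi> ** matrix_inv g)"

text \<open>\<open>\<xi> \<bullet> coAd \<iota> g \<mu> = Ad \<iota> (matrix_inv g) \<xi> \<bullet> \<mu>\<close>.\<close>

definition coAd :: "(real^'m \<Rightarrow> complex^'n^'n) \<Rightarrow> complex^'n^'n \<Rightarrow> real^'m \<Rightarrow> real^'m" where
  "coAd \<iota> g \<mu> = adjoint (Ad \<iota> (matrix_inv g)) \<mu>"

definition isotropy_group ::
    "(complex^'n^'n) set \<Rightarrow> (real^'m \<Rightarrow> complex^'n^'n) \<Rightarrow> real^'m \<Rightarrow> (complex^'n^'n) set" where
  "isotropy_group G \<iota> \<mu> = {g \<in> G. coAd \<iota> g \<mu> = \<mu>}"

definition isotropy_algebra ::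
    "(complex^'n^'n) set \<Rightarrow> (real^'m \<Rightarrow> complex^'n^'n) \<Rightarrow> real^'m \<Rightarrow> (real^'m) set" where
  "isotropy_algebra G \<iota> \<mu> = {\<eta>. \<iota> \<eta> \<in> lie_algebra (isotropy_group G \<iota> \<mu>)}"

text \<open>Continuous differentiability on the manifold \<open>G\<close>, in the charts \<open>\<xi> \<mapsto> g exp \<xi>\<close>.\<close>

definition C1_on_group ::
    "(complex^'n^'n) set \<Rightarrow> (real^'m \<Rightarrow> complex^'n^'n) \<Rightarrow>
     (complex^'n^'n \<Rightarrow> 'e::real_normed_vector) \<Rightarrow> bool" where
  "C1_on_group G \<iota> f \<longleftrightarrow>
     (\<forall>g\<in>G. \<exists>U. open U \<and> 0 \<in> U \<and> C1_on U (\<lambda>\<xi>. f (g ** matrix_exp (\<iota> \<xi>))))"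


subsection \<open>Globally Hamiltonian actions\<close>

definition group_action_on ::
    "(complex^'n^'n) set \<Rightarrow> (complex^'n^'n \<Rightarrow> 'e \<Rightarrow> 'e) \<Rightarrow> bool" where
  "group_action_on G \<Phi> \<longleftrightarrow>
     \<Phi> (mat 1) = id \<and> (\<forall>g\<in>G. \<forall>h\<in>G. \<Phi> (g ** h) = \<Phi> g \<circ> \<Phi> h)"

text \<open>The momentum map \<open>F\<close> carries the family \<open>F\<^sub>\<xi> = \<xi> \<bullet> F\<close>, which is linear in \<open>\<xi>\<close>; conversely
  every such linear family is of this form.\<close>

definition globally_hamiltonian ::
    "'e::banach set \<Rightarrow> ('e \<Rightarrow>\<^sub>L ('e \<Rightarrow>\<^sub>L real)) \<Rightarrow> (complex^'n^'n) set \<Rightarrow>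
     (real^'m \<Rightarrow> complex^'n^'n) \<Rightarrow> (complex^'n^'n \<Rightarrow> 'e \<Rightarrow> 'e) \<Rightarrow> ('e \<Rightarrow> real^'m) \<Rightarrow> bool" where
  "globally_hamiltonian D J G \<iota> \<Phi> F \<longleftrightarrow>
     group_action_on G \<Phi> \<and>
     (\<forall>g\<in>G. C1_on UNIV (\<Phi> g) \<and>
        (\<forall>u\<in>D. \<forall>v w. J (frechet_derivative (\<Phi> g) (at u) v) (frechet_derivative (\<Phi> g) (at u) w)
                      = J v w) \<and>
        \<Phi> g ` D = D) \<and>
     (\<forall>\<xi>. C1_on UNIV (\<lambda>u. \<xi> \<bullet> F u) \<and> (\<lambda>u. \<xi> \<bullet> F u) \<in> Dif D J \<and>
        hamiltonian_flow D J (\<lambda>u. \<xi> \<bullet> F u) (\<lambda>t. \<Phi> (matrix_exp (t *\<^sub>R \<iota> \<xi>))))"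

definition Ad_star_equivariant ::
    "(complex^'n^'n) set \<Rightarrow> (real^'m \<Rightarrow> complex^'n^'n) \<Rightarrow>
     (complex^'n^'n \<Rightarrow> 'e \<Rightarrow> 'e) \<Rightarrow> ('e \<Rightarrow> real^'m) \<Rightarrow> bool" where
  "Ad_star_equivariant G \<iota> \<Phi> F \<longleftrightarrow>
     (\<forall>g\<in>G. \<forall>\<xi> u. \<xi> \<bullet> F (\<Phi> g u) = Ad \<iota> (matrix_inv g) \<xi> \<bullet> F u)"

definition inf_generator ::
    "(real^'m \<Rightarrow> complex^'n^'n) \<Rightarrow> (complex^'n^'n \<Rightarrow> 'e \<Rightarrow> 'e) \<Rightarrow> real^'m \<Rightarrow> 'e::real_normed_vector \<Rightarrow> 'e"
  where "inf_generator \<iota> \<Phi> \<eta> u = vector_derivative (\<lambda>t. \<Phi> (matrix_exp (t *\<^sub>R \<iota> \<eta>)) u) (at 0)"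

definition orbit_tangent ::
    "(complex^'n^'n) set \<Rightarrow> (real^'m \<Rightarrow> complex^'n^'n) \<Rightarrow> (complex^'n^'n \<Rightarrow> 'e \<Rightarrow> 'e) \<Rightarrow>
     ('e \<Rightarrow> real^'m) \<Rightarrow> 'e::real_normed_vector \<Rightarrow> 'e set" where
  "orbit_tangent G \<iota> \<Phi> F u = (\<lambda>\<eta>. inf_generator \<iota> \<Phi> \<eta> u) ` isotropy_algebra G \<iota> (F u)"


subsection \<open>Unbounded operators on a real Hilbert space\<close>

text \<open>An unbounded operator is a partial map with domain \<open>dom A\<close>.\<close>

definition linear_op :: "('h::real_inner \<rightharpoonup> 'h) \<Rightarrow> bool" where
  "linear_op A \<longleftrightarrow>
     subspace (dom A) \<and>
     (\<forall>x\<in>dom A. \<forall>y\<in>dom A. the (A (x + y)) = the (A x) + the (A y)) \<and>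
     (\<forall>c. \<forall>x\<in>dom A. the (A (c *\<^sub>R x)) = c *\<^sub>R the (A x))"

text \<open>The left-hand side of the equivalence says that \<open>(y, w)\<close> is in the graph of the adjoint.\<close>

definition self_adjoint_op :: "('h::real_inner \<rightharpoonup> 'h) \<Rightarrow> bool" where
  "self_adjoint_op A \<longleftrightarrow>
     linear_op A \<and> closure (dom A) = UNIV \<and>
     (\<forall>y w. (\<forall>x\<in>dom A. the (A x) \<bullet> y = x \<bullet> w) \<longleftrightarrow> A y = Some w)"

definition positive_op :: "('h::real_inner \<rightharpoonup> 'h) \<Rightarrow> bool" where
  "positive_op A \<longleftrightarrow> (\<forall>x\<in>dom A. x \<bullet> the (A x) \<ge> 0)"

text \<open>Real points suffice: all operators below whose spectrum is taken are self-adjoint.\<close>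

definition resolvent_set :: "('h::real_inner \<rightharpoonup> 'h) \<Rightarrow> real set" where
  "resolvent_set A =
     {s. \<exists>R :: 'h \<Rightarrow>\<^sub>L 'h.
           (\<forall>x\<in>dom A. R (the (A x) - s *\<^sub>R x) = x) \<and>
           (\<forall>y. R y \<in> dom A \<and> the (A (R y)) - s *\<^sub>R R y = y)}"

definition op_spectrum :: "('h::real_inner \<rightharpoonup> 'h) \<Rightarrow> real set" where
  "op_spectrum A = - resolvent_set A"


subsection \<open>The completion, the operator \<open>T\<close> and the space \<open>E\<^sub>2\<close>\<close>

definition continuous_scalar_product :: "('e::real_normed_vector \<Rightarrow> 'e \<Rightarrow> real) \<Rightarrow> bool" where
  "continuous_scalar_product sp \<longleftrightarrow>
     bilinear sp \<and> (\<forall>v w. sp v w = sp w v) \<and> (\<forall>v. v \<noteq> 0 \<longrightarrow> sp v v > 0) \<and>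
     (\<forall>v w. \<bar>sp v w\<bar> \<le> norm v * norm w)"

text \<open>The Hilbert space \<open>'h\<close> is a completion of \<open>('e, sp)\<close>, with \<open>j\<close> the canonical inclusion
  (injective because \<open>sp\<close> is positive definite).\<close>

definition is_completion ::
    "('e::real_normed_vector \<Rightarrow> 'e \<Rightarrow> real) \<Rightarrow> ('e \<Rightarrow> 'h::{real_inner,banach}) \<Rightarrow> bool" where
  "is_completion sp j \<longleftrightarrow>
     linear j \<and> (\<forall>v w. j v \<bullet> j w = sp v w) \<and> closure (range j) = UNIV"

text \<open>\<open>T2\<close> is the operator of the inner product of \<open>'e\<close>, regarded as a closed form on \<open>'h\<close> with
  form domain \<open>'e\<close>, and \<open>T\<close> is its positive square root. The condition \<open>dom T = range j\<close>
  expresses that the form domain is all of \<open>'e\<close>; without it \<open>T2\<close> is not determined.\<close>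

definition form_operator_sqrt ::
    "('e::{real_inner,banach} \<Rightarrow> 'h::{real_inner,banach}) \<Rightarrow> ('h \<rightharpoonup> 'h) \<Rightarrow> ('h \<rightharpoonup> 'h) \<Rightarrow> bool" where
  "form_operator_sqrt j T2 T \<longleftrightarrow>
     self_adjoint_op T2 \<and> positive_op T2 \<and>
     (\<forall>u v. j u \<in> dom T2 \<longrightarrow> j v \<in> dom T2 \<longrightarrow> u \<bullet> v = j u \<bullet> the (T2 (j v))) \<and>
     self_adjoint_op T \<and> positive_op T \<and> T \<circ>\<^sub>m T = T2 \<and>
     dom T = range j \<and>
     (\<forall>u v. u \<bullet> v = the (T (j u)) \<bullet> the (T (j v)))"

text \<open>The Banach space \<open>'e2\<close> is \<open>dom T2\<close> with the norm \<open>\<parallel>T2 u\<parallel>\<close>, with \<open>i2\<close> its inclusion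
  into \<open>'e\<close>.\<close>

definition is_E2 ::
    "('e::real_normed_vector \<Rightarrow> 'h::{real_inner,banach}) \<Rightarrow> ('h \<rightharpoonup> 'h) \<Rightarrow> ('e2::banach \<Rightarrow> 'e) \<Rightarrow> bool" where
  "is_E2 j T2 i2 \<longleftrightarrow>
     linear i2 \<and> range (\<lambda>z. j (i2 z)) = dom T2 \<and> (\<forall>z. norm z = norm (the (T2 (j (i2 z)))))"

text \<open>Only meaningful where a representing vector exists; it is then unique by density.\<close>

definition hat_gradient ::
    "('e::real_normed_vector \<Rightarrow> 'h::{real_inner,banach}) \<Rightarrow> ('e \<Rightarrow> real) \<Rightarrow> 'e \<Rightarrow> 'h" where
  "hat_gradient j f u = (THE w. \<forall>v. frechet_derivative f (at u) v = w \<bullet> j v)"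

definition hessian_op ::
    "('e::real_normed_vector \<Rightarrow> 'h::{real_inner,banach}) \<Rightarrow> ('e \<Rightarrow> real) \<Rightarrow> 'e \<Rightarrow> ('h \<rightharpoonup> 'h)" where
  "hessian_op j f u = (\<lambda>z.
     if \<exists>x w. z = j x \<and> (\<forall>v. second_deriv f u x v = w \<bullet> j v)
     then Some (THE w. \<exists>x. z = j x \<and> (\<forall>v. second_deriv f u x v = w \<bullet> j v))
     else None)"


subsection \<open>Bilinear forms\<close>

definition form_kernel :: "('e \<Rightarrow> 'e \<Rightarrow> real) \<Rightarrow> 'e set" where
  "form_kernel B = {v. \<forall>w. B v w = 0}"

definition extended_dim :: "'e::real_vector set \<Rightarrow> enat" where
  "extended_dim V = (if \<exists>S. finite S \<and> V = span S then enat (dim V) else \<infinity>)"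

definition negative_definite_on :: "('e::real_vector \<Rightarrow> 'e \<Rightarrow> real) \<Rightarrow> 'e set \<Rightarrow> bool" where
  "negative_definite_on B V \<longleftrightarrow> (\<forall>v\<in>V. v \<noteq> 0 \<longrightarrow> B v v < 0)"

definition morse_index :: "('e::real_vector \<Rightarrow> 'e \<Rightarrow> real) \<Rightarrow> enat" where
  "morse_index B = (SUP V\<in>{V. subspace V \<and> negative_definite_on B V}. extended_dim V)"

definition lagrangian :: "('e \<Rightarrow> real) \<Rightarrow> ('e \<Rightarrow> real^'m) \<Rightarrow> real^'m \<Rightarrow> 'e \<Rightarrow> real" where
  "lagrangian H F \<xi> u = H u - \<xi> \<bullet> F u"

end

theory Submission
  imports Defs
begin

text \<open>
Relative equilibria with velocity \<open>\<xi>\<close> are the critical points of \<open>L \<xi> = H - \<xi> \<bullet> F\<close>, that is, the zeros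
of the gradient \<open>g \<xi>\<close> of \<open>L \<xi>\<close> for the weaker scalar product, a \<open>C\<^sup>1\<close> map from \<open>E\<^sub>2\<close> to the completion.
Its linearisation at the given equilibrium \<open>u\<^sub>s\<close> is the Hessian operator \<open>A\<close>, which is symmetric but has
the kernel \<open>K\<close>, the tangent space of the orbit of \<open>u\<^sub>s\<close> under the isotropy group of \<open>F u\<^sub>s\<close>. The
implicit function theorem is therefore applied to the bordered equation
\<open>g \<xi> z + P (z - u\<^sub>s) = 0\<close> with \<open>P\<close> the orthogonal projection onto \<open>K\<close>. Two points need an argument.

The linearisation \<open>A + P\<close> is a bijection from \<open>E\<^sub>2\<close> onto the completion. This reduces to the solvability
of \<open>A w = f\<close> for every \<open>f\<close> orthogonal to \<open>K\<close>
(\<open>spectral_gap_finite_index_solvable\<close>, \<open>bordered_operator_bij\<close>). If \<open>(0, 2 * c)\<close> lies in the resolvent set, then \<open>R = (A - c)\<^sup>-\<^sup>1\<close> has norm at most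
\<open>1 / c\<close> (\<open>resolvent_norm_le\<close>), so that \<open>Q = A R = 1 + c R\<close> is a bounded positive operator, and
\<open>A R g \<bullet> R g \<ge> 0\<close> says exactly that \<open>Q g \<bullet> g \<le> \<parallel>Q g\<parallel>\<^sup>2\<close>. Since the Morse index is finite, this
holds on a subspace of finite codimension, on whose image \<open>Q\<close> is consequently bounded below
(\<open>positive_operator_range\<close>). Hence the range of \<open>Q\<close> is closed. The bounded inverse theorem makes the
inverse of \<open>A + P\<close> continuous.

The solutions \<open>u\<close> of the bordered equation are critical points. They satisfy \<open>g \<xi> u \<in> K\<close>, and by
the invariance of \<open>H\<close> and the constancy of \<open>F\<close> along the orbit of the isotropy group of \<open>F u\<close>, the
vector \<open>g \<xi> u\<close> is orthogonal to \<open>X \<eta> u\<close> for all \<open>\<eta>\<close> in the isotropy algebra of \<open>F u\<close>. As the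
isotropy algebras near \<open>F u\<^sub>s\<close> have constant dimension, they depend continuously on the base point, and
since the infinitesimal generators are skew-symmetric, a vector of \<open>K\<close> with this property vanishes
for \<open>u\<close> close to \<open>u\<^sub>s\<close> (\<open>tangent_orthogonal_to_nearby_orbit_eq_0\<close>).

Finally, differentiating \<open>H' (u\<^sub>\<xi>) - \<xi> \<bullet> F' (u\<^sub>\<xi>) = 0\<close> shows that a direction in which \<open>u\<^sub>\<xi>\<close> is
stationary annihilates the range of \<open>F' (u\<^sub>\<xi>)\<close>, which is the whole space by regularity; the same
equation recovers \<open>\<xi>\<close> from \<open>u\<^sub>\<xi>\<close> (\<open>critical_family_injective_immersion\<close>).
\<close>

section \<open>Bounded inverses and implicit functions in Banach spaces\<close>

text \<open>By Baire's theorem, the closure of the image of some ball about 0 has interior points, hence contains a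
ball about 0 after taking differences. So every \<open>y\<close> can be approximated up to half its norm by
the image of a vector of norm at most \<open>M * norm y\<close>; iterating on the error sums to a preimage.\<close>

lemma bounded_inverse:
  fixes f :: "'a::banach \<Rightarrow> 'b::banach"
  assumes "bounded_linear f" and "bij f"
  shows "bounded_linear (inv f)"
proof -
  interpret bounded_linear f by fact
  define A where "A n = closure (f ` ball 0 (real n))" for n
  have "UNIV = \<Union> (range A)"
  proof (rule UNIV_eq_I)
    fix y
    obtain x where x: "y = f x"
      using \<open>bij f\<close> bij_is_surj by (metis surjD)
    obtain n where "norm x < real n"
      using reals_Archimedean2 by blast
    then have "y \<in> f ` ball 0 (real n)"
      by (simp add: x)
    then have "y \<in> A n"
      unfolding A_def using closure_subset by (rule subsetD[rotated])
    then show "y \<in> \<Union> (range A)"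
      by blast
  qed
  then have "\<Union> (range A) = UNIV" ..
  moreover have "interior (\<Union> (range A)) = {}" if "\<And>n. interior (A n) = {}"
  proof (rule Met_TC.metric_Baire_category_alt[of "range A", unfolded mtopology_is_euclidean euclidean_interior_of closed_closedin[symmetric]])
    fix T assume "T \<in> range A"
    then show "closed T \<and> interior T = {}"
      using that by (metis A_def closed_closure rangeE)
  qed (simp_all only: mcomplete_iff_complete complete_UNIV countable_image uncountable_def[symmetric] countableI_type)
  ultimately obtain n where "interior (A n) \<noteq> {}"
    by (metis UNIV_not_empty interior_UNIV)
  then obtain y0 r where r: "r > 0" "ball y0 r \<subseteq> A n"
    by (metis all_not_in_conv mem_interior)
  have approx: "\<exists>x. norm x \<le> 2 * real n \<and> norm (y - f x) \<le> e"
    if y: "norm y < r" and e: "e > 0" for y e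
  proof -
    have e2: "e / 2 > 0"
      using e by simp
    have "y0 + y \<in> ball y0 r" "y0 \<in> ball y0 r"
      using y r(1) by (simp_all add: dist_norm)
    then have A: "y0 + y \<in> A n" "y0 \<in> A n"
      using r(2) by blast+
    obtain x1 where "norm x1 < real n" "dist (f x1) (y0 + y) < e / 2"
      using A(1) e2 unfolding A_def closure_approachable by (metis imageE mem_ball_0)
    moreover obtain x2 where "norm x2 < real n" "dist (f x2) y0 < e / 2"
      using A(2) e2 unfolding A_def closure_approachable by (metis imageE mem_ball_0)
    moreover have "norm (y - f (x1 - x2)) \<le> norm (y0 + y - f x1) + norm (f x2 - y0)"
      using norm_triangle_ineq[of "y0 + y - f x1" "f x2 - y0"] by (simp add: diff algebra_simps)
    moreover have "norm (x1 - x2) \<le> norm x1 + norm x2"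
      by (rule norm_triangle_ineq4)
    ultimately have "norm (x1 - x2) \<le> 2 * real n" "norm (y - f (x1 - x2)) \<le> e"
      unfolding dist_norm norm_minus_commute[of "f x1"] by linarith+
    then show ?thesis
      by blast
  qed
  \<comment> \<open>The vector \<open>y\<close> is rescaled to norm \<open>r / 2\<close>, approximated up to \<open>r / 4\<close>, and scaled back.\<close>
  define M where "M = 4 * real n / r"
  have step: "\<exists>x. norm x \<le> M * norm y \<and> norm (y - f x) \<le> norm y / 2" for y
  proof (cases "y = 0")
    case True
    then show ?thesis
      by (intro exI[of _ 0]) (simp add: zero)
  next
    case False
    define c where "c = r / (2 * norm y)"
    have c: "c > 0"
      using False r by (simp add: c_def)
    have "norm (c *\<^sub>R y) < r"
      using False r by (simp add: c_def)
    then obtain x where x: "norm x \<le> 2 * real n" "norm (c *\<^sub>R y - f x) \<le> r / 4"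
      using approx[of "c *\<^sub>R y" "r / 4"] r by auto
    have "c *\<^sub>R (y - f ((1 / c) *\<^sub>R x)) = c *\<^sub>R y - f x"
      using c by (simp add: scaleR scaleR_right_diff_distrib)
    then have "c * norm (y - f ((1 / c) *\<^sub>R x)) \<le> r / 4"
      using x(2) c by (metis abs_of_pos norm_scaleR)
    then have "norm (y - f ((1 / c) *\<^sub>R x)) \<le> norm y / 2"
      using c False r by (simp add: c_def field_simps)
    moreover have "norm ((1 / c) *\<^sub>R x) \<le> M * norm y"
      using x(1) c False r by (simp add: c_def M_def field_simps)
    ultimately show ?thesis
      by blast
  qed
  have "M \<ge> 0"
    using r by (simp add: M_def)
  obtain s where s: "\<And>y. norm (s y) \<le> M * norm y" "\<And>y. norm (y - f (s y)) \<le> norm y / 2"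
    using step by metis
  have bound: "norm (inv f y) \<le> norm y * (2 * M)" for y
  proof -
    define z where "z k = ((\<lambda>y. y - f (s y)) ^^ k) y" for k
    have z: "norm (z k) \<le> norm y * (1 / 2) ^ k" for k
    proof (induction k)
      case (Suc k)
      then show ?case
        using s(2)[of "z k"] by (simp add: z_def)
    qed (simp add: z_def)
    have sz: "norm (s (z k)) \<le> (M * norm y) * (1 / 2) ^ k" for k
      using order_trans[OF s(1)[of "z k"] mult_left_mono[OF z[of k] \<open>M \<ge> 0\<close>]]
      by (simp add: mult.assoc)
    have sum_geo: "(\<lambda>k. (M * norm y) * (1 / 2) ^ k) sums ((M * norm y) * 2)"
      using geometric_sums[of "1/2 :: real"] by (intro sums_mult) simp
    have sm: "summable (\<lambda>k. norm (s (z k)))"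
      by (rule summable_comparison_test'[of _ 0, OF sums_summable[OF sum_geo]])
        (use sz in \<open>simp only: real_norm_def abs_norm_cancel\<close>)
    define x where "x = (\<Sum>k. s (z k))"
    have x_sums: "(\<lambda>k. s (z k)) sums x"
      unfolding x_def by (rule summable_sums[OF summable_norm_cancel[OF sm]])
    have "norm x \<le> (\<Sum>k. norm (s (z k)))"
      unfolding x_def by (rule summable_norm[OF sm])
    also have "\<dots> \<le> (M * norm y) * 2"
      using suminf_le[OF sz sm sums_summable[OF sum_geo]] sums_unique[OF sum_geo] by simp
    finally have "norm x \<le> norm y * (2 * M)"
      by (simp add: ac_simps)
    moreover have "f x = y"
    proof -
      have "(\<Sum>k<n. f (s (z k))) = y - z n" for n
        by (induction n) (simp_all add: z_def)
      moreover have "(\<lambda>n. y - z n) \<longlonglongrightarrow> y - 0"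
      proof (intro tendsto_diff tendsto_const)
        have "(\<lambda>k. norm y * (1 / 2) ^ k) \<longlonglongrightarrow> norm y * 0"
          by (intro tendsto_mult_left LIMSEQ_realpow_zero) auto
        then show "z \<longlonglongrightarrow> 0"
          using z by (intro Lim_null_comparison[of z "\<lambda>k. norm y * (1 / 2) ^ k"]) auto
      qed
      ultimately have "(\<lambda>k. f (s (z k))) sums y"
        by (simp add: sums_def)
      then show "f x = y"
        using sums[OF x_sums] sums_unique2 by blast
    qed
    ultimately show ?thesis
      using \<open>bij f\<close> by (metis bij_is_inj inv_f_f)
  qed
  have "linear (inv f)"
  proof (rule linearI)
    show "inv f (x + y) = inv f x + inv f y" for x y
      using inv_f_f[OF bij_is_inj[OF \<open>bij f\<close>], of "inv f x + inv f y"] \<open>bij f\<close>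
      by (simp add: add bij_is_surj surj_f_inv_f)
    show "inv f (c *\<^sub>R x) = c *\<^sub>R inv f x" for c x
      using inv_f_f[OF bij_is_inj[OF \<open>bij f\<close>], of "c *\<^sub>R inv f x"] \<open>bij f\<close>
      by (simp add: scaleR bij_is_surj surj_f_inv_f)
  qed
  then show ?thesis
    using bound by (intro bounded_linear_intro) (auto simp: linear_add linear_scale)
qed

text \<open>A vanishing partial derivative makes \<open>N (\<xi>, _)\<close> a contraction with factor \<open>1 / 2\<close> near \<open>b\<close>, uniformly
in \<open>\<xi>\<close> near \<open>a\<close>. The derivative \<open>D\<close> of the fixed point is itself found as a fixed point, that of
\<open>D \<mapsto> N1 + N2 \<circ> D\<close> in the Banach space of bounded operators, and its continuous dependence on \<open>\<xi>\<close> follows from the same contraction estimate.\<close>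

lemma fixed_point_depends_C1:
  fixes N :: "'a::real_normed_vector \<times> 'b::banach \<Rightarrow> 'b"
    and N' :: "'a \<times> 'b \<Rightarrow> ('a \<times> 'b) \<Rightarrow>\<^sub>L 'b"
  assumes der: "\<And>z. (N has_derivative blinfun_apply (N' z)) (at z)"
    and cont: "continuous_on UNIV N'"
    and fixed: "N (a, b) = b"
    and stationary: "\<And>h. N' (a, b) (0, h) = 0"
  shows "\<exists>\<Omega> U. open \<Omega> \<and> a \<in> \<Omega> \<and> U a = b \<and> (\<forall>\<xi>\<in>\<Omega>. N (\<xi>, U \<xi>) = U \<xi>) \<and> C1_on \<Omega> U"
proof -
  obtain \<delta> where \<delta>: "\<delta> > 0" "\<And>z. dist z (a, b) < \<delta> \<Longrightarrow> dist (N' z) (N' (a, b)) < 1 / 2"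
    using cont unfolding continuous_on_iff by (metis UNIV_I half_gt_zero_iff zero_less_one)
  define M where "M = norm (N' (a, b)) + 1 / 2"
  have near: "dist (\<xi>, x) (a, b) < \<delta>" if "dist \<xi> a < \<delta> / 2" "dist x b \<le> \<delta> / 2" for \<xi> x
    using that sqrt_sum_squares_le_sum_abs[of "dist \<xi> a" "dist x b"] by (simp add: dist_Pair_Pair)
  have half: "norm (N' z (0, h)) \<le> 1 / 2 * norm h" if "dist z (a, b) < \<delta>" for z h
  proof -
    have "norm (N' z (0, h)) = norm ((N' z - N' (a, b)) (0, h))"
      by (simp add: blinfun.diff_left stationary)
    also have "\<dots> \<le> norm (N' z - N' (a, b)) * norm (0 :: 'a, h)"
      by (rule norm_blinfun)
    also have "\<dots> \<le> 1 / 2 * norm h"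
      using \<delta>(2)[OF that] by (intro mult_mono) (auto simp: dist_norm)
    finally show ?thesis .
  qed
  have M: "norm (N' z) \<le> M" if "dist z (a, b) < \<delta>" for z
    using \<delta>(2)[OF that] norm_triangle_ineq2[of "N' z" "N' (a, b)"] by (simp add: M_def dist_norm)
  have "M \<ge> 0"
    by (simp add: M_def)
  have contract: "norm (N (\<xi>, x) - N (\<xi>, y)) \<le> 1 / 2 * norm (x - y)"
    if "dist \<xi> a < \<delta> / 2" "x \<in> cball b (\<delta> / 2)" "y \<in> cball b (\<delta> / 2)" for \<xi> x y
  proof (rule differentiable_bound[of "cball b (\<delta> / 2)" _ "\<lambda>x h. N' (\<xi>, x) (0, h)"])
    fix x assume "x \<in> cball b (\<delta> / 2)"
    then have "dist (\<xi>, x) (a, b) < \<delta>"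
      using near that(1) by (simp add: dist_commute)
    then show "onorm (\<lambda>h. N' (\<xi>, x) (0, h)) \<le> 1 / 2"
      using half by (intro onorm_bound) auto
    have "((\<lambda>x. (\<xi>, x)) has_derivative (\<lambda>h. (0, h))) (at x within cball b (\<delta> / 2))"
      by (auto intro!: derivative_eq_intros)
    from has_derivative_in_compose[OF this has_derivative_at_withinI[OF der]]
    show "((\<lambda>x. N (\<xi>, x)) has_derivative (\<lambda>h. N' (\<xi>, x) (0, h))) (at x within cball b (\<delta> / 2))" .
  qed (use that in auto)
  have lip1: "norm (N (\<xi>, x) - N (\<zeta>, x)) \<le> M * norm (\<xi> - \<zeta>)"
    if "dist \<xi> a < \<delta> / 2" "dist \<zeta> a < \<delta> / 2" "x \<in> cball b (\<delta> / 2)" for \<xi> \<zeta> x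
  proof (rule differentiable_bound[of "ball a (\<delta> / 2)" _ "\<lambda>\<xi> h. N' (\<xi>, x) (h, 0)"])
    fix \<xi> assume "\<xi> \<in> ball a (\<delta> / 2)"
    then have "dist (\<xi>, x) (a, b) < \<delta>"
      using near that(3) by (simp add: dist_commute)
    then show "onorm (\<lambda>h. N' (\<xi>, x) (h, 0)) \<le> M"
      using order_trans[OF norm_blinfun mult_right_mono[OF M norm_ge_zero[of "(_, 0)"]]] \<open>M \<ge> 0\<close>
      by (intro onorm_bound) auto
    have "((\<lambda>\<xi>. (\<xi>, x)) has_derivative (\<lambda>h. (h, 0))) (at \<xi> within ball a (\<delta> / 2))"
      by (auto intro!: derivative_eq_intros)
    from has_derivative_in_compose[OF this has_derivative_at_withinI[OF der]]
    show "((\<lambda>\<xi>. N (\<xi>, x)) has_derivative (\<lambda>h. N' (\<xi>, x) (h, 0))) (at \<xi> within ball a (\<delta> / 2))" .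
  qed (use that in \<open>auto simp: dist_commute\<close>)
  define r where "r = min (\<delta> / 2) (\<delta> / (4 * (M + 1)))"
  define \<Omega> where "\<Omega> = ball a r"
  have "r > 0"
    using \<delta>(1) \<open>M \<ge> 0\<close> by (simp add: r_def)
  have \<Omega>: "dist \<xi> a < \<delta> / 2" "M * dist \<xi> a \<le> \<delta> / 4" if "\<xi> \<in> \<Omega>" for \<xi>
  proof -
    have *: "dist \<xi> a < \<delta> / (4 * (M + 1))" "dist \<xi> a < \<delta> / 2"
      using that by (auto simp: \<Omega>_def r_def dist_commute)
    then have "(M + 1) * dist \<xi> a \<le> \<delta> / 4"
      using \<open>M \<ge> 0\<close> by (simp add: field_simps)
    then show "M * dist \<xi> a \<le> \<delta> / 4"
      using zero_le_dist[of \<xi> a] unfolding distrib_right by linarith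
  qed (use that in \<open>auto simp: \<Omega>_def r_def dist_commute\<close>)
  have "\<exists>!x. x \<in> cball b (\<delta> / 2) \<and> N (\<xi>, x) = x" if \<xi>: "\<xi> \<in> \<Omega>" for \<xi>
  proof (rule Banach_fix[of _ "1 / 2"])
    show "complete (cball b (\<delta> / 2))"
      by (simp add: complete_eq_closed)
    show "(\<lambda>x. N (\<xi>, x)) ` cball b (\<delta> / 2) \<subseteq> cball b (\<delta> / 2)"
    proof clarify
      fix x assume x: "x \<in> cball b (\<delta> / 2)"
      have "norm (N (\<xi>, x) - b) \<le> norm (N (\<xi>, x) - N (\<xi>, b)) + norm (N (\<xi>, b) - N (a, b))"
        using norm_triangle_ineq[of "N (\<xi>, x) - N (\<xi>, b)" "N (\<xi>, b) - N (a, b)"] by (simp add: fixed)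
      also have "\<dots> \<le> 1 / 2 * norm (x - b) + M * norm (\<xi> - a)"
        using \<Omega>[OF \<xi>] x \<delta>(1) by (intro add_mono contract lip1) auto
      also have "\<dots> \<le> \<delta> / 2"
        using \<Omega>[OF \<xi>] x by (simp add: dist_norm norm_minus_commute)
      finally show "N (\<xi>, x) \<in> cball b (\<delta> / 2)"
        by (simp add: dist_norm norm_minus_commute)
    qed
  qed (use \<delta>(1) contract[OF \<Omega>(1)[OF \<xi>]] in \<open>auto simp: dist_norm\<close>)
  then obtain U where U: "\<And>\<xi>. \<xi> \<in> \<Omega> \<Longrightarrow> U \<xi> \<in> cball b (\<delta> / 2)" "\<And>\<xi>. \<xi> \<in> \<Omega> \<Longrightarrow> N (\<xi>, U \<xi>) = U \<xi>"
    and uniq: "\<And>\<xi> x. \<xi> \<in> \<Omega> \<Longrightarrow> x \<in> cball b (\<delta> / 2) \<Longrightarrow> N (\<xi>, x) = x \<Longrightarrow> x = U \<xi>"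
    by metis
  have "a \<in> \<Omega>"
    using \<open>r > 0\<close> by (simp add: \<Omega>_def)
  then have "U a = b"
    using uniq[of a b] fixed \<delta>(1) by simp
  have z: "dist (\<xi>, U \<xi>) (a, b) < \<delta>" if "\<xi> \<in> \<Omega>" for \<xi>
    using near[OF \<Omega>(1)[OF that]] U(1)[OF that] by (metis dist_commute mem_cball)
  have lip: "norm (U \<xi> - U \<zeta>) \<le> 2 * M * norm (\<xi> - \<zeta>)" if "\<xi> \<in> \<Omega>" "\<zeta> \<in> \<Omega>" for \<xi> \<zeta>
  proof -
    have "norm (U \<xi> - U \<zeta>) \<le> norm (N (\<xi>, U \<xi>) - N (\<xi>, U \<zeta>)) + norm (N (\<xi>, U \<zeta>) - N (\<zeta>, U \<zeta>))"
      using norm_triangle_ineq[of "N (\<xi>, U \<xi>) - N (\<xi>, U \<zeta>)" "N (\<xi>, U \<zeta>) - N (\<zeta>, U \<zeta>)"]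
      by (simp add: U that)
    also have "\<dots> \<le> 1 / 2 * norm (U \<xi> - U \<zeta>) + M * norm (\<xi> - \<zeta>)"
      using that U \<Omega> by (intro add_mono contract lip1) auto
    finally show ?thesis
      by simp
  qed
  have contU: "continuous_on \<Omega> U"
  proof (rule lipschitz_on_continuous_on[of "2 * M"])
    show "(2 * M)-lipschitz_on \<Omega> U"
      using lip \<open>M \<ge> 0\<close> by (auto simp: lipschitz_on_def dist_norm)
  qed
  define inl inr where "inl = Blinfun (\<lambda>h :: 'a. (h, 0 :: 'b))" and "inr = Blinfun (\<lambda>k :: 'b. (0 :: 'a, k))"
  have inl: "blinfun_apply inl h = (h, 0)" and inr: "blinfun_apply inr k = (0, k)" for h k
    unfolding inl_def inr_def
    by (simp_all add: bounded_linear_Blinfun_apply bounded_linear_Pair bounded_linear_ident bounded_linear_zero)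
  define N1 where "N1 \<xi> = N' (\<xi>, U \<xi>) o\<^sub>L inl" for \<xi>
  define N2 where "N2 \<xi> = N' (\<xi>, U \<xi>) o\<^sub>L inr" for \<xi>
  have split: "N' (\<xi>, U \<xi>) (h, k) = N1 \<xi> h + N2 \<xi> k" for \<xi> h k
    by (simp add: N1_def N2_def inl inr flip: blinfun.add_right)
  have N2: "norm (N2 \<xi>) \<le> 1 / 2" if "\<xi> \<in> \<Omega>" for \<xi>
    using half[OF z[OF that]] by (intro norm_blinfun_bound) (auto simp: N2_def inr)
  have "\<exists>D. N1 \<xi> + (N2 \<xi> o\<^sub>L D) = D" if "\<xi> \<in> \<Omega>" for \<xi>
  proof -
    have "\<exists>!D. N1 \<xi> + (N2 \<xi> o\<^sub>L D) = D"
    proof (rule banach_fix_type[of "1 / 2"]; (intro allI)?)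
      fix D1 D2
      have "dist (N1 \<xi> + (N2 \<xi> o\<^sub>L D1)) (N1 \<xi> + (N2 \<xi> o\<^sub>L D2)) = norm (N2 \<xi> o\<^sub>L (D1 - D2))"
        by (simp add: dist_norm bounded_bilinear.diff_right[OF bounded_bilinear_blinfun_compose])
      also have "\<dots> \<le> norm (N2 \<xi>) * norm (D1 - D2)"
        by (rule norm_blinfun_compose)
      also have "\<dots> \<le> 1 / 2 * norm (D1 - D2)"
        by (intro mult_right_mono N2 that) auto
      finally show "dist (N1 \<xi> + (N2 \<xi> o\<^sub>L D1)) (N1 \<xi> + (N2 \<xi> o\<^sub>L D2)) \<le> 1 / 2 * dist D1 D2"
        by (simp add: dist_norm)
    qed auto
    then show ?thesis
      by blast
  qed
  then obtain D where D: "\<And>\<xi>. \<xi> \<in> \<Omega> \<Longrightarrow> N1 \<xi> + (N2 \<xi> o\<^sub>L D \<xi>) = D \<xi>"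
    by metis
  have "open \<Omega>"
    by (simp add: \<Omega>_def)
  have derU: "(U has_derivative D \<xi>) (at \<xi>)" if \<xi>: "\<xi> \<in> \<Omega>" for \<xi>
    unfolding has_derivative_within_alt
  proof (intro conjI allI impI)
    fix e :: real assume "e > 0"
    define e' where "e' = e / (2 * (1 + 2 * M))"
    have "e' > 0"
      using \<open>e > 0\<close> \<open>M \<ge> 0\<close> by (simp add: e'_def)
    then obtain d where d: "d > 0" "\<And>z. norm (z - (\<xi>, U \<xi>)) < d \<Longrightarrow>
        norm (N z - N (\<xi>, U \<xi>) - N' (\<xi>, U \<xi>) (z - (\<xi>, U \<xi>))) \<le> e' * norm (z - (\<xi>, U \<xi>))"
      using der[of "(\<xi>, U \<xi>)"] unfolding has_derivative_within_alt by blast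
    obtain d2 where d2: "d2 > 0" "ball \<xi> d2 \<subseteq> \<Omega>"
      using \<open>open \<Omega>\<close> \<xi> open_contains_ball by blast
    show "\<exists>d>0. \<forall>\<zeta>\<in>UNIV. norm (\<zeta> - \<xi>) < d \<longrightarrow>
        norm (U \<zeta> - U \<xi> - blinfun_apply (D \<xi>) (\<zeta> - \<xi>)) \<le> e * norm (\<zeta> - \<xi>)"
    proof (intro exI[of _ "min d2 (d / (1 + 2 * M))"] conjI ballI impI)
      show "min d2 (d / (1 + 2 * M)) > 0"
        using d d2 \<open>M \<ge> 0\<close> by simp
      fix \<zeta> assume \<zeta>: "norm (\<zeta> - \<xi>) < min d2 (d / (1 + 2 * M))"
      then have "\<zeta> \<in> \<Omega>"
        using d2 by (auto simp: dist_norm norm_minus_commute subset_iff)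
      have zz: "norm ((\<zeta>, U \<zeta>) - (\<xi>, U \<xi>)) \<le> (1 + 2 * M) * norm (\<zeta> - \<xi>)"
        using norm_Pair_le[of "\<zeta> - \<xi>" "U \<zeta> - U \<xi>"] lip[OF \<open>\<zeta> \<in> \<Omega>\<close> \<xi>] by (simp add: algebra_simps)
      also have "\<dots> < d"
        using \<zeta> \<open>M \<ge> 0\<close> by (simp add: field_simps)
      finally have rem: "norm (N (\<zeta>, U \<zeta>) - N (\<xi>, U \<xi>) - N' (\<xi>, U \<xi>) ((\<zeta>, U \<zeta>) - (\<xi>, U \<xi>)))
          \<le> e' * norm ((\<zeta>, U \<zeta>) - (\<xi>, U \<xi>))" (is "norm ?rem \<le> _")
        by (rule d(2))
      define w where "w = U \<zeta> - U \<xi> - D \<xi> (\<zeta> - \<xi>)"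
      have DD: "D \<xi> h = N1 \<xi> h + N2 \<xi> (D \<xi> h)" for h
        using D[OF \<xi>] by (metis blinfun.add_left blinfun_apply_blinfun_compose)
      \<comment> \<open>Both \<open>U\<close> and \<open>D\<close> solve fixed point equations, so the error reproduces itself through \<open>N2\<close>,
        whose norm is at most \<open>1 / 2\<close>.\<close>
      have "w = ?rem + N2 \<xi> w"
        unfolding w_def using DD[of "\<zeta> - \<xi>"] U(2)[OF \<xi>] U(2)[OF \<open>\<zeta> \<in> \<Omega>\<close>]
        by (simp add: split blinfun.diff_right blinfun.add_right algebra_simps)
      then have "norm w \<le> norm ?rem + norm (N2 \<xi> w)"
        by (metis norm_triangle_ineq)
      also have "norm (N2 \<xi> w) \<le> 1 / 2 * norm w"
        using order_trans[OF norm_blinfun mult_right_mono[OF N2[OF \<xi>] norm_ge_zero]] by blast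
      finally have "norm w \<le> 2 * norm ?rem"
        by simp
      also have "\<dots> \<le> 2 * (e' * ((1 + 2 * M) * norm (\<zeta> - \<xi>)))"
        using rem zz \<open>e' > 0\<close> by (smt (verit) mult_left_mono)
      also have "\<dots> = e * norm (\<zeta> - \<xi>)"
        using \<open>M \<ge> 0\<close> by (simp add: e'_def field_simps)
      finally show "norm (U \<zeta> - U \<xi> - D \<xi> (\<zeta> - \<xi>)) \<le> e * norm (\<zeta> - \<xi>)"
        by (simp add: w_def)
    qed
  qed (rule blinfun.bounded_linear_right)
  have contN': "continuous_on \<Omega> (\<lambda>\<xi>. N' (\<xi>, U \<xi>))"
    by (rule continuous_on_compose2[OF cont]) (auto intro!: continuous_intros contU)
  have contN1: "continuous_on \<Omega> N1" and contN2: "continuous_on \<Omega> N2"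
    unfolding N1_def[abs_def] N2_def[abs_def]
    by (auto intro!: bounded_bilinear.continuous_on[OF bounded_bilinear_blinfun_compose] contN' continuous_intros)
  have "continuous_on \<Omega> D"
    unfolding continuous_on_def
  proof
    fix \<xi> assume \<xi>: "\<xi> \<in> \<Omega>"
    have tri: "norm (p + q + t) \<le> norm p + norm q + norm t" for p q t :: "'a \<Rightarrow>\<^sub>L 'b"
      using norm_triangle_ineq[of p q] norm_triangle_ineq[of "p + q" t] by linarith
    have bound: "norm (D \<zeta> - D \<xi>) \<le> 2 * (norm (N1 \<zeta> - N1 \<xi>) + norm (N2 \<zeta> - N2 \<xi>) * norm (D \<xi>))"
      if \<zeta>: "\<zeta> \<in> \<Omega>" for \<zeta>
    proof -
      have "D \<zeta> - D \<xi> = (N1 \<zeta> - N1 \<xi>) + ((N2 \<zeta> - N2 \<xi>) o\<^sub>L D \<xi>) + (N2 \<zeta> o\<^sub>L (D \<zeta> - D \<xi>))"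
        using D[OF \<xi>] D[OF \<zeta>]
        by (simp add: bounded_bilinear.diff_left[OF bounded_bilinear_blinfun_compose] bounded_bilinear.diff_right[OF bounded_bilinear_blinfun_compose] algebra_simps)
      then have "norm (D \<zeta> - D \<xi>) \<le>
          norm (N1 \<zeta> - N1 \<xi>) + norm ((N2 \<zeta> - N2 \<xi>) o\<^sub>L D \<xi>) + norm (N2 \<zeta> o\<^sub>L (D \<zeta> - D \<xi>))"
        using tri by metis
      also have "\<dots> \<le> norm (N1 \<zeta> - N1 \<xi>) + norm (N2 \<zeta> - N2 \<xi>) * norm (D \<xi>) + 1 / 2 * norm (D \<zeta> - D \<xi>)"
        by (intro add_mono order_refl norm_blinfun_compose
            order_trans[OF norm_blinfun_compose mult_right_mono[OF N2[OF \<zeta>] norm_ge_zero]])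
      finally show ?thesis
        by simp
    qed
    have "(N1 \<longlongrightarrow> N1 \<xi>) (at \<xi> within \<Omega>)" "(N2 \<longlongrightarrow> N2 \<xi>) (at \<xi> within \<Omega>)"
      using contN1 contN2 \<xi> by (auto simp: continuous_on_def)
    then have "((\<lambda>\<zeta>. 2 * (norm (N1 \<zeta> - N1 \<xi>) + norm (N2 \<zeta> - N2 \<xi>) * norm (D \<xi>))) \<longlongrightarrow>
        2 * (norm (N1 \<xi> - N1 \<xi>) + norm (N2 \<xi> - N2 \<xi>) * norm (D \<xi>))) (at \<xi> within \<Omega>)"
      by (intro tendsto_intros)
    then have "((\<lambda>\<zeta>. 2 * (norm (N1 \<zeta> - N1 \<xi>) + norm (N2 \<zeta> - N2 \<xi>) * norm (D \<xi>))) \<longlongrightarrow> 0) (at \<xi> within \<Omega>)"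
      by simp
    then have "((\<lambda>\<zeta>. D \<zeta> - D \<xi>) \<longlongrightarrow> 0) (at \<xi> within \<Omega>)"
      by (rule Lim_null_comparison[rotated])
        (rule eventually_at_filter[THEN iffD2], rule always_eventually, use bound in blast)
    then show "(D \<longlongrightarrow> D \<xi>) (at \<xi> within \<Omega>)"
      using LIM_zero_cancel by blast
  qed
  then have "C1_on \<Omega> U"
    unfolding C1_on_def using derU by blast
  then show ?thesis
    using \<open>open \<Omega>\<close> \<open>a \<in> \<Omega>\<close> \<open>U a = b\<close> U(2) by blast
qed

text \<open>A zero of \<open>f (\<xi>, _)\<close> is a fixed point of the simplified Newton iteration \<open>x \<mapsto> x - \<Lambda> (f (\<xi>, x))\<close>,
whose derivative in \<open>x\<close> vanishes at the base point.\<close>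

lemma implicit_function_C1:
  fixes f :: "'a::real_normed_vector \<times> 'b::banach \<Rightarrow> 'c::real_normed_vector"
    and \<Lambda> :: "'c \<Rightarrow>\<^sub>L 'b"
  assumes der: "\<And>z. (f has_derivative blinfun_apply (f' z)) (at z)"
    and cont: "continuous_on UNIV f'"
    and zero: "f (a, b) = 0"
    and left_inv: "\<And>h. \<Lambda> (f' (a, b) (0, h)) = h"
    and inj: "inj (blinfun_apply \<Lambda>)"
  shows "\<exists>\<Omega> U. open \<Omega> \<and> a \<in> \<Omega> \<and> U a = b \<and> (\<forall>\<xi>\<in>\<Omega>. f (\<xi>, U \<xi>) = 0) \<and> C1_on \<Omega> U"
proof -
  define S where "S = (Blinfun snd :: ('a \<times> 'b) \<Rightarrow>\<^sub>L 'b)"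
  have S: "blinfun_apply S z = snd z" for z
    unfolding S_def by (simp add: bounded_linear_Blinfun_apply bounded_linear_snd)
  define N where "N z = snd z - \<Lambda> (f z)" for z
  define N' where "N' z = S - (\<Lambda> o\<^sub>L f' z)" for z
  have "(N has_derivative blinfun_apply (N' z)) (at z)" for z
    unfolding N_def[abs_def] N'_def
    by (auto intro!: derivative_eq_intros der bounded_linear.has_derivative[OF blinfun.bounded_linear_right] simp: S blinfun.diff_left)
  moreover have "continuous_on UNIV N'"
    unfolding N'_def[abs_def]
    by (intro continuous_intros bounded_bilinear.continuous_on[OF bounded_bilinear_blinfun_compose] cont)
  ultimately have "\<exists>\<Omega> U. open \<Omega> \<and> a \<in> \<Omega> \<and> U a = b \<and> (\<forall>\<xi>\<in>\<Omega>. N (\<xi>, U \<xi>) = U \<xi>) \<and> C1_on \<Omega> U"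
    by (rule fixed_point_depends_C1) (auto simp: N_def N'_def zero left_inv S blinfun.diff_left)
  moreover have "N (\<xi>, x) = x \<longleftrightarrow> f (\<xi>, x) = 0" for \<xi> x
    using injD[OF inj, of "f (\<xi>, x)" 0] by (auto simp: N_def)
  ultimately show ?thesis
    by simp
qed

section \<open>Functions of class one and two\<close>

text \<open>The second difference \<open>\<Delta> v w s\<close> is symmetric in \<open>v\<close> and \<open>w\<close>, and by the mean value theorem in the
direction \<open>w\<close> it equals \<open>s\<^sup>2 * f'' v w\<close> up to an error \<open>o(s\<^sup>2)\<close>.\<close>

lemma second_derivative_symmetric:
  fixes f :: "'a::real_normed_vector \<Rightarrow> real"
  assumes der: "\<And>x. (f has_derivative blinfun_apply (f' x)) (at x)"
    and der2: "(f' has_derivative f'') (at u)"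
  shows "f'' v w = f'' w v"
proof -
  interpret f'': bounded_linear f''
    using der2 by (rule has_derivative_bounded_linear)
  define \<Delta> where "\<Delta> v w s = f (u + s *\<^sub>R v + s *\<^sub>R w) - f (u + s *\<^sub>R v) - f (u + s *\<^sub>R w) + f u"
    for v w and s :: real
  have lim: "((\<lambda>s. \<Delta> v w s / s\<^sup>2) \<longlongrightarrow> f'' v w) (at_right 0)" for v w
  proof (rule tendstoI)
    fix e :: real assume "e > 0"
    define m where "m = norm v + norm w"
    have "m \<ge> 0"
      by (simp add: m_def)
    define e' where "e' = e / (2 * (m + 1) * (norm w + 1))"
    have pos: "2 * (m + 1) * (norm w + 1) > 0"
      using \<open>m \<ge> 0\<close> norm_ge_zero[of w] by (intro mult_pos_pos) linarith+
    have "e' > 0"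
      using \<open>e > 0\<close> pos by (simp add: e'_def)
    then obtain d where d: "d > 0" "\<And>y. norm (y - u) < d \<Longrightarrow> norm (f' y - f' u - f'' (y - u)) \<le> e' * norm (y - u)"
      using der2 unfolding has_derivative_within_alt by blast
    have "dist (\<Delta> v w s / s\<^sup>2) (f'' v w) < e" if s: "0 < s" "s < d / (m + 1)" for s
    proof -
      define g where "g t = f (u + s *\<^sub>R v + t *\<^sub>R w) - f (u + t *\<^sub>R w)" for t
      have dg: "(g has_real_derivative (f' (u + s *\<^sub>R v + t *\<^sub>R w) w - f' (u + t *\<^sub>R w) w)) (at t)" for t
      proof -
        have "((\<lambda>t. f (y + t *\<^sub>R w)) has_derivative (\<lambda>h. f' (y + t *\<^sub>R w) (h *\<^sub>R w))) (at t)" for y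
          by (rule has_derivative_compose[OF _ der]) (auto intro!: derivative_eq_intros)
        then have "((\<lambda>t. f (y + t *\<^sub>R w)) has_real_derivative f' (y + t *\<^sub>R w) w) (at t)" for y
          by (simp add: has_field_derivative_def blinfun.scaleR_right mult.commute[of _ "blinfun_apply _ _"] cong: if_cong)
        then show ?thesis
          unfolding g_def[abs_def] by (intro derivative_intros)
      qed
      obtain t where t: "0 < t" "t < s"
        and gt: "g s - g 0 = (s - 0) * (f' (u + s *\<^sub>R v + t *\<^sub>R w) w - f' (u + t *\<^sub>R w) w)"
        using MVT2[OF \<open>0 < s\<close>, of g "\<lambda>t. f' (u + s *\<^sub>R v + t *\<^sub>R w) w - f' (u + t *\<^sub>R w) w"] dg by blast
      define R where "R h = f' (u + h) - f' u - f'' h" for h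
      have R: "norm (R h) \<le> e' * (s * m)" if "norm h \<le> s * m" for h
      proof -
        have "s * m < d"
          using s \<open>m \<ge> 0\<close> by (simp add: field_simps)
        then have "norm (R h) \<le> e' * norm h"
          using d(2)[of "u + h"] that by (simp add: R_def)
        then show ?thesis
          using that \<open>e' > 0\<close> by (meson less_imp_le mult_left_mono order_trans)
      qed
      have tw: "norm (t *\<^sub>R w) \<le> s * norm w"
        using t by (simp add: mult_right_mono)
      have 1: "norm (s *\<^sub>R v + t *\<^sub>R w) \<le> s * m"
        using norm_triangle_ineq[of "s *\<^sub>R v" "t *\<^sub>R w"] tw s by (simp add: m_def distrib_left)
      have 2: "norm (t *\<^sub>R w) \<le> s * m"
        using tw s by (simp add: m_def distrib_left add_increasing)
      have "f' (u + s *\<^sub>R v + t *\<^sub>R w) - f' (u + t *\<^sub>R w) = s *\<^sub>R f'' v + (R (s *\<^sub>R v + t *\<^sub>R w) - R (t *\<^sub>R w))"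
        by (simp add: R_def f''.add f''.scaleR add.assoc)
      then have "f' (u + s *\<^sub>R v + t *\<^sub>R w) w - f' (u + t *\<^sub>R w) w
          = s * f'' v w + (R (s *\<^sub>R v + t *\<^sub>R w) - R (t *\<^sub>R w)) w"
        by (metis blinfun.add_left blinfun.diff_left blinfun.scaleR_left real_scaleR_def)
      moreover have "\<Delta> v w s = g s - g 0"
        by (simp add: \<Delta>_def g_def)
      ultimately have \<Delta>: "\<Delta> v w s / s\<^sup>2 - f'' v w = (R (s *\<^sub>R v + t *\<^sub>R w) - R (t *\<^sub>R w)) w / s"
        using gt s by (simp add: field_simps power2_eq_square)
      have "\<bar>(R (s *\<^sub>R v + t *\<^sub>R w) - R (t *\<^sub>R w)) w\<bar> \<le> (2 * (e' * (s * m))) * norm w"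
        using order_trans[OF norm_blinfun[of "R (s *\<^sub>R v + t *\<^sub>R w) - R (t *\<^sub>R w)" w]
            mult_right_mono[OF order_trans[OF norm_triangle_ineq4 add_mono[OF R[OF 1] R[OF 2]]]]]
        by (simp add: mult.commute[of m])
      then have "\<bar>\<Delta> v w s / s\<^sup>2 - f'' v w\<bar> \<le> (2 * (e' * (s * m))) * norm w / s"
        unfolding \<Delta> abs_divide using s by (metis abs_of_pos divide_right_mono less_imp_le)
      also have "\<dots> = e' * (2 * m * norm w)"
        using s by simp
      also have "\<dots> < e' * (2 * (m + 1) * (norm w + 1))"
        using \<open>e' > 0\<close> \<open>m \<ge> 0\<close> by (intro mult_strict_left_mono) (auto simp: algebra_simps add_pos_nonneg)
      also have "\<dots> = e"
        using pos unfolding e'_def by (metis less_irrefl nonzero_eq_divide_eq)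
      finally show ?thesis
        by (simp add: dist_real_def)
    qed
    moreover have "\<forall>\<^sub>F s in at_right 0. s \<in> {0<..<d / (m + 1)}"
      using d(1) \<open>m \<ge> 0\<close> by (intro eventually_at_right_real) simp
    ultimately show "\<forall>\<^sub>F s in at_right 0. dist (\<Delta> v w s / s\<^sup>2) (f'' v w) < e"
      by (auto elim: eventually_mono)
  qed
  have "\<Delta> v w s = \<Delta> w v s" for s
    unfolding \<Delta>_def by (simp only: ac_simps)
  then have "((\<lambda>s. \<Delta> v w s / s\<^sup>2) \<longlongrightarrow> f'' w v) (at_right 0)"
    using lim[of w v] by simp
  then show ?thesis
    using tendsto_unique[OF trivial_limit_at_right_real lim[of v w]] by blast
qed

lemma C2_on_UNIV_derivatives:
  assumes "C2_on UNIV f"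
  obtains f' f'' where "\<And>x. (f has_derivative blinfun_apply (f' x)) (at x)"
    and "\<And>x. (f' has_derivative blinfun_apply (f'' x)) (at x)"
proof -
  obtain f' where f': "\<forall>x\<in>UNIV. (f has_derivative blinfun_apply (f' x)) (at x)" "C1_on UNIV f'"
    using assms unfolding C2_on_def by blast
  obtain f'' where f'': "\<forall>x\<in>UNIV. (f' has_derivative blinfun_apply (f'' x)) (at x)"
    using f'(2) unfolding C1_on_def by blast
  show thesis
    by (rule that[OF f'(1)[rule_format, OF UNIV_I] f''[rule_format, OF UNIV_I]])
qed

lemma second_deriv_eq:
  assumes "\<And>x. (f has_derivative blinfun_apply (f' x)) (at x)"
    and "(f' has_derivative f'') (at u)"
  shows "second_deriv f u v w = f'' v w"
proof -
  have "(\<lambda>x. Blinfun (frechet_derivative f (at x))) = f'"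
    by (simp only: frechet_derivative_at[OF assms(1), symmetric] blinfun_apply_inverse)
  moreover have "frechet_derivative f' (at u) = f''"
    using frechet_derivative_at[OF assms(2)] by simp
  ultimately show ?thesis
    by (simp add: second_deriv_def)
qed

lemma C1_on_subset: "C1_on S f \<Longrightarrow> T \<subseteq> S \<Longrightarrow> C1_on T f"
  unfolding C1_on_def using continuous_on_subset by blast

lemma C1_on_bounded_linear_compose:
  fixes g :: "'b::real_normed_vector \<Rightarrow> 'c::real_normed_vector"
  assumes "bounded_linear g" and "C1_on S f"
  shows "C1_on S (\<lambda>x. g (f x))"
proof -
  obtain f' where f': "\<And>x. x \<in> S \<Longrightarrow> (f has_derivative blinfun_apply (f' x)) (at x)" "continuous_on S f'"
    using assms(2) unfolding C1_on_def by blast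
  have g: "blinfun_apply (Blinfun g) = g"
    using assms(1) by (rule bounded_linear_Blinfun_apply)
  show ?thesis
    unfolding C1_on_def
  proof (intro exI conjI ballI)
    show "((\<lambda>x. g (f x)) has_derivative blinfun_apply (Blinfun g o\<^sub>L f' x)) (at x)" if "x \<in> S" for x
      using bounded_linear.has_derivative[OF assms(1) f'(1)[OF that]] by (simp add: g blinfun_compose.rep_eq comp_def)
    show "continuous_on S (\<lambda>x. Blinfun g o\<^sub>L f' x)"
      by (intro bounded_bilinear.continuous_on[OF bounded_bilinear_blinfun_compose] continuous_on_const f'(2))
  qed
qed

lemma C1_on_continuous_on: "C1_on S f \<Longrightarrow> continuous_on S f"
  unfolding C1_on_def by (meson continuous_at_imp_continuous_on has_derivative_continuous)

text \<open>With a bounded right inverse \<open>S\<close> of \<open>F' u\<close>, a vector \<open>\<eta>\<close> that annihilates the range of \<open>F' v\<close> satisfies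
\<open>\<parallel>\<eta>\<parallel>\<^sup>2 = \<eta> \<bullet> (F' u - F' v) (S \<eta>)\<close>, which is too small unless \<open>\<eta> = 0\<close>.\<close>

lemma regularity_open:
  fixes F' :: "'e::real_normed_vector \<Rightarrow> 'e \<Rightarrow>\<^sub>L 'k::euclidean_space"
  assumes "range (F' u) = UNIV" and "isCont F' u"
  shows "\<forall>\<^sub>F v in nhds u. \<forall>\<eta>. (\<forall>h. \<eta> \<bullet> F' v h = 0) \<longrightarrow> \<eta> = 0"
proof -
  obtain S where S: "linear S" "blinfun_apply (F' u) \<circ> S = id"
    using linear_surjective_right_inverse[OF _ assms(1)] bounded_linear.linear[OF blinfun.bounded_linear_right] by blast
  then have "bounded_linear S"
    by (simp add: linear_conv_bounded_linear)
  then obtain K where K: "K > 0" "\<And>\<eta>. norm (S \<eta>) \<le> norm \<eta> * K"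
    using bounded_linear.pos_bounded by blast
  have "\<forall>\<^sub>F v in nhds u. dist (F' v) (F' u) < 1 / K"
    using assms(2) K(1) unfolding continuous_within tendsto_iff eventually_at_filter
    by (auto elim!: eventually_mono allE[of _ "1 / K"])
  then show ?thesis
  proof (rule eventually_mono, intro allI impI)
    fix v \<eta> assume close: "dist (F' v) (F' u) < 1 / K" and zero: "\<forall>h. \<eta> \<bullet> F' v h = 0"
    have "F' u (S \<eta>) = \<eta>"
      using S(2) by (metis comp_apply id_apply)
    then have "(norm \<eta>)\<^sup>2 = \<eta> \<bullet> (F' u - F' v) (S \<eta>)"
      using zero by (simp add: blinfun.diff_left inner_diff_right power2_norm_eq_inner)
    also have "\<dots> \<le> norm \<eta> * norm ((F' u - F' v) (S \<eta>))"
      by (rule norm_cauchy_schwarz)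
    also have "\<dots> \<le> norm \<eta> * (norm (F' u - F' v) * (norm \<eta> * K))"
      using order_trans[OF norm_blinfun mult_left_mono[OF K(2) norm_ge_zero]]
      by (rule mult_left_mono) simp
    finally have le: "(norm \<eta>)\<^sup>2 \<le> (norm (F' v - F' u) * K) * (norm \<eta>)\<^sup>2"
      by (simp add: power2_eq_square norm_minus_commute ac_simps)
    have "norm (F' v - F' u) * K < 1"
      using close K(1) by (simp add: dist_norm field_simps)
    then show "\<eta> = 0"
      using le by (metis less_le_not_le mult_le_cancel_right1 not_le power_eq_0_iff norm_eq_zero zero_le_power2 zero_less_power2)
  qed
qed

text \<open>The equation \<open>H' (U \<xi>) = \<xi> \<bullet> F' (U \<xi>)\<close> determines \<open>\<xi>\<close> from \<open>U \<xi>\<close>, because \<open>\<xi>\<close> enters linearly through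
a surjective derivative. Differentiated along \<open>\<eta>\<close> with \<open>U' \<eta> = 0\<close>, all terms vanish except
\<open>\<eta> \<bullet> F' (U \<xi>)\<close>, which gives the immersion property for the same reason.\<close>

lemma critical_family_injective_immersion:
  fixes H' :: "'e::real_normed_vector \<Rightarrow> 'e \<Rightarrow>\<^sub>L real"
    and F' :: "'e \<Rightarrow> 'e \<Rightarrow>\<^sub>L 'k::euclidean_space"
  assumes H'': "\<And>x. (H' has_derivative blinfun_apply (H'' x)) (at x)"
    and F'': "\<And>x. (F' has_derivative blinfun_apply (F'' x)) (at x)"
    and U: "C1_on \<Omega> U" "open \<Omega>"
    and critical: "\<And>\<xi> h. \<xi> \<in> \<Omega> \<Longrightarrow> H' (U \<xi>) h - \<xi> \<bullet> F' (U \<xi>) h = 0"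
    and regular: "\<And>\<xi> \<eta>. \<xi> \<in> \<Omega> \<Longrightarrow> (\<And>h. \<eta> \<bullet> F' (U \<xi>) h = 0) \<Longrightarrow> \<eta> = 0"
  shows "inj_on U \<Omega>" and "\<forall>\<xi>\<in>\<Omega>. inj (frechet_derivative U (at \<xi>))"
proof -
  show "inj_on U \<Omega>"
  proof (rule inj_onI)
    fix \<xi> \<zeta> assume \<xi>: "\<xi> \<in> \<Omega>" "\<zeta> \<in> \<Omega>" "U \<xi> = U \<zeta>"
    have "(\<xi> - \<zeta>) \<bullet> F' (U \<xi>) h = 0" for h
      using critical[OF \<xi>(1), of h] critical[OF \<xi>(2), of h] by (simp add: \<xi>(3) inner_diff_left)
    then have "\<xi> - \<zeta> = 0"
      by (rule regular[OF \<xi>(1)])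
    then show "\<xi> = \<zeta>"
      by simp
  qed
  show "\<forall>\<xi>\<in>\<Omega>. inj (frechet_derivative U (at \<xi>))"
  proof
    fix \<xi> assume \<xi>: "\<xi> \<in> \<Omega>"
    obtain U' where "\<forall>\<xi>\<in>\<Omega>. (U has_derivative blinfun_apply (U' \<xi>)) (at \<xi>)"
      using U(1) unfolding C1_on_def by blast
    then have dU: "(U has_derivative blinfun_apply (U' \<xi>)) (at \<xi>)"
      using \<xi> by blast
    have "\<eta> = 0" if \<eta>: "U' \<xi> \<eta> = 0" for \<eta>
    proof (rule regular[OF \<xi>])
      fix h
      have 1: "((\<lambda>\<xi>. H' (U \<xi>)) has_derivative (\<lambda>\<eta>. H'' (U \<xi>) (U' \<xi> \<eta>))) (at \<xi>)"
        using dU H'' by (rule has_derivative_compose)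
      have 2: "((\<lambda>\<xi>. F' (U \<xi>)) has_derivative (\<lambda>\<eta>. F'' (U \<xi>) (U' \<xi> \<eta>))) (at \<xi>)"
        using dU F'' by (rule has_derivative_compose)
      have 3: "((\<lambda>\<xi>. H' (U \<xi>) h - \<xi> \<bullet> F' (U \<xi>) h) has_derivative
          (\<lambda>\<eta>. H'' (U \<xi>) (U' \<xi> \<eta>) h - (\<xi> \<bullet> F'' (U \<xi>) (U' \<xi> \<eta>) h + \<eta> \<bullet> F' (U \<xi>) h))) (at \<xi>)"
        by (intro has_derivative_diff has_derivative_inner has_derivative_ident
            bounded_linear.has_derivative[OF blinfun.bounded_linear_left] 1 2)
      have "((\<lambda>\<xi>. 0) has_derivative
          (\<lambda>\<eta>. H'' (U \<xi>) (U' \<xi> \<eta>) h - (\<xi> \<bullet> F'' (U \<xi>) (U' \<xi> \<eta>) h + \<eta> \<bullet> F' (U \<xi>) h))) (at \<xi>)"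
        using has_derivative_transform_within_open[OF 3 U(2) \<xi>] critical by auto
      then have "(\<lambda>\<eta>. H'' (U \<xi>) (U' \<xi> \<eta>) h - (\<xi> \<bullet> F'' (U \<xi>) (U' \<xi> \<eta>) h + \<eta> \<bullet> F' (U \<xi>) h)) = (\<lambda>_. 0)"
        using has_derivative_const by (rule has_derivative_unique)
      then have "H'' (U \<xi>) (U' \<xi> \<eta>) h - (\<xi> \<bullet> F'' (U \<xi>) (U' \<xi> \<eta>) h + \<eta> \<bullet> F' (U \<xi>) h) = 0"
        by (rule fun_cong)
      then show "\<eta> \<bullet> F' (U \<xi>) h = 0"
        by (simp add: \<eta> blinfun.zero_right blinfun.zero_left)
    qed
    then have "inj (blinfun_apply (U' \<xi>))"
      using linear_injective_0[OF bounded_linear.linear[OF blinfun.bounded_linear_right]] by blast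
    then show "inj (frechet_derivative U (at \<xi>))"
      by (simp add: frechet_derivative_at[OF dU, symmetric])
  qed
qed

section \<open>Closed subspaces of Hilbert spaces\<close>

text \<open>Minimising sequences for the distance to \<open>S\<close> are Cauchy by the parallelogram identity; at the minimiser
the first variation vanishes, which is the orthogonality.\<close>

lemma closed_subspace_projection:
  fixes S :: "'a::{real_inner,banach} set"
  assumes "closed S" and "subspace S"
  obtains P where "bounded_linear P" and "\<And>x. P x \<in> S" and "\<And>x s. s \<in> S \<Longrightarrow> (x - P x) \<bullet> s = 0"
proof -
  have "\<exists>p\<in>S. \<forall>s\<in>S. (x - p) \<bullet> s = 0" for x
  proof -
    define d where "d = infdist x S"
    have "S \<noteq> {}" "d \<ge> 0"
      using subspace_0[OF \<open>subspace S\<close>] by (auto simp: d_def infdist_nonneg)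
    have d: "d \<le> norm (x - s)" if "s \<in> S" for s
      using infdist_le[OF that, of x] by (simp add: d_def dist_norm)
    have "\<exists>s\<in>S. (norm (x - s))\<^sup>2 < d\<^sup>2 + 1 / real (Suc n)" for n
    proof -
      have "d < sqrt (d\<^sup>2 + 1 / real (Suc n))"
        using \<open>d \<ge> 0\<close> by (intro real_less_rsqrt) simp
      then obtain s where "s \<in> S" "norm (x - s) < sqrt (d\<^sup>2 + 1 / real (Suc n))"
        unfolding d_def infdist_notempty[OF \<open>S \<noteq> {}\<close>] using \<open>S \<noteq> {}\<close>
        by (subst (asm) cINF_less_iff) (auto simp: dist_norm intro!: bdd_belowI[of _ 0])
      moreover from this(2) have "(norm (x - s))\<^sup>2 < (sqrt (d\<^sup>2 + 1 / real (Suc n)))\<^sup>2"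
        by (intro power_strict_mono) auto
      ultimately show ?thesis
        by (auto simp: add_nonneg_nonneg)
    qed
    then obtain s where s: "\<And>n. s n \<in> S" "\<And>n. (norm (x - s n))\<^sup>2 < d\<^sup>2 + 1 / real (Suc n)"
      by metis
    have diff: "(norm (s m - s n))\<^sup>2 \<le> 2 * (1 / real (Suc m)) + 2 * (1 / real (Suc n))" for m n
    proof -
      have "(1 / 2) *\<^sub>R (s m + s n) \<in> S"
        using s(1) \<open>subspace S\<close> by (intro subspace_scale subspace_add)
      then have "d\<^sup>2 \<le> (norm (x - (1 / 2) *\<^sub>R (s m + s n)))\<^sup>2"
        using d \<open>d \<ge> 0\<close> by (intro power_mono)
      moreover have "(norm (s m - s n))\<^sup>2 + 4 * (norm (x - (1 / 2) *\<^sub>R (s m + s n)))\<^sup>2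
          = 2 * (norm (x - s m))\<^sup>2 + 2 * (norm (x - s n))\<^sup>2"
        by (simp add: power2_norm_eq_inner inner_diff inner_add inner_commute) (simp add: field_simps)
      ultimately show ?thesis
        using s(2)[of m] s(2)[of n] by linarith
    qed
    have "Cauchy s"
    proof (rule metric_CauchyI)
      fix e :: real assume "e > 0"
      then obtain N where N: "4 / e\<^sup>2 < real N"
        using reals_Archimedean2 by blast
      have "dist (s m) (s n) < e" if "m \<ge> N" "n \<ge> N" for m n
      proof -
        have N': "4 < e\<^sup>2 * real (Suc k)" if "k \<ge> N" for k
        proof -
          have "4 < e\<^sup>2 * real N"
            using N \<open>e > 0\<close> by (simp add: field_simps)
          also have "\<dots> \<le> e\<^sup>2 * real (Suc k)"
            using that by (intro mult_left_mono) auto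
          finally show ?thesis .
        qed
        have "2 * (1 / real (Suc k)) < e\<^sup>2 / 2" if "k \<ge> N" for k
          using N'[OF that] by (simp add: field_simps)
        from this[OF that(1)] this[OF that(2)] have "(norm (s m - s n))\<^sup>2 < e\<^sup>2"
          using diff[of m n] by linarith
        then show ?thesis
          using \<open>e > 0\<close> by (simp add: dist_norm power_less_imp_less_base)
      qed
      then show "\<exists>M. \<forall>m\<ge>M. \<forall>n\<ge>M. dist (s m) (s n) < e"
        by blast
    qed
    then obtain p where p: "s \<longlonglongrightarrow> p"
      using Cauchy_convergent convergent_def by blast
    have "p \<in> S"
      using \<open>closed S\<close> s(1) p by (rule closed_sequentially)
    have lim: "(\<lambda>n. d\<^sup>2 + 1 / real (Suc n)) \<longlonglongrightarrow> d\<^sup>2 + 0"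
      by (intro tendsto_add tendsto_const LIMSEQ_Suc[OF lim_1_over_n])
    have min: "(norm (x - p))\<^sup>2 \<le> d\<^sup>2"
    proof (rule tendsto_le[OF sequentially_bot _ tendsto_power[OF tendsto_norm[OF tendsto_diff[OF tendsto_const p]]]])
      show "(\<lambda>n. d\<^sup>2 + 1 / real (Suc n)) \<longlonglongrightarrow> d\<^sup>2"
        using lim by simp
      show "\<forall>\<^sub>F n in sequentially. (norm (x - s n))\<^sup>2 \<le> d\<^sup>2 + 1 / real (Suc n)"
        using s(2) by (intro always_eventually allI less_imp_le)
    qed
    have "(x - p) \<bullet> v = 0" if "v \<in> S" for v
    proof (rule ccontr)
      assume "(x - p) \<bullet> v \<noteq> 0"
      then have v: "v \<bullet> v > 0"
        by (cases "v = 0") auto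
      \<comment> \<open>The minimiser of \<open>t \<mapsto> \<parallel>x - (p + t v)\<parallel>\<^sup>2\<close>.\<close>
      define t where "t = ((x - p) \<bullet> v) / (v \<bullet> v)"
      have expand: "(norm (a - t *\<^sub>R v))\<^sup>2 = (norm a)\<^sup>2 - 2 * t * (a \<bullet> v) + t\<^sup>2 * (v \<bullet> v)" for a
        unfolding power2_norm_eq_inner
        by (simp add: inner_diff inner_commute power2_eq_square algebra_simps)
      have "p + t *\<^sub>R v \<in> S"
        using \<open>p \<in> S\<close> that \<open>subspace S\<close> by (intro subspace_add subspace_scale)
      then have "d\<^sup>2 \<le> (norm (x - (p + t *\<^sub>R v)))\<^sup>2"
        using d \<open>d \<ge> 0\<close> by (intro power_mono)
      also have "x - (p + t *\<^sub>R v) = (x - p) - t *\<^sub>R v"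
        by simp
      also have "(norm ((x - p) - t *\<^sub>R v))\<^sup>2 = (norm (x - p))\<^sup>2 - 2 * t * ((x - p) \<bullet> v) + t\<^sup>2 * (v \<bullet> v)"
        by (rule expand)
      also have "\<dots> = (norm (x - p))\<^sup>2 - ((x - p) \<bullet> v)\<^sup>2 / (v \<bullet> v)"
        unfolding t_def using v by (simp add: power2_eq_square divide_simps del: inner_diff_left)
      finally have "((x - p) \<bullet> v)\<^sup>2 / (v \<bullet> v) \<le> 0"
        using min by linarith
      moreover have "((x - p) \<bullet> v)\<^sup>2 / (v \<bullet> v) > 0"
        using v \<open>(x - p) \<bullet> v \<noteq> 0\<close> by (intro divide_pos_pos) auto
      ultimately show False
        by linarith
    qed
    then show ?thesis
      using \<open>p \<in> S\<close> by blast
  qed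
  then obtain P where P: "\<And>x. P x \<in> S" "\<And>x s. s \<in> S \<Longrightarrow> (x - P x) \<bullet> s = 0"
    by metis
  have uniq: "P x = p" if "p \<in> S" "\<And>s. s \<in> S \<Longrightarrow> (x - p) \<bullet> s = 0" for x p
  proof -
    have "p - P x \<in> S"
      using that(1) P(1) \<open>subspace S\<close> by (intro subspace_diff)
    then have "(x - P x) \<bullet> (p - P x) = 0" "(x - p) \<bullet> (p - P x) = 0"
      by (rule P(2), rule that(2))
    then have "(p - P x) \<bullet> (p - P x) = 0"
      by (simp add: inner_diff_left)
    then show ?thesis
      by simp
  qed
  have "P (x + y) = P x + P y" for x y
  proof (rule uniq)
    show "(x + y - (P x + P y)) \<bullet> s = 0" if "s \<in> S" for s
      using P(2)[OF that, of x] P(2)[OF that, of y] by (simp add: inner_diff_left inner_add_left)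
  qed (intro subspace_add \<open>subspace S\<close> P(1))
  moreover have "P (c *\<^sub>R x) = c *\<^sub>R P x" for c x
  proof (rule uniq)
    show "(c *\<^sub>R x - c *\<^sub>R P x) \<bullet> s = 0" if "s \<in> S" for s
      using P(2)[OF that, of x] by (simp flip: scaleR_diff_right)
  qed (intro subspace_scale \<open>subspace S\<close> P(1))
  moreover have "norm (P x) \<le> norm x * 1" for x
  proof -
    have "(norm (P x))\<^sup>2 = x \<bullet> P x"
      using P(2)[OF P(1), of x x] by (simp add: inner_diff_left power2_norm_eq_inner)
    also have "\<dots> \<le> norm x * norm (P x)"
      by (rule norm_cauchy_schwarz)
    finally show ?thesis
      by (cases "norm (P x) = 0") (auto simp: power2_eq_square)
  qed
  ultimately have "bounded_linear P"
    by (rule bounded_linear_intro)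
  then show thesis
    using P that by blast
qed

lemma subspace_closure:
  fixes S :: "'a::real_normed_vector set"
  assumes "subspace S"
  shows "subspace (closure S)"
proof (rule subspaceI)
  show "0 \<in> closure S"
    using subspace_0[OF assms] closure_subset by blast
  show "x + y \<in> closure S" if x: "x \<in> closure S" and y: "y \<in> closure S" for x y
  proof -
    obtain a b where a: "\<And>n. a n \<in> S" "a \<longlonglongrightarrow> x" and b: "\<And>n. b n \<in> S" "b \<longlonglongrightarrow> y"
      using x y unfolding closure_sequential by blast
    have "(\<lambda>n. a n + b n) \<longlonglongrightarrow> x + y"
      using a(2) b(2) by (rule tendsto_add)
    then show ?thesis
      unfolding closure_sequential using subspace_add[OF assms a(1) b(1)] by (intro exI conjI) auto
  qed
  show "c *\<^sub>R x \<in> closure S" if x: "x \<in> closure S" for c x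
  proof -
    obtain a where a: "\<And>n. a n \<in> S" "a \<longlonglongrightarrow> x"
      using x unfolding closure_sequential by blast
    have "(\<lambda>n. c *\<^sub>R a n) \<longlonglongrightarrow> c *\<^sub>R x"
      using tendsto_const a(2) by (rule tendsto_scaleR)
    then show ?thesis
      unfolding closure_sequential using subspace_scale[OF assms a(1)] by (intro exI conjI) auto
  qed
qed

text \<open>With \<open>P\<close> the projection onto \<open>S\<close> and \<open>q\<close> the component of \<open>x\<close> orthogonal to \<open>S\<close>, the sum consists of the
\<open>y\<close> for which \<open>y - P y\<close> is a multiple of \<open>q\<close>, and that is a closed condition (also when \<open>q = 0\<close>).\<close>

lemma closed_subspace_plus_line:
  fixes S :: "'a::{real_inner,banach} set"
  assumes "closed S" and "subspace S"
  shows "closed {s + c *\<^sub>R x | s c. s \<in> S}"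
proof -
  obtain P where P: "bounded_linear P" "\<And>x. P x \<in> S" "\<And>x s. s \<in> S \<Longrightarrow> (x - P x) \<bullet> s = 0"
    using closed_subspace_projection[OF assms] by blast
  interpret P: bounded_linear P by fact
  have PS: "P s = s" if "s \<in> S" for s
  proof -
    have "(s - P s) \<bullet> (s - P s) = 0"
      using that P(2) \<open>subspace S\<close> by (intro P(3) subspace_diff)
    then show ?thesis
      by (metis inner_eq_zero_iff right_minus_eq)
  qed
  define q where "q = x - P x"
  define k where "k y = ((y - P y) \<bullet> q) / (q \<bullet> q)" for y
  have "{s + c *\<^sub>R x | s c. s \<in> S} = {y. y - P y = k y *\<^sub>R q}"
  proof (intro subset_antisym subsetI)
    fix y assume "y \<in> {s + c *\<^sub>R x | s c. s \<in> S}"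
    then obtain s c where y: "y = s + c *\<^sub>R x" "s \<in> S"
      by blast
    then have "y - P y = c *\<^sub>R q"
      by (simp add: q_def P.add P.scaleR PS scaleR_diff_right)
    then show "y \<in> {y. y - P y = k y *\<^sub>R q}"
      by (cases "q = 0") (simp_all add: k_def)
  next
    fix y assume "y \<in> {y. y - P y = k y *\<^sub>R q}"
    then have "y = (P y - k y *\<^sub>R P x) + k y *\<^sub>R x"
      by (simp add: q_def algebra_simps)
    moreover have "P y - k y *\<^sub>R P x \<in> S"
      using P(2) \<open>subspace S\<close> by (intro subspace_diff subspace_scale)
    ultimately show "y \<in> {s + c *\<^sub>R x | s c. s \<in> S}"
      by blast
  qed
  moreover have "closed {y. y - P y = k y *\<^sub>R q}"
    unfolding k_def divide_inverse
    by (intro closed_Collect_eq continuous_intros linear_continuous_on P.bounded_linear_axioms)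
  ultimately show ?thesis
    by simp
qed

lemma closed_subspace_plus_span:
  fixes S :: "'a::{real_inner,banach} set"
  assumes "finite N" and "closed S" and "subspace S"
  shows "closed {s + t | s t. s \<in> S \<and> t \<in> span N}"
  using \<open>finite N\<close>
proof (induction N)
  case empty
  then show ?case
    using \<open>closed S\<close> by simp
next
  case (insert x N)
  have "{s + t | s t. s \<in> S \<and> t \<in> span (insert x N)}
      = {y + c *\<^sub>R x | y c. y \<in> {s + t | s t. s \<in> S \<and> t \<in> span N}}"
  proof (intro subset_antisym subsetI)
    fix y assume "y \<in> {s + t | s t. s \<in> S \<and> t \<in> span (insert x N)}"
    then obtain s t k where "y = s + t" "s \<in> S" "t - k *\<^sub>R x \<in> span N"
      unfolding span_insert by blast
    moreover from this(1) have "y = (s + (t - k *\<^sub>R x)) + k *\<^sub>R x"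
      by simp
    ultimately show "y \<in> {y + c *\<^sub>R x | y c. y \<in> {s + t | s t. s \<in> S \<and> t \<in> span N}}"
      by blast
  next
    fix y assume "y \<in> {y + c *\<^sub>R x | y c. y \<in> {s + t | s t. s \<in> S \<and> t \<in> span N}}"
    then obtain s t c where "y = s + (t + c *\<^sub>R x)" "s \<in> S" "t \<in> span N"
      by (auto simp: add.assoc)
    moreover from this(3) have "t + c *\<^sub>R x \<in> span (insert x N)"
      unfolding span_insert by (simp add: exI[of _ c])
    ultimately show "y \<in> {s + t | s t. s \<in> S \<and> t \<in> span (insert x N)}"
      by blast
  qed
  then show ?case
    using closed_subspace_plus_line[OF insert.IH subspace_sums[OF \<open>subspace S\<close> subspace_span]] by simp
qed

lemma closed_linear_image_subspace:
  fixes f :: "'a::euclidean_space \<Rightarrow> 'h::{real_inner,banach}"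
  assumes "linear f" and "subspace S"
  shows "closed (f ` S)"
proof -
  obtain N where N: "N \<subseteq> S" "independent N" "S \<subseteq> span N"
    using basis_exists[of S] by metis
  have "finite N"
    by (rule independent_imp_finite[OF N(2)])
  have "span N = S"
    by (rule span_subspace[OF N(1,3) assms(2)])
  then have "f ` S = span (f ` N)"
    by (simp only: linear_span_image[OF assms(1)])
  also have "\<dots> = {s + t | s t. s \<in> {0} \<and> t \<in> span (f ` N)}"
    by simp
  finally have "f ` S = {s + t | s t. s \<in> {0} \<and> t \<in> span (f ` N)}" .
  then show ?thesis
    using closed_subspace_plus_span[of "f ` N" "{0 :: 'h}"] \<open>finite N\<close> subspace_single_0 by simp
qed

text \<open>If every vector of \<open>W\<close> is relatively close to \<open>V\<close>, then the orthogonal projection onto \<open>V\<close> is injective on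
\<open>W\<close>, hence onto \<open>V\<close> when the dimensions agree. This converts upper into lower semicontinuity.\<close>

lemma subspace_approx_converse:
  fixes V W :: "'a::euclidean_space set"
  assumes "subspace V" "subspace W" "dim W = dim V" and e: "0 \<le> e" "e \<le> 1 / 2"
    and near: "\<And>\<eta>. \<eta> \<in> W \<Longrightarrow> \<exists>\<zeta>\<in>V. norm (\<eta> - \<zeta>) \<le> e * norm \<eta>"
    and "\<zeta> \<in> V"
  shows "\<exists>\<eta>\<in>W. norm (\<eta> - \<zeta>) \<le> 2 * e * norm \<zeta>"
proof -
  obtain P where P: "bounded_linear P" "\<And>x. P x \<in> V" "\<And>x s. s \<in> V \<Longrightarrow> (x - P x) \<bullet> s = 0"
    using closed_subspace_projection[OF closed_subspace[OF \<open>subspace V\<close>] \<open>subspace V\<close>] by blast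
  interpret P: bounded_linear P by fact
  have P_near: "norm (\<eta> - P \<eta>) \<le> e * norm \<eta>" if "\<eta> \<in> W" for \<eta>
  proof -
    obtain \<zeta> where \<zeta>: "\<zeta> \<in> V" "norm (\<eta> - \<zeta>) \<le> e * norm \<eta>"
      using near[OF \<open>\<eta> \<in> W\<close>] by blast
    have "P \<eta> - \<zeta> \<in> V"
      using P(2) \<zeta>(1) \<open>subspace V\<close> by (intro subspace_diff)
    then have "orthogonal (\<eta> - P \<eta>) (P \<eta> - \<zeta>)"
      unfolding orthogonal_def by (rule P(3))
    then have "(norm (\<eta> - \<zeta>))\<^sup>2 = (norm (\<eta> - P \<eta>))\<^sup>2 + (norm (P \<eta> - \<zeta>))\<^sup>2"
      using norm_add_Pythagorean[of "\<eta> - P \<eta>" "P \<eta> - \<zeta>"] by simp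
    then have "(norm (\<eta> - P \<eta>))\<^sup>2 \<le> (norm (\<eta> - \<zeta>))\<^sup>2"
      by simp
    then have "norm (\<eta> - P \<eta>) \<le> norm (\<eta> - \<zeta>)"
      by (rule power2_le_imp_le) simp
    then show ?thesis
      using \<zeta>(2) by linarith
  qed
  have half: "e * norm \<eta> \<le> norm \<eta> / 2" for \<eta> :: 'a
    using e mult_right_mono[of e "1 / 2" "norm \<eta>"] by simp
  have "inj_on P (span W)"
    unfolding span_eq_iff[THEN iffD2, OF \<open>subspace W\<close>]
  proof (rule inj_onI)
    fix x y assume xy: "x \<in> W" "y \<in> W" "P x = P y"
    then have "norm (x - y) \<le> e * norm (x - y)"
      using P_near[of "x - y"] subspace_diff[OF \<open>subspace W\<close>] by (simp add: P.diff)
    then have "norm (x - y) \<le> norm (x - y) / 2"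
      using half[of "x - y"] by linarith
    then show "x = y"
      by simp
  qed
  then have "dim (P ` W) = dim V"
    using eucl.dim_image_eq[OF P.linear_axioms] \<open>dim W = dim V\<close> by simp
  moreover have "subspace (P ` W)"
    using \<open>subspace W\<close> by (rule linear_subspace_image[OF P.linear_axioms])
  ultimately have "P ` W = V"
    using P(2) \<open>subspace V\<close> by (intro subspace_dim_equal) auto
  then obtain \<eta> where \<eta>: "\<eta> \<in> W" "\<zeta> = P \<eta>"
    using \<open>\<zeta> \<in> V\<close> by blast
  have "norm \<eta> \<le> norm \<zeta> + norm (\<eta> - P \<eta>)"
    using norm_triangle_ineq[of "P \<eta>" "\<eta> - P \<eta>"] by (simp add: \<eta>(2))
  then have "norm \<eta> \<le> 2 * norm \<zeta>"
    using P_near[OF \<eta>(1)] half[of \<eta>] by linarith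
  then have "e * norm \<eta> \<le> e * (2 * norm \<zeta>)"
    using e(1) by (rule mult_left_mono)
  then have "norm (\<eta> - \<zeta>) \<le> 2 * e * norm \<zeta>"
    using P_near[OF \<eta>(1)] by (simp add: \<eta>(2))
  then show ?thesis
    using \<eta>(1) by blast
qed

section \<open>Symmetric operators with a spectral gap and finite index\<close>

text \<open>The form may be degenerate, so that the inequality for inner products does not apply.\<close>

lemma positive_form_Cauchy_Schwarz:
  fixes b :: "'a::real_vector \<Rightarrow> 'a \<Rightarrow> real"
  assumes "bilinear b" and sym: "\<And>x y. b x y = b y x" and pos: "\<And>x. b x x \<ge> 0"
  shows "(b x y)\<^sup>2 \<le> b x x * b y y"
proof -
  have quad: "0 \<le> b x x + 2 * t * b x y + t\<^sup>2 * b y y" for t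
    using pos[of "x + t *\<^sub>R y"] sym[of y x] \<open>bilinear b\<close>
    by (simp add: bilinear_ladd bilinear_radd bilinear_lmul bilinear_rmul power2_eq_square algebra_simps)
  show ?thesis
  proof (cases "b y y = 0")
    case True
    \<comment> \<open>The quadratic polynomial in \<open>quad\<close> is then affine and nonnegative, hence constant.\<close>
    have "b x y = 0"
    proof (rule ccontr)
      assume "b x y \<noteq> 0"
      then have "2 * (- (b x x + 1) / (2 * b x y)) * b x y = - (b x x + 1)"
        by simp
      then show False
        using quad[of "- (b x x + 1) / (2 * b x y)"] unfolding True by simp
    qed
    then show ?thesis
      by (simp add: True)
  next
    case False
    then have y: "b y y > 0"
      using pos[of y] by simp
    have "b x x + 2 * (- b x y / b y y) * b x y + (- b x y / b y y)\<^sup>2 * b y y = b x x - (b x y)\<^sup>2 / b y y"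
      using y by (simp add: power2_eq_square field_simps)
    then have "(b x y)\<^sup>2 / b y y \<le> b x x"
      using quad[of "- b x y / b y y"] by linarith
    then show ?thesis
      using y by (simp add: field_simps)
  qed
qed

text \<open>The inequality \<open>Q g \<bullet> g \<le> \<parallel>Q g\<parallel>\<^sup>2\<close> says that the part of \<open>Q\<close> on \<open>W\<close> has, roughly, no spectrum in
\<open>(0, 1)\<close>. Cauchy-Schwarz for the form of \<open>Q\<close>, applied to \<open>g\<close> and \<open>z = Q g\<close>, turns it into
\<open>\<parallel>z\<parallel>\<^sup>2 \<le> Q z \<bullet> z\<close>. So \<open>Q\<close> is bounded below on the closure \<open>Z\<close> of \<open>Q ` W\<close>, and \<open>Q ` Z\<close> is closed. The range
of \<open>Q\<close> exceeds \<open>Q ` Z\<close> by a finite-dimensional space only, so it is closed as well, and a symmetric operator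
with closed range hits everything that is orthogonal to its kernel.\<close>

lemma positive_operator_range:
  fixes Q :: "'h::{real_inner,banach} \<Rightarrow> 'h"
  assumes "bounded_linear Q"
    and sym: "\<And>x y. Q x \<bullet> y = x \<bullet> Q y"
    and pos: "\<And>x. Q x \<bullet> x \<ge> 0"
    and "subspace W" and "finite N"
    and decomp: "\<And>x. \<exists>w\<in>W. \<exists>n\<in>span N. x = w + n"
    and le: "\<And>g. g \<in> W \<Longrightarrow> Q g \<bullet> g \<le> (norm (Q g))\<^sup>2"
    and orth: "\<And>k. Q k = 0 \<Longrightarrow> f \<bullet> k = 0"
  shows "f \<in> range Q"
proof -
  interpret Q: bounded_linear Q by fact
  have CS: "(Q x \<bullet> y)\<^sup>2 \<le> (Q x \<bullet> x) * (Q y \<bullet> y)" for x y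
  proof (rule positive_form_Cauchy_Schwarz)
    show "bilinear (\<lambda>x y. Q x \<bullet> y)"
      unfolding bilinear_def
      by (auto intro!: linearI simp: Q.add Q.scaleR inner_add_left inner_add_right)
    show "Q x \<bullet> y = Q y \<bullet> x" for x y
      using sym[of x y] by (simp add: inner_commute)
  qed (rule pos)
  define Z where "Z = closure (Q ` W)"
  have "norm z \<le> norm (Q z)" if z: "z \<in> Q ` W" for z
  proof (cases "z = 0")
    case False
    obtain g where g: "g \<in> W" "z = Q g"
      using z by blast
    have "((norm z)\<^sup>2)\<^sup>2 = (Q g \<bullet> z)\<^sup>2"
      by (simp add: g(2) power2_norm_eq_inner)
    also have "\<dots> \<le> (Q g \<bullet> g) * (Q z \<bullet> z)"
      by (rule CS)
    also have "\<dots> \<le> (norm z)\<^sup>2 * (Q z \<bullet> z)"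
      using le[OF g(1)] pos[of z] unfolding g(2)[symmetric] by (intro mult_right_mono)
    finally have "(norm z)\<^sup>2 \<le> Q z \<bullet> z"
      using False by (simp add: power2_eq_square)
    also have "\<dots> \<le> norm (Q z) * norm z"
      by (rule norm_cauchy_schwarz)
    finally show ?thesis
      using False by (simp add: power2_eq_square)
  qed simp
  then have "Z \<subseteq> {z. norm z \<le> norm (Q z)}"
    unfolding Z_def
    by (intro closure_minimal subsetI closed_Collect_le continuous_intros linear_continuous_on Q.bounded_linear_axioms)
      simp
  then have Z: "norm z \<le> norm (Q z)" if "z \<in> Z" for z
    using that by blast
  have subspaceQ: "subspace (Q ` X)" if "subspace X" for X
    using that Q.linear_axioms by (intro linear_subspace_image)
  have "subspace Z"
    unfolding Z_def by (intro subspace_closure subspaceQ \<open>subspace W\<close>)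
  have "complete (Q ` Z)"
    using complete_isometric_image[of 1 Z Q] Z \<open>subspace Z\<close> Q.bounded_linear_axioms
    by (simp add: Z_def complete_eq_closed)
  then have "closed (Q ` Z)"
    by (rule complete_imp_closed)
  have subspace_range: "subspace (range Q)"
    by (rule subspaceQ) (rule subspace_UNIV)
  define Y where "Y = closure (range Q)"
  have Y: "Y \<subseteq> {s + t | s t. s \<in> Z \<and> t \<in> span (Q ` N)}"
    unfolding Y_def
  proof (rule closure_minimal)
    show "closed {s + t | s t. s \<in> Z \<and> t \<in> span (Q ` N)}"
      using \<open>finite N\<close> \<open>subspace Z\<close> by (intro closed_subspace_plus_span) (auto simp: Z_def)
    show "range Q \<subseteq> {s + t | s t. s \<in> Z \<and> t \<in> span (Q ` N)}"
    proof (intro subsetI)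
      fix y assume "y \<in> range Q"
      then obtain x where x: "y = Q x"
        by blast
      obtain w n where w: "w \<in> W" "n \<in> span N" "x = w + n"
        using decomp[of x] by blast
      from w(1,2) have "Q w \<in> Z" "Q n \<in> span (Q ` N)"
        using closure_subset[of "Q ` W"] linear_span_image[OF Q.linear_axioms, of N] by (auto simp: Z_def)
      moreover have "y = Q w + Q n"
        by (simp add: x w(3) Q.add)
      ultimately show "y \<in> {s + t | s t. s \<in> Z \<and> t \<in> span (Q ` N)}"
        by blast
    qed
  qed
  \<comment> \<open>A symmetric operator annihilates the orthogonal complement of its range.\<close>
  have QY: "range Q = Q ` Y"
  proof (intro subset_antisym subsetI)
    fix y assume "y \<in> range Q"
    then obtain x where x: "y = Q x"
      by blast
    obtain P where P: "bounded_linear P" "\<And>x. P x \<in> Y" "\<And>x s. s \<in> Y \<Longrightarrow> (x - P x) \<bullet> s = 0"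
      using closed_subspace_projection[of Y] subspace_closure[OF subspace_range] by (auto simp: Y_def)
    have "(x - P x) \<bullet> Q (Q (x - P x)) = 0"
      using closure_subset[of "range Q"] by (intro P(3)) (auto simp: Y_def)
    then have "Q (x - P x) = 0"
      using sym[of "x - P x" "Q (x - P x)"] by simp
    then show "y \<in> Q ` Y"
      using x P(2) by (simp add: Q.diff)
  qed blast
  have "range Q = {s + t | s t. s \<in> Q ` Z \<and> t \<in> span (Q ` Q ` N)}"
  proof (intro subset_antisym subsetI)
    fix y assume "y \<in> range Q"
    then obtain x where x: "y = Q x" "x \<in> Y"
      unfolding QY by blast
    then obtain s t where st: "x = s + t" "s \<in> Z" "t \<in> span (Q ` N)"
      using Y by blast
    have "Q t \<in> span (Q ` Q ` N)"
      using st(3) linear_span_image[OF Q.linear_axioms, of "Q ` N"] by blast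
    moreover have "y = Q s + Q t"
      by (simp add: x(1) st(1) Q.add)
    ultimately show "y \<in> {s + t | s t. s \<in> Q ` Z \<and> t \<in> span (Q ` Q ` N)}"
      using st(2) by blast
  next
    fix y assume "y \<in> {s + t | s t. s \<in> Q ` Z \<and> t \<in> span (Q ` Q ` N)}"
    then obtain s t where y: "y = s + t" "s \<in> Q ` Z" "t \<in> span (Q ` Q ` N)"
      by blast
    have "span (Q ` Q ` N) \<subseteq> range Q"
      by (intro span_minimal subspace_range) blast
    then show "y \<in> range Q"
      using y subspace_add[OF subspace_range] by blast
  qed
  then have "closed (range Q)"
    using closed_subspace_plus_span[OF _ \<open>closed (Q ` Z)\<close> subspaceQ[OF \<open>subspace Z\<close>], of "Q ` Q ` N"]
      \<open>finite N\<close> by simp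
  then obtain P where P: "bounded_linear P" "\<And>x. P x \<in> range Q" "\<And>x s. s \<in> range Q \<Longrightarrow> (x - P x) \<bullet> s = 0"
    using closed_subspace_projection[OF _ subspace_range] by blast
  have "(f - P f) \<bullet> Q (Q (f - P f)) = 0"
    by (intro P(3)) blast
  then have "Q (f - P f) = 0"
    using sym[of "f - P f" "Q (f - P f)"] by simp
  then have "(f - P f) \<bullet> f = 0"
    using orth[of "f - P f"] by (simp add: inner_commute)
  moreover have "(f - P f) \<bullet> P f = 0"
    by (intro P(3) P(2))
  ultimately have "(f - P f) \<bullet> (f - P f) = 0"
    unfolding inner_diff_right[of "f - P f"] by simp
  then have "P f = f"
    by (metis inner_eq_zero_iff right_minus_eq)
  then show ?thesis
    using P(2)[of f] by (simp only:)
qed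

text \<open>If \<open>\<rho> = norm R\<close> exceeded \<open>1 / c\<close>, both points \<open>c \<plusminus> 1 / \<rho>\<close> would lie in \<open>(0, 2 * c)\<close>, hence in the resolvent
set, and \<open>\<rho> - R\<close> and \<open>\<rho> + R\<close> would be bounded below. So would be their product \<open>\<rho>\<^sup>2 - R\<^sup>2\<close>, which is
impossible for a symmetric \<open>R\<close>: this product is small on vectors that almost realise the norm of \<open>R\<close>.\<close>

lemma resolvent_norm_le:
  fixes A :: "'h::real_inner \<rightharpoonup> 'h" and R :: "'h \<Rightarrow>\<^sub>L 'h"
  assumes c: "c > 0"
    and gap: "\<And>s. 0 < s \<Longrightarrow> s < 2 * c \<Longrightarrow> s \<in> resolvent_set A"
    and R: "\<And>y. R y \<in> dom A" "\<And>y. the (A (R y)) - c *\<^sub>R R y = y"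
    and sym: "\<And>x y. R x \<bullet> y = x \<bullet> R y"
  shows "norm R \<le> 1 / c"
proof (rule ccontr)
  define \<rho> where "\<rho> = norm R"
  assume "\<not> norm R \<le> 1 / c"
  then have \<rho>: "1 / c < \<rho>"
    by (simp add: \<rho>_def)
  then have "\<rho> > 0"
    using c by (metis divide_pos_pos less_trans zero_less_one)
  define e where "e = 1 / \<rho>"
  have e: "0 < e" "e < c" "e * \<rho> = 1"
    using \<rho> \<open>\<rho> > 0\<close> c by (simp_all add: e_def field_simps)
  have below: "\<exists>K>0. \<forall>y. norm y \<le> K * norm (y - t *\<^sub>R R y)" if t: "\<bar>t\<bar> = e" for t
  proof -
    have "0 < c + t" "c + t < 2 * c"
      using t e by linarith+
    then obtain R' :: "'h \<Rightarrow>\<^sub>L 'h" where R': "\<And>x. x \<in> dom A \<Longrightarrow> R' (the (A x) - (c + t) *\<^sub>R x) = x"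
      using gap[of "c + t"] unfolding resolvent_set_def by blast
    have "norm y \<le> (1 + e * norm R') * norm (y - t *\<^sub>R R y)" for y
    proof -
      have "the (A (R y)) - (c + t) *\<^sub>R R y = y - t *\<^sub>R R y"
        using R(2)[of y] by (simp add: algebra_simps)
      then have R'y: "R' (y - t *\<^sub>R R y) = R y"
        using R'[OF R(1)[of y]] by simp
      have "norm y \<le> norm (y - t *\<^sub>R R y) + norm (t *\<^sub>R R' (y - t *\<^sub>R R y))"
        using norm_triangle_ineq[of "y - t *\<^sub>R R y" "t *\<^sub>R R y"] unfolding R'y by simp
      also have "norm (t *\<^sub>R R' (y - t *\<^sub>R R y)) \<le> e * (norm R' * norm (y - t *\<^sub>R R y))"
        unfolding norm_scaleR t using e(1) by (intro mult_left_mono norm_blinfun) simp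
      finally show ?thesis
        by (simp add: algebra_simps)
    qed
    moreover have "1 + e * norm R' > 0"
      using e(1) by (simp add: add_pos_nonneg)
    ultimately show ?thesis
      by blast
  qed
  obtain K1 where K1: "K1 > 0" "\<And>y. norm y \<le> K1 * norm (y - e *\<^sub>R R y)"
    using below[of e] e(1) by auto
  obtain K2 where K2: "K2 > 0" "\<And>y. norm y \<le> K2 * norm (y - (- e) *\<^sub>R R y)"
    using below[of "- e"] e(1) by auto
  define K where "K = K2 * K1"
  have "K > 0"
    using K1 K2 by (simp add: K_def)
  \<comment> \<open>\<open>1 - e\<^sup>2 R\<^sup>2 = (1 - e R) (1 + e R)\<close> is bounded below, and \<open>\<parallel>y - e\<^sup>2 R\<^sup>2 y\<parallel>\<^sup>2 \<le> \<parallel>y\<parallel>\<^sup>2 - e\<^sup>2 \<parallel>R y\<parallel>\<^sup>2\<close>.\<close>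
  have K: "(norm y)\<^sup>2 \<le> K\<^sup>2 * ((norm y)\<^sup>2 - e\<^sup>2 * (norm (R y))\<^sup>2)" for y
  proof -
    define z where "z = y - (- e) *\<^sub>R R y"
    have "z - e *\<^sub>R R z = y - (e * e) *\<^sub>R R (R y)"
      by (simp add: z_def blinfun.diff_right blinfun.add_right blinfun.scaleR_right algebra_simps)
    then have "norm z \<le> K1 * norm (y - (e * e) *\<^sub>R R (R y))"
      using K1(2)[of z] by simp
    then have "K2 * norm z \<le> K2 * (K1 * norm (y - (e * e) *\<^sub>R R (R y)))"
      using K2(1) by (intro mult_left_mono) auto
    then have "norm y \<le> K * norm (y - (e * e) *\<^sub>R R (R y))"
      using K2(2)[of y] unfolding z_def[symmetric] K_def by linarith
    then have "(norm y)\<^sup>2 \<le> (K * norm (y - (e * e) *\<^sub>R R (R y)))\<^sup>2"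
      by (rule power_mono) simp
    also have "\<dots> = K\<^sup>2 * (norm (y - (e * e) *\<^sub>R R (R y)))\<^sup>2"
      by (simp add: power_mult_distrib)
    also have "(norm (y - (e * e) *\<^sub>R R (R y)))\<^sup>2
        = (norm y)\<^sup>2 - 2 * (e * e) * (y \<bullet> R (R y)) + (e * norm (e *\<^sub>R R (R y)))\<^sup>2"
    proof -
      have "(norm (a - k *\<^sub>R b))\<^sup>2 = (norm a)\<^sup>2 - 2 * k * (a \<bullet> b) + (norm (k *\<^sub>R b))\<^sup>2" for a b :: 'h and k
        unfolding power2_norm_eq_inner
        by (simp add: inner_diff inner_commute power2_eq_square algebra_simps)
      from this[of y "e * e" "R (R y)"] show ?thesis
        using e(1) by (simp add: abs_mult mult.assoc)
    qed
    also have "y \<bullet> R (R y) = (norm (R y))\<^sup>2"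
      using sym[of y "R y"] by (simp add: power2_norm_eq_inner)
    also have "(e * norm (e *\<^sub>R R (R y)))\<^sup>2 \<le> (e * norm (R y))\<^sup>2"
    proof (intro power_mono mult_left_mono)
      have "norm (e *\<^sub>R R (R y)) \<le> e * (\<rho> * norm (R y))"
        using e(1) norm_blinfun[of R "R y"] by (simp add: \<rho>_def)
      then show "norm (e *\<^sub>R R (R y)) \<le> norm (R y)"
        using e(3) by (simp flip: mult.assoc)
    qed (use e(1) in auto)
    finally have "(norm y)\<^sup>2 \<le> K\<^sup>2 * ((norm y)\<^sup>2 - 2 * (e * e) * (norm (R y))\<^sup>2 + (e * norm (R y))\<^sup>2)"
      by (simp add: mult_left_mono)
    then show ?thesis
      by (simp add: power_mult_distrib power2_eq_square[of e] algebra_simps)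
  qed
  define q where "q = 1 - 1 / K\<^sup>2"
  have "norm R \<le> sqrt q * \<rho>"
  proof (rule norm_blinfun_bound)
    fix y
    have "e\<^sup>2 * (norm (R y))\<^sup>2 \<le> q * (norm y)\<^sup>2"
      using K[of y] \<open>K > 0\<close> by (simp add: q_def field_simps)
    then have "\<rho>\<^sup>2 * (e\<^sup>2 * (norm (R y))\<^sup>2) \<le> \<rho>\<^sup>2 * (q * (norm y)\<^sup>2)"
      by (intro mult_left_mono) auto
    moreover have "\<rho>\<^sup>2 * (e\<^sup>2 * (norm (R y))\<^sup>2) = (norm (R y))\<^sup>2"
      using e(3) by (simp add: power_mult_distrib[symmetric] mult.assoc[symmetric] mult.commute[of \<rho>])
    ultimately have "(norm (R y))\<^sup>2 \<le> q * (\<rho>\<^sup>2 * (norm y)\<^sup>2)"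
      by (simp add: ac_simps)
    then have "sqrt ((norm (R y))\<^sup>2) \<le> sqrt (q * (\<rho>\<^sup>2 * (norm y)\<^sup>2))"
      by (rule real_sqrt_le_mono)
    then show "norm (R y) \<le> sqrt q * \<rho> * norm y"
      using \<open>\<rho> > 0\<close> by (simp add: real_sqrt_mult)
  next
    have "\<exists>y. R y \<noteq> 0"
      using \<open>\<rho> > 0\<close> unfolding \<rho>_def by (metis blinfun_eqI norm_eq_zero less_irrefl zero_blinfun.rep_eq)
    then obtain y where "R y \<noteq> 0"
      by blast
    then have "0 < e\<^sup>2 * (norm (R y))\<^sup>2"
      using e(1) by simp
    also have "\<dots> \<le> q * (norm y)\<^sup>2"
      using K[of y] \<open>K > 0\<close> by (simp add: q_def field_simps)
    finally have "q > 0"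
      using zero_less_mult_pos2 zero_le_power2 by (metis less_le mult_zero_right)
    then show "0 \<le> sqrt q * \<rho>"
      using \<open>\<rho> > 0\<close> by simp
  qed
  moreover have "sqrt q < 1"
    using \<open>K > 0\<close> by (simp add: q_def)
  then have "sqrt q * \<rho> < \<rho>"
    using \<open>\<rho> > 0\<close> by simp
  ultimately show False
    by (simp add: \<rho>_def)
qed

text \<open>With \<open>R = (A - c)\<^sup>-\<^sup>1\<close> for the midpoint \<open>c\<close> of the gap, \<open>Q = A R = 1 + c R\<close> is positive because
\<open>norm R \<le> 1 / c\<close>, it has the same kernel as \<open>A\<close>, and its range consists of the vectors \<open>A w\<close>. From
\<open>g = Q g - c R g\<close> one gets \<open>Q g \<bullet> g = \<parallel>Q g\<parallel>\<^sup>2 - c * (A w \<bullet> w)\<close> for \<open>w = R g\<close>, so that the hypothesis of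
\<open>positive_operator_range\<close> amounts to \<open>A w \<bullet> w \<ge> 0\<close>. This holds for the \<open>w\<close> that are \<open>A\<close>-orthogonal to a
maximal \<open>A\<close>-orthonormal negative system \<open>S\<close>, since otherwise \<open>w\<close> could be normalised and added to \<open>S\<close>.\<close>

lemma spectral_gap_finite_index_solvable:
  fixes A :: "'h::{real_inner,banach} \<rightharpoonup> 'h"
  assumes "linear_op A"
    and sym: "\<And>x y. x \<in> dom A \<Longrightarrow> y \<in> dom A \<Longrightarrow> the (A x) \<bullet> y = x \<bullet> the (A y)"
    and gap: "\<delta> > 0" "\<And>s. 0 < s \<Longrightarrow> s < \<delta> \<Longrightarrow> s \<in> resolvent_set A"
    and index: "\<And>S. \<lbrakk>finite S; S \<subseteq> dom A; \<And>e. e \<in> S \<Longrightarrow> the (A e) \<bullet> e = -1;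
        \<And>e e'. e \<in> S \<Longrightarrow> e' \<in> S \<Longrightarrow> e \<noteq> e' \<Longrightarrow> the (A e) \<bullet> e' = 0\<rbrakk> \<Longrightarrow> card S \<le> n"
    and f: "\<And>k. k \<in> dom A \<Longrightarrow> the (A k) = 0 \<Longrightarrow> f \<bullet> k = 0"
  shows "\<exists>w\<in>dom A. the (A w) = f"
proof -
  have dom: "subspace (dom A)"
    and add: "\<And>x y. x \<in> dom A \<Longrightarrow> y \<in> dom A \<Longrightarrow> the (A (x + y)) = the (A x) + the (A y)"
    and scale: "\<And>c x. x \<in> dom A \<Longrightarrow> the (A (c *\<^sub>R x)) = c *\<^sub>R the (A x)"
    using \<open>linear_op A\<close> by (auto simp: linear_op_def)
  have A0: "the (A 0) = 0"
    using scale[OF subspace_0[OF dom], of 0] by simp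
  define c where "c = \<delta> / 2"
  have c: "c > 0" "c < \<delta>"
    using gap(1) by (simp_all add: c_def)
  obtain R :: "'h \<Rightarrow>\<^sub>L 'h" where R: "\<And>y. R y \<in> dom A" "\<And>y. the (A (R y)) - c *\<^sub>R R y = y"
    and RA: "\<And>x. x \<in> dom A \<Longrightarrow> R (the (A x) - c *\<^sub>R x) = x"
    using gap(2)[OF c] unfolding resolvent_set_def by blast
  have AR: "the (A (R y)) = y + c *\<^sub>R R y" for y
    using R(2)[of y] by (simp add: algebra_simps)
  have symR: "R x \<bullet> y = x \<bullet> R y" for x y
    using sym[OF R(1)[of x] R(1)[of y]] unfolding AR by (simp add: inner_add_left inner_add_right)
  have normR: "norm R \<le> 1 / c"
    using c(1) R symR by (intro resolvent_norm_le[of c A] gap) (auto simp: c_def)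
  define Q where "Q g = g + c *\<^sub>R R g" for g
  have Q: "Q g = the (A (R g))" for g
    by (simp add: Q_def AR)
  define P where "P S \<longleftrightarrow> finite S \<and> S \<subseteq> dom A \<and> (\<forall>e\<in>S. the (A e) \<bullet> e = -1) \<and>
    (\<forall>e\<in>S. \<forall>e'\<in>S. e \<noteq> e' \<longrightarrow> the (A e) \<bullet> e' = 0)" for S
  have "\<exists>S. P S \<and> (\<forall>S'. P S' \<longrightarrow> card S' \<le> card S)"
  proof (rule ex_has_greatest_nat[of P "{}" card "Suc n"])
    show "\<forall>S. P S \<longrightarrow> card S < Suc n"
      unfolding P_def less_Suc_eq_le by (intro allI impI index) auto
  qed (simp add: P_def)
  then obtain S where S: "P S" and max: "\<And>S'. P S' \<Longrightarrow> card S' \<le> card S"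
    by blast
  have finS: "finite S" and Sdom: "\<And>e. e \<in> S \<Longrightarrow> e \<in> dom A"
    and See: "\<And>e. e \<in> S \<Longrightarrow> the (A e) \<bullet> e = -1"
    and Sort: "\<And>e e'. e \<in> S \<Longrightarrow> e' \<in> S \<Longrightarrow> e \<noteq> e' \<Longrightarrow> the (A e) \<bullet> e' = 0"
    using S by (auto simp: P_def)
  define W where "W = {g. \<forall>e\<in>S. the (A e) \<bullet> R g = 0}"
  have nonneg: "the (A (R g)) \<bullet> R g \<ge> 0" if "g \<in> W" for g
  proof (rule ccontr)
    define w where "w = R g"
    define t where "t = 1 / sqrt (- (the (A w) \<bullet> w))"
    assume "\<not> 0 \<le> the (A (R g)) \<bullet> R g"
    then have neg: "the (A w) \<bullet> w < 0"
      by (simp add: w_def)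
    have w: "w \<in> dom A" "\<And>e. e \<in> S \<Longrightarrow> the (A e) \<bullet> w = 0"
      using R(1) that by (auto simp: w_def W_def)
    have tw: "t *\<^sub>R w \<in> dom A"
      using w(1) dom by (rule subspace_scale[rotated])
    have norm1: "the (A (t *\<^sub>R w)) \<bullet> (t *\<^sub>R w) = -1"
    proof -
      have "t * t = 1 / (- (the (A w) \<bullet> w))"
        using neg by (simp add: t_def)
      then have "(t * t) * (the (A w) \<bullet> w) = -1"
        using neg by simp
      then show ?thesis
        by (simp add: scale[OF w(1)] mult.assoc)
    qed
    have ort: "the (A e) \<bullet> (t *\<^sub>R w) = 0" "the (A (t *\<^sub>R w)) \<bullet> e = 0" if "e \<in> S" for e
      using w(2)[OF that] sym[OF tw Sdom[OF that]] by (simp_all add: inner_commute)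
    have "t *\<^sub>R w \<notin> S"
      using ort(1) norm1 by force
    moreover have "P (insert (t *\<^sub>R w) S)"
      unfolding P_def using finS tw Sdom See Sort norm1 ort by auto
    ultimately show False
      using max[of "insert (t *\<^sub>R w) S"] finS by simp
  qed
  have "f \<in> range Q"
  proof (rule positive_operator_range)
    show "bounded_linear Q"
      unfolding Q_def[abs_def]
      by (intro bounded_linear_add bounded_linear_ident bounded_linear_scaleR_right[THEN bounded_linear_compose]
          blinfun.bounded_linear_right)
    show "Q x \<bullet> y = x \<bullet> Q y" for x y
      by (simp add: Q_def inner_add_left inner_add_right symR)
    show "Q x \<bullet> x \<ge> 0" for x
    proof -
      have "\<bar>R x \<bullet> x\<bar> \<le> norm (R x) * norm x"
        by (rule Cauchy_Schwarz_ineq2)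
      also have "\<dots> \<le> (1 / c * norm x) * norm x"
        using order_trans[OF norm_blinfun mult_right_mono[OF normR norm_ge_zero]] by (rule mult_right_mono) simp
      finally have "c * \<bar>R x \<bullet> x\<bar> \<le> (norm x)\<^sup>2"
        using c(1) by (simp add: field_simps power2_eq_square)
      moreover have "c * \<bar>R x \<bullet> x\<bar> \<ge> - (c * (R x \<bullet> x))"
        using c(1) by (metis abs_ge_minus_self mult_left_mono less_imp_le mult_minus_right)
      ultimately show ?thesis
        by (simp add: Q_def inner_add_left power2_norm_eq_inner)
    qed
    show "subspace W"
      by (auto simp: subspace_def W_def blinfun.add_right blinfun.scaleR_right inner_add_right blinfun.zero_right)
    show "finite ((\<lambda>e. the (A e) - c *\<^sub>R e) ` S)"
      using finS by simp
    show "\<exists>w\<in>W. \<exists>n\<in>span ((\<lambda>e. the (A e) - c *\<^sub>R e) ` S). g = w + n" for g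
    proof -
      define \<gamma> where "\<gamma> e = the (A e) \<bullet> R g" for e
      define h where "h = (\<Sum>e\<in>S. \<gamma> e *\<^sub>R (the (A e) - c *\<^sub>R e))"
      have Rh: "R h = (\<Sum>e\<in>S. \<gamma> e *\<^sub>R e)"
        unfolding h_def blinfun.sum_right blinfun.scaleR_right
        by (intro sum.cong refl) (simp add: RA Sdom)
      have "g + h \<in> W"
        unfolding W_def
      proof (intro CollectI ballI)
        fix e assume e: "e \<in> S"
        have "the (A e) \<bullet> R h = (\<Sum>e'\<in>S. \<gamma> e' * (the (A e) \<bullet> e'))"
          by (simp add: Rh inner_sum_right)
        also have "\<dots> = (\<Sum>e'\<in>S. if e' = e then - \<gamma> e else 0)"
          using See[OF e] Sort[OF e] by (intro sum.cong) auto
        also have "\<dots> = - \<gamma> e"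
          using finS e by simp
        finally show "the (A e) \<bullet> R (g + h) = 0"
          by (simp add: blinfun.add_right inner_add_right \<gamma>_def)
      qed
      moreover have "- h \<in> span ((\<lambda>e. the (A e) - c *\<^sub>R e) ` S)"
        unfolding h_def by (intro span_neg span_sum span_scale span_base) auto
      moreover have "g = (g + h) + (- h)"
        by simp
      ultimately show ?thesis
        by blast
    qed
    show "Q g \<bullet> g \<le> (norm (Q g))\<^sup>2" if "g \<in> W" for g
    proof -
      have "Q g \<bullet> g = Q g \<bullet> (Q g - c *\<^sub>R R g)"
        by (simp add: Q_def)
      also have "\<dots> = (norm (Q g))\<^sup>2 - c * (Q g \<bullet> R g)"
        by (simp add: inner_diff_right power2_norm_eq_inner)
      also have "\<dots> \<le> (norm (Q g))\<^sup>2"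
        using nonneg[OF that] c(1) by (simp add: Q)
      finally show ?thesis .
    qed
    show "f \<bullet> k = 0" if "Q k = 0" for k
    proof -
      have "f \<bullet> R k = 0"
        using that by (intro f R(1)) (simp flip: Q)
      moreover have "k = - (c *\<^sub>R R k)"
        using that unfolding Q_def by (rule eq_neg_iff_add_eq_0[THEN iffD2])
      ultimately show ?thesis
        by (metis inner_minus_right inner_scaleR_right mult_zero_right neg_0_equal_iff_equal)
    qed
  qed
  then show ?thesis
    unfolding Q using R(1) by blast
qed

text \<open>The range of \<open>A\<close> is orthogonal to its kernel \<open>K\<close>, where \<open>P\<close> takes its values, so the equation
\<open>A x + P x = f\<close> splits into the component in \<open>K\<close>, which fixes \<open>P x\<close>, and the orthogonal one.\<close>

lemma bordered_operator_bij:
  fixes A :: "'h::real_inner \<rightharpoonup> 'h"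
  assumes "linear_op A"
    and sym: "\<And>x y. x \<in> dom A \<Longrightarrow> y \<in> dom A \<Longrightarrow> the (A x) \<bullet> y = x \<bullet> the (A y)"
    and ker: "\<And>x. x \<in> K \<longleftrightarrow> x \<in> dom A \<and> the (A x) = 0"
    and "linear P" and P: "\<And>x. P x \<in> K" "\<And>x k. k \<in> K \<Longrightarrow> (x - P x) \<bullet> k = 0"
    and solve: "\<And>f. (\<And>k. k \<in> K \<Longrightarrow> f \<bullet> k = 0) \<Longrightarrow> \<exists>w\<in>dom A. the (A w) = f"
  shows "bij_betw (\<lambda>x. the (A x) + P x) (dom A) UNIV"
proof -
  have dom: "subspace (dom A)"
    and add: "\<And>x y. x \<in> dom A \<Longrightarrow> y \<in> dom A \<Longrightarrow> the (A (x + y)) = the (A x) + the (A y)"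
    and scale: "\<And>c x. x \<in> dom A \<Longrightarrow> the (A (c *\<^sub>R x)) = c *\<^sub>R the (A x)"
    using \<open>linear_op A\<close> by (auto simp: linear_op_def)
  have diff: "the (A (x - y)) = the (A x) - the (A y)" if "x \<in> dom A" "y \<in> dom A" for x y
    using add[OF that(1) subspace_neg[OF dom that(2)]] scale[OF that(2), of "-1"] by simp
  have Pid: "P k = k" if "k \<in> K" for k
  proof -
    have "k - P k \<in> K"
      using that P(1)[of k] subspace_diff[OF dom] diff unfolding ker by auto
    then have "(k - P k) \<bullet> (k - P k) = 0"
      by (rule P(2))
    then show ?thesis
      by (metis inner_eq_zero_iff right_minus_eq)
  qed
  have ortho: "the (A x) \<bullet> k = 0" if "x \<in> dom A" "k \<in> K" for x k
    using sym[OF that(1), of k] that(2) unfolding ker by simp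
  have inj0: "x = 0" if x: "x \<in> dom A" "the (A x) + P x = 0" for x
  proof -
    have "(the (A x) + P x) \<bullet> P x = 0"
      by (simp add: x(2))
    then have Px: "P x = 0"
      using ortho[OF x(1) P(1)[of x]] by (simp add: inner_add_left)
    then have "x \<in> K"
      using x ker by simp
    then show ?thesis
      using Pid Px by metis
  qed
  show ?thesis
    unfolding bij_betw_def
  proof
    show "inj_on (\<lambda>x. the (A x) + P x) (dom A)"
    proof (rule inj_onI)
      fix x y assume xy: "x \<in> dom A" "y \<in> dom A" "the (A x) + P x = the (A y) + P y"
      have "x - y = 0"
      proof (rule inj0)
        show "the (A (x - y)) + P (x - y) = 0"
          using xy(3) by (simp add: diff[OF xy(1,2)] linear_diff[OF \<open>linear P\<close>] algebra_simps)
      qed (rule subspace_diff[OF dom xy(1,2)])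
      then show "x = y"
        by simp
    qed
    have "\<exists>x\<in>dom A. the (A x) + P x = f" for f
    proof -
      obtain w where w: "w \<in> dom A" "the (A w) = f - P f"
        using solve[of "f - P f"] P(2) by blast
      have K: "P f \<in> dom A" "the (A (P f)) = 0" "P w \<in> dom A" "the (A (P w)) = 0"
        using P(1) ker by auto
      have "the (A (w - P w + P f)) = f - P f"
        using add[OF subspace_diff[OF dom w(1) K(3)] K(1)] diff[OF w(1) K(3)] K w(2) by simp
      moreover have "P (w - P w + P f) = P f"
        by (simp add: linear_add[OF \<open>linear P\<close>] linear_diff[OF \<open>linear P\<close>] Pid P(1))
      moreover have "w - P w + P f \<in> dom A"
        by (intro subspace_add subspace_diff dom w(1) K)
      ultimately show ?thesis
        by (intro bexI[of _ "w - P w + P f"]) simp_all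
    qed
    then show "(\<lambda>x. the (A x) + P x) ` dom A = UNIV"
      by (metis (mono_tags, lifting) UNIV_eq_I image_iff)
  qed
qed

lemma gap_from_INF:
  fixes S :: "real set"
  assumes "(INF s\<in>S \<inter> {0<..}. ereal s) > 0"
  obtains \<delta> where "\<delta> > 0" and "\<And>s. 0 < s \<Longrightarrow> s < \<delta> \<Longrightarrow> s \<notin> S"
proof -
  obtain \<delta> where \<delta>: "0 < ereal \<delta>" "ereal \<delta> < (INF s\<in>S \<inter> {0<..}. ereal s)"
    using ereal_dense2[OF assms] by auto
  have "s \<notin> S" if "0 < s" "s < \<delta>" for s
  proof
    assume "s \<in> S"
    then have "(INF s\<in>S \<inter> {0<..}. ereal s) \<le> ereal s"
      using that(1) by (intro INF_lower) simp
    then have "ereal \<delta> < ereal s"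
      using \<delta>(2) by (rule less_le_trans[rotated])
    then show False
      using that(2) by simp
  qed
  then show thesis
    using \<delta>(1) that by simp
qed

text \<open>An orthonormal negative system is independent and spans a negative definite subspace.\<close>

lemma card_le_morse_index:
  fixes B :: "'e::real_vector \<Rightarrow> 'e \<Rightarrow> real"
  assumes "bilinear B" and "finite S"
    and neg: "\<And>e. e \<in> S \<Longrightarrow> B e e = -1"
    and orth: "\<And>e e'. e \<in> S \<Longrightarrow> e' \<in> S \<Longrightarrow> e \<noteq> e' \<Longrightarrow> B e e' = 0"
  shows "enat (card S) \<le> morse_index B"
proof -
  have B: "B (\<Sum>e\<in>S. u e *\<^sub>R e) (\<Sum>e\<in>S. v e *\<^sub>R e) = - (\<Sum>e\<in>S. u e * v e)" for u v
  proof -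
    have "B (\<Sum>e\<in>S. u e *\<^sub>R e) (\<Sum>e\<in>S. v e *\<^sub>R e) = (\<Sum>e\<in>S. \<Sum>e'\<in>S. u e * (v e' * B e e'))"
      using \<open>bilinear B\<close>
      by (simp add: bilinear_def linear_sum[of "\<lambda>x. B x _"] linear_sum[of "B _"] linear_scale[of "\<lambda>x. B x _"]
          linear_scale[of "B _"] sum_distrib_left)
        (subst sum.swap, simp add: mult.left_commute)
    also have "\<dots> = (\<Sum>e\<in>S. \<Sum>e'\<in>S. if e' = e then - (u e * v e) else 0)"
      using neg orth by (intro sum.cong refl) auto
    also have "\<dots> = - (\<Sum>e\<in>S. u e * v e)"
      using \<open>finite S\<close> by (simp add: sum_negf)
    finally show ?thesis .
  qed
  have zero: "\<forall>e\<in>S. u e = 0" if "(\<Sum>e\<in>S. u e * u e) \<le> 0" for u :: "'e \<Rightarrow> real"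
  proof -
    have "(\<Sum>e\<in>S. u e * u e) = 0"
      using that by (intro antisym sum_nonneg) auto
    then show ?thesis
      using \<open>finite S\<close> by (simp add: sum_nonneg_eq_0_iff)
  qed
  have "independent S"
    unfolding independent_explicit_finite_subsets
  proof (intro allI impI ballI)
    fix T u v
    assume T: "T \<subseteq> S" "finite T" "(\<Sum>v\<in>T. u v *\<^sub>R v) = 0" "v \<in> T"
    define u' where "u' e = (if e \<in> T then u e else 0)" for e
    have "(\<Sum>e\<in>S. u' e *\<^sub>R e) = (\<Sum>e\<in>T. u' e *\<^sub>R e)"
      using T(1) \<open>finite S\<close> by (intro sum.mono_neutral_right) (auto simp: u'_def)
    also have "\<dots> = 0"
      using T(3) by (simp add: u'_def)
    finally have "(\<Sum>e\<in>S. u' e * u' e) = 0"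
      using B[of u' u'] \<open>bilinear B\<close> by (simp add: bilinear_lzero)
    then show "u v = 0"
      using zero[of u'] T by (auto simp: u'_def split: if_splits)
  qed
  moreover have "negative_definite_on B (span S)"
    unfolding negative_definite_on_def
  proof (intro ballI impI)
    fix v assume "v \<in> span S" "v \<noteq> 0"
    then obtain u where u: "v = (\<Sum>e\<in>S. u e *\<^sub>R e)"
      using span_finite[OF \<open>finite S\<close>] by auto
    have "\<not> (\<Sum>e\<in>S. u e * u e) \<le> 0"
      using zero[of u] \<open>v \<noteq> 0\<close> by (auto simp: u)
    then show "B v v < 0"
      by (simp add: u B)
  qed
  ultimately have "extended_dim (span S) = enat (card S)"
    using \<open>finite S\<close> by (auto simp: extended_dim_def dim_eq_card_independent)
  then show ?thesis
    unfolding morse_index_def using \<open>negative_definite_on B (span S)\<close>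
    by (metis (mono_tags, lifting) SUP_upper mem_Collect_eq subspace_span)
qed

section \<open>The completion and the Hessian operator\<close>

text \<open>The last part says that a vector of the completion is determined by its products with the dense
range of \<open>j\<close>; it makes gradients and the Hessian operator single-valued.\<close>

lemma completion_inclusion:
  assumes "continuous_scalar_product sp" and "is_completion sp j"
  shows "inj j" and "norm (j v) \<le> norm v" and "bounded_linear j"
    and "\<And>w w'. (\<And>v. w \<bullet> j v = w' \<bullet> j v) \<Longrightarrow> w = w'"
proof -
  have lin: "linear j" and j: "\<And>v w. j v \<bullet> j w = sp v w" and dense: "closure (range j) = UNIV"
    using assms(2) by (auto simp: is_completion_def)
  have pos: "\<And>v. v \<noteq> 0 \<Longrightarrow> sp v v > 0" and bound: "\<And>v w. \<bar>sp v w\<bar> \<le> norm v * norm w"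
    using assms(1) by (auto simp: continuous_scalar_product_def)
  have "v = 0" if "j v = 0" for v
    using pos[of v] j[of v v] that by (cases "v = 0") auto
  then show "inj j"
    using linear_injective_0[OF lin] by blast
  show norm_j: "norm (j v) \<le> norm v" for v
  proof (rule power2_le_imp_le)
    have "(norm (j v))\<^sup>2 = sp v v"
      by (simp only: power2_norm_eq_inner j)
    then show "(norm (j v))\<^sup>2 \<le> (norm v)\<^sup>2"
      using bound[of v v] unfolding power2_eq_square by linarith
  qed simp
  show "bounded_linear j"
    by (rule bounded_linear_intro[of _ 1]) (auto simp: linear_add[OF lin] linear_scale[OF lin] norm_j)
  show "w = w'" if eq: "\<And>v. w \<bullet> j v = w' \<bullet> j v" for w w'
  proof -
    have "closed {y. (w - w') \<bullet> y = 0}"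
      by (intro closed_Collect_eq continuous_intros)
    moreover have "range j \<subseteq> {y. (w - w') \<bullet> y = 0}"
      using eq by (auto simp: inner_diff_left)
    ultimately have "closure (range j) \<subseteq> {y. (w - w') \<bullet> y = 0}"
      by (intro closure_minimal)
    then have "(w - w') \<bullet> (w - w') = 0"
      unfolding dense by blast
    then show ?thesis
      by simp
  qed
qed

lemma hessian_op_eq_Some_iff:
  assumes "continuous_scalar_product sp" and "is_completion sp j"
  shows "hessian_op j f u z = Some w \<longleftrightarrow> (\<exists>x. z = j x \<and> (\<forall>v. second_deriv f u x v = w \<bullet> j v))"
    (is "_ \<longleftrightarrow> ?R w")
proof -
  have uniq: "w1 = w2" if "?R w1" "?R w2" for w1 w2
  proof (rule completion_inclusion(4)[OF assms])
    obtain x1 x2 where x: "z = j x1" "\<And>v. second_deriv f u x1 v = w1 \<bullet> j v"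
        "z = j x2" "\<And>v. second_deriv f u x2 v = w2 \<bullet> j v"
      using \<open>?R w1\<close> \<open>?R w2\<close> by blast
    have "x1 = x2"
      using x(1,3) completion_inclusion(1)[OF assms] by (metis injD)
    then show "w1 \<bullet> j v = w2 \<bullet> j v" for v
      using x(2,4) by metis
  qed
  show ?thesis
  proof (cases "\<exists>w. ?R w")
    case True
    then obtain w0 where w0: "?R w0"
      by blast
    then have "(THE w. ?R w) = w0"
      using uniq by (intro the_equality)
    moreover have "\<exists>x w. z = j x \<and> (\<forall>v. second_deriv f u x v = w \<bullet> j v)"
      using w0 by blast
    ultimately have "hessian_op j f u z = Some w0"
      by (simp add: hessian_op_def)
    then show ?thesis
      using w0 uniq by (metis option.inject)
  next
    case False
    then show ?thesis
      by (auto simp: hessian_op_def)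
  qed
qed

text \<open>On the domain of \<open>T2\<close> one has \<open>\<parallel>i2 z\<parallel>\<^sup>2 = j (i2 z) \<bullet> T2 (j (i2 z))\<close>, and \<open>j\<close> does not increase norms.\<close>

lemma norm_E2_inclusion_le:
  assumes "continuous_scalar_product sp" and "is_completion sp j"
    and "form_operator_sqrt j T2 T" and "is_E2 j T2 i2"
  shows "norm (i2 z) \<le> norm z"
proof -
  have "j (i2 z) \<in> dom T2"
    using assms(4) unfolding is_E2_def by blast
  then have "i2 z \<bullet> i2 z = j (i2 z) \<bullet> the (T2 (j (i2 z)))"
    using assms(3) unfolding form_operator_sqrt_def by blast
  also have "\<dots> \<le> norm (j (i2 z)) * norm (the (T2 (j (i2 z))))"
    by (rule norm_cauchy_schwarz)
  also have "\<dots> \<le> norm (i2 z) * norm z"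
    using completion_inclusion(2)[OF assms(1,2)] assms(4) unfolding is_E2_def
    by (metis mult_right_mono norm_ge_zero)
  finally have "norm (i2 z) * norm (i2 z) \<le> norm (i2 z) * norm z"
    by (simp only: norm_eq_sqrt_inner[of "i2 z"] real_sqrt_mult_self) simp
  then have sq: "norm (i2 z) * norm (i2 z) \<le> norm (i2 z) * norm z" .
  show ?thesis
  proof (rule ccontr)
    assume "\<not> norm (i2 z) \<le> norm z"
    then have "norm z < norm (i2 z)" "0 < norm (i2 z)"
      using norm_ge_zero[of z] by linarith+
    then have "norm (i2 z) * norm z < norm (i2 z) * norm (i2 z)"
      by (rule mult_strict_left_mono)
    then show False
      using sq by linarith
  qed
qed

section \<open>Isometric Hamiltonian actions\<close>

text \<open>
The derivative \<open>F'\<close> of the momentum map is part of the data, and \<open>V\<close> is a space of vectors with smooth orbit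
maps; for the persistence theorem \<open>V\<close> is the image of \<open>E\<^sub>2\<close>.
\<close>

locale isometric_hamiltonian_action =
  fixes D :: "'e::{real_inner,banach} set"
    and J :: "'e \<Rightarrow>\<^sub>L ('e \<Rightarrow>\<^sub>L real)"
    and sp :: "'e \<Rightarrow> 'e \<Rightarrow> real"
    and G :: "(complex^'n^'n) set"
    and \<iota> :: "real^'m \<Rightarrow> complex^'n^'n"
    and \<Phi> :: "complex^'n^'n \<Rightarrow> 'e \<Rightarrow> 'e"
    and F :: "'e \<Rightarrow> real^'m" and F' :: "'e \<Rightarrow> 'e \<Rightarrow>\<^sub>L (real^'m)"
    and V :: "'e set" and u\<^sub>0 :: 'e
  assumes scalar_product: "continuous_scalar_product sp"
    and group: "matrix_lie_group G"
    and coords: "lie_algebra_coords G \<iota>"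
    and hamiltonian: "globally_hamiltonian D J G \<iota> \<Phi> F"
    and equivariant: "Ad_star_equivariant G \<iota> \<Phi> F"
    and F': "\<And>u. (F has_derivative F' u) (at u)"
    and isometric: "\<And>g. g \<in> G \<Longrightarrow> linear (\<Phi> g)"
      "\<And>g v w. g \<in> G \<Longrightarrow> sp (\<Phi> g v) (\<Phi> g w) = sp v w"
      "\<And>g v. g \<in> G \<Longrightarrow> norm (\<Phi> g v) = norm v"
    and V: "subspace V"
    and smooth: "\<And>v. v \<in> V \<Longrightarrow> C1_on_group G \<iota> (\<lambda>g. \<Phi> g v)"
    and u\<^sub>0: "u\<^sub>0 \<in> D" "u\<^sub>0 \<in> V"
    and regular: "range (F' u\<^sub>0) = UNIV"
begin

abbreviation X where "X \<equiv> inf_generator \<iota> \<Phi>"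

abbreviation flow where "flow \<eta> t \<equiv> \<Phi> (matrix_exp (t *\<^sub>R \<iota> \<eta>))"

abbreviation isotropy where "isotropy u \<equiv> isotropy_algebra G \<iota> (F u)"

lemma linear_\<iota>: "linear \<iota>"
  using coords by (simp add: lie_algebra_coords_def)

lemma exp_in_G: "matrix_exp (t *\<^sub>R \<iota> \<eta>) \<in> G"
proof -
  have "\<iota> \<eta> \<in> lie_algebra G"
    using coords by (auto simp: lie_algebra_coords_def)
  then show ?thesis
    by (simp add: lie_algebra_def)
qed

lemma flow_hamiltonian: "hamiltonian_flow D J (\<lambda>u. \<eta> \<bullet> F u) (flow \<eta>)"
  using hamiltonian by (simp add: globally_hamiltonian_def)

lemma flow_add: "flow \<eta> (t + s) u = flow \<eta> t (flow \<eta> s u)"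
  using flow_hamiltonian[of \<eta>] unfolding hamiltonian_flow_def by (metis comp_apply)

lemma flow_0: "flow \<eta> 0 u = u"
  using flow_hamiltonian[of \<eta>] unfolding hamiltonian_flow_def by (metis id_apply)

lemma bounded_bilinear_sp: "bounded_bilinear sp"
proof
  show "\<exists>K. \<forall>a b. norm (sp a b) \<le> norm a * norm b * K"
    using scalar_product unfolding continuous_scalar_product_def real_norm_def by (metis mult.right_neutral)
qed (use scalar_product in \<open>auto simp: continuous_scalar_product_def bilinear_ladd bilinear_radd
    bilinear_lmul bilinear_rmul\<close>)

lemma sp_bound: "\<bar>sp v w\<bar> \<le> norm v * norm w"
  using scalar_product by (simp add: continuous_scalar_product_def)

lemma sp_pos: "v \<noteq> 0 \<Longrightarrow> sp v v > 0"
  using scalar_product by (simp add: continuous_scalar_product_def)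

lemma C1_orbit_map:
  assumes "v \<in> V"
  shows "\<exists>U. open U \<and> 0 \<in> U \<and> C1_on U (\<lambda>\<eta>. \<Phi> (matrix_exp (\<iota> \<eta>)) v)"
proof -
  have "mat 1 \<in> G"
    using group by (simp add: matrix_lie_group_def)
  then obtain U where "open U" "0 \<in> U" "C1_on U (\<lambda>\<eta>. \<Phi> (mat 1 ** matrix_exp (\<iota> \<eta>)) v)"
    using smooth[OF assms] unfolding C1_on_group_def by blast
  then show ?thesis
    unfolding matrix_mul_lid by blast
qed

text \<open>Smoothness of the orbit map in the exponential chart gives more than differentiability of the single
curves: the derivative at 0 is linear in \<open>\<eta>\<close>.\<close>

lemma generator_linear:
  assumes "v \<in> V"
  shows "\<exists>L. bounded_linear L \<and> (\<forall>\<eta>. X \<eta> v = L \<eta> \<and> ((\<lambda>t. flow \<eta> t v) has_vector_derivative L \<eta>) (at 0))"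
proof -
  obtain U where "0 \<in> U" "C1_on U (\<lambda>\<eta>. \<Phi> (matrix_exp (\<iota> \<eta>)) v)"
    using C1_orbit_map[OF assms] by blast
  then obtain L where L: "((\<lambda>\<eta>. \<Phi> (matrix_exp (\<iota> \<eta>)) v) has_derivative L) (at 0)"
    unfolding C1_on_def by blast
  then interpret L: bounded_linear L
    by (rule has_derivative_bounded_linear)
  have "((\<lambda>t. flow \<eta> t v) has_vector_derivative L \<eta>) (at 0)" for \<eta>
  proof -
    have "((\<lambda>t::real. t *\<^sub>R \<eta>) has_derivative (\<lambda>t. t *\<^sub>R \<eta>)) (at 0)"
      by (auto intro!: derivative_eq_intros)
    moreover have "((\<lambda>\<eta>. \<Phi> (matrix_exp (\<iota> \<eta>)) v) has_derivative L) (at (0 *\<^sub>R \<eta>))"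
      using L by simp
    ultimately have "((\<lambda>t. \<Phi> (matrix_exp (\<iota> (t *\<^sub>R \<eta>))) v) has_derivative (\<lambda>t. L (t *\<^sub>R \<eta>))) (at 0)"
      by (rule has_derivative_compose)
    then show ?thesis
      unfolding has_vector_derivative_def linear_scale[OF linear_\<iota>] L.scaleR .
  qed
  moreover from this have "X \<eta> v = L \<eta>" for \<eta>
    unfolding inf_generator_def by (rule vector_derivative_at)
  ultimately show ?thesis
    using L.bounded_linear_axioms by blast
qed

lemma flow_derivative: "v \<in> V \<Longrightarrow> ((\<lambda>t. flow \<eta> t v) has_vector_derivative X \<eta> v) (at 0)"
  using generator_linear[of v] by metis

lemma bounded_linear_generator:
  assumes "v \<in> V"
  shows "bounded_linear (\<lambda>\<eta>. X \<eta> v)"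
proof -
  obtain L where "bounded_linear L" "\<And>\<eta>. X \<eta> v = L \<eta>"
    using generator_linear[OF assms] by blast
  then show ?thesis
    by simp
qed

lemma linear_generator: "v \<in> V \<Longrightarrow> linear (\<lambda>\<eta>. X \<eta> v)"
  by (rule bounded_linear.linear[OF bounded_linear_generator])

lemma generator_add:
  assumes "v \<in> V" "w \<in> V"
  shows "X \<eta> (v + w) = X \<eta> v + X \<eta> w"
proof -
  have "((\<lambda>t. flow \<eta> t v + flow \<eta> t w) has_vector_derivative X \<eta> v + X \<eta> w) (at 0)"
    using assms by (intro has_vector_derivative_add flow_derivative)
  then have "((\<lambda>t. flow \<eta> t (v + w)) has_vector_derivative X \<eta> v + X \<eta> w) (at 0)"
    by (simp add: linear_add[OF isometric(1)[OF exp_in_G]])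
  then show ?thesis
    using flow_derivative[OF subspace_add[OF V assms]] by (rule vector_derivative_unique_at[rotated])
qed

lemma generator_scale:
  assumes "v \<in> V"
  shows "X \<eta> (c *\<^sub>R v) = c *\<^sub>R X \<eta> v"
proof -
  have "((\<lambda>t. c *\<^sub>R flow \<eta> t v) has_vector_derivative c *\<^sub>R X \<eta> v) (at 0)"
    using flow_derivative[OF assms] by (rule bounded_linear.has_vector_derivative[OF bounded_linear_scaleR_right])
  then have "((\<lambda>t. flow \<eta> t (c *\<^sub>R v)) has_vector_derivative c *\<^sub>R X \<eta> v) (at 0)"
    by (simp add: linear_scale[OF isometric(1)[OF exp_in_G]])
  then show ?thesis
    using flow_derivative[OF subspace_scale[OF V assms]] by (rule vector_derivative_unique_at[rotated])
qed

text \<open>This follows by differentiating \<open>sp (flow \<eta> t v) (flow \<eta> t w) = sp v w\<close>. It moves the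
generator from a variable point onto a fixed vector, so that continuity in the point becomes evident.\<close>

lemma generator_skew:
  assumes "v \<in> V" "w \<in> V"
  shows "sp (X \<eta> v) w = - sp v (X \<eta> w)"
proof -
  have "((\<lambda>t. sp (flow \<eta> t v) (flow \<eta> t w)) has_vector_derivative
      sp (flow \<eta> 0 v) (X \<eta> w) + sp (X \<eta> v) (flow \<eta> 0 w)) (at 0)"
    by (intro bounded_bilinear.has_vector_derivative[OF bounded_bilinear_sp] flow_derivative assms)
  then have "((\<lambda>t. sp v w) has_vector_derivative sp v (X \<eta> w) + sp (X \<eta> v) w) (at 0)"
    unfolding flow_0 isometric(2)[OF exp_in_G] .
  then have "sp v (X \<eta> w) + sp (X \<eta> v) w = 0"
    using has_vector_derivative_const by (rule vector_derivative_unique_at)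
  then show ?thesis
    by simp
qed

lemma regular_eq_0:
  assumes "\<And>h. \<eta> \<bullet> F' u\<^sub>0 h = 0"
  shows "\<eta> = 0"
proof -
  have "\<eta> \<in> range (F' u\<^sub>0)"
    by (simp add: regular)
  then have "\<eta> \<bullet> \<eta> = 0"
    using assms by (metis rangeE)
  then show ?thesis
    by simp
qed

text \<open>A linear functional that is constant on the values of \<open>F\<close> annihilates the range of \<open>F' u\<^sub>0\<close>.\<close>

lemma momentum_separates:
  assumes "\<And>u. \<eta> \<bullet> F u = \<zeta> \<bullet> F u"
  shows "\<eta> = \<zeta>"
proof -
  have "((\<lambda>u. (\<eta> - \<zeta>) \<bullet> F u) has_derivative (\<lambda>h. (\<eta> - \<zeta>) \<bullet> F' u\<^sub>0 h)) (at u\<^sub>0)"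
    by (intro has_derivative_inner_right F')
  moreover have "(\<lambda>u. (\<eta> - \<zeta>) \<bullet> F u) = (\<lambda>u. 0)"
    using assms by (auto simp: inner_diff_left)
  ultimately have "(\<lambda>h. (\<eta> - \<zeta>) \<bullet> F' u\<^sub>0 h) = (\<lambda>h. 0)"
    using has_derivative_const has_derivative_unique by metis
  then have "\<eta> - \<zeta> = 0"
    by (intro regular_eq_0) metis
  then show ?thesis
    by simp
qed

text \<open>The values of \<open>F\<close> separate vectors, and by equivariance the products of \<open>Ad \<iota> (matrix_inv g) \<xi>\<close> with them are
those of \<open>\<xi>\<close> with the values of \<open>F \<circ> \<Phi> g\<close>, hence linear in \<open>\<xi>\<close>.\<close>

lemma linear_Ad:
  assumes "g \<in> G"
  shows "linear (Ad \<iota> (matrix_inv g))"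
proof -
  have eq: "Ad \<iota> (matrix_inv g) \<xi> \<bullet> F u = \<xi> \<bullet> F (\<Phi> g u)" for \<xi> u
    using equivariant assms by (simp add: Ad_star_equivariant_def)
  show ?thesis
  proof (rule linearI)
    show "Ad \<iota> (matrix_inv g) (\<xi> + \<zeta>) = Ad \<iota> (matrix_inv g) \<xi> + Ad \<iota> (matrix_inv g) \<zeta>" for \<xi> \<zeta>
      by (rule momentum_separates) (simp add: eq inner_add_left)
    show "Ad \<iota> (matrix_inv g) (c *\<^sub>R \<xi>) = c *\<^sub>R Ad \<iota> (matrix_inv g) \<xi>" for c \<xi>
      by (rule momentum_separates) (simp add: eq)
  qed
qed

lemma momentum_equivariant:
  assumes "g \<in> G"
  shows "F (\<Phi> g u) = coAd \<iota> g (F u)"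
proof (rule vector_eq_rdot[THEN iffD1], rule allI)
  fix \<xi>
  have "\<xi> \<bullet> F (\<Phi> g u) = Ad \<iota> (matrix_inv g) \<xi> \<bullet> F u"
    using equivariant assms by (simp add: Ad_star_equivariant_def)
  also have "\<dots> = \<xi> \<bullet> coAd \<iota> g (F u)"
    unfolding coAd_def using adjoint_works[OF linear_Ad[OF assms]] by metis
  finally show "F (\<Phi> g u) \<bullet> \<xi> = coAd \<iota> g (F u) \<bullet> \<xi>"
    by (simp add: inner_commute)
qed

lemma isotropy_iff_flow: "\<eta> \<in> isotropy u \<longleftrightarrow> (\<forall>t. F (flow \<eta> t u) = F u)"
  by (simp add: isotropy_algebra_def lie_algebra_def isotropy_group_def exp_in_G
      momentum_equivariant[OF exp_in_G])

lemma momentum_flow_derivative: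
  assumes "u \<in> V"
  shows "((\<lambda>t. F (flow \<eta> t u)) has_vector_derivative F' u (X \<eta> u)) (at 0)"
proof -
  have "(F has_derivative F' u) (at (flow \<eta> 0 u) within range (\<lambda>t. flow \<eta> t u))"
    unfolding flow_0 by (rule has_derivative_at_withinI[OF F'])
  with flow_derivative[OF assms] show ?thesis
    by (rule vector_derivative_diff_chain_within[unfolded comp_def])
qed

lemma invariant_derivative_generator:
  fixes H :: "'e \<Rightarrow> real"
  assumes "\<And>g. g \<in> G \<Longrightarrow> H \<circ> \<Phi> g = H" and "(H has_derivative H') (at u)" and "u \<in> V"
  shows "H' (X \<eta> u) = 0"
proof -
  have "(H has_derivative H') (at (flow \<eta> 0 u) within range (\<lambda>t. flow \<eta> t u))"
    unfolding flow_0 by (rule has_derivative_at_withinI[OF assms(2)])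
  from vector_derivative_diff_chain_within[OF flow_derivative[OF \<open>u \<in> V\<close>] this]
  have "((\<lambda>t. H (flow \<eta> t u)) has_vector_derivative H' (X \<eta> u)) (at 0)"
    by (simp add: comp_def)
  moreover have "H (flow \<eta> t u) = H u" for t
    using assms(1)[OF exp_in_G] by (metis comp_apply)
  ultimately have "((\<lambda>t. H u) has_vector_derivative H' (X \<eta> u)) (at 0)"
    by simp
  then show ?thesis
    using has_vector_derivative_const by (rule vector_derivative_unique_at)
qed

text \<open>By equivariance, the curve \<open>t \<mapsto> F (flow \<eta> t u)\<close> is an orbit of the linear coadjoint flow; if its velocity vanishes
at \<open>t = 0\<close>, it vanishes always. So isotropy algebras at points of \<open>V\<close> are kernels of linear maps.\<close>

lemma isotropy_iff_derivative:
  assumes "u \<in> V"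
  shows "\<eta> \<in> isotropy u \<longleftrightarrow> F' u (X \<eta> u) = 0"
proof
  assume "\<eta> \<in> isotropy u"
  then have "((\<lambda>t. F u) has_vector_derivative F' u (X \<eta> u)) (at 0)"
    using momentum_flow_derivative[OF assms, of \<eta>] by (simp add: isotropy_iff_flow)
  then show "F' u (X \<eta> u) = 0"
    using has_vector_derivative_const by (rule vector_derivative_unique_at)
next
  assume zero: "F' u (X \<eta> u) = 0"
  define c where "c t = F (flow \<eta> t u)" for t
  have "(c has_vector_derivative 0) (at t)" for t
  proof -
    define A where "A = coAd \<iota> (matrix_exp (t *\<^sub>R \<iota> \<eta>))"
    have "linear A"
      unfolding A_def coAd_def[abs_def] by (intro adjoint_linear linear_Ad exp_in_G)
    then have "bounded_linear A"
      by (simp add: linear_conv_bounded_linear)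
    then have "((\<lambda>s. A (c s)) has_vector_derivative A (F' u (X \<eta> u))) (at 0)"
      unfolding c_def
      by (rule bounded_linear.has_vector_derivative) (rule momentum_flow_derivative[OF assms])
    moreover have "A (c s) = c (t + s)" for s
      by (simp add: A_def c_def flow_add momentum_equivariant[OF exp_in_G])
    moreover have "A (F' u (X \<eta> u)) = 0"
      by (simp add: zero linear_0[OF \<open>linear A\<close>])
    ultimately have shifted: "((\<lambda>s. c (t + s)) has_vector_derivative 0) (at (t - t))"
      by simp
    have "((\<lambda>s. s - t) has_vector_derivative 1) (at t)"
      by (auto intro!: derivative_eq_intros)
    from vector_diff_chain_at[OF this shifted] show ?thesis
      by (simp add: comp_def)
  qed
  then obtain k where "\<And>t. t \<in> UNIV \<Longrightarrow> c t = k"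
    using has_vector_derivative_zero_constant[of UNIV c] by auto
  then have "c t = c 0" for t
    by simp
  then show "\<eta> \<in> isotropy u"
    unfolding isotropy_iff_flow c_def flow_0 by blast
qed

lemma subspace_isotropy:
  assumes "u \<in> V"
  shows "subspace (isotropy u)"
proof -
  have "linear (\<lambda>\<eta>. F' u (X \<eta> u))"
    using bounded_linear_compose[OF blinfun.bounded_linear_right bounded_linear_generator[OF assms]]
    by (rule bounded_linear.linear)
  then have "subspace {\<eta>. F' u (X \<eta> u) = 0}"
    by (rule linear_subspace_kernel)
  moreover have "isotropy u = {\<eta>. F' u (X \<eta> u) = 0}"
    using isotropy_iff_derivative[OF assms] by blast
  ultimately show ?thesis
    by simp
qed

text \<open>Since \<open>J (X \<eta> u\<^sub>0)\<close> is the derivative of \<open>\<eta> \<bullet> F\<close> at \<open>u\<^sub>0\<close>, the generator vanishes only if \<open>\<eta>\<close> annihilates the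
range of \<open>F' u\<^sub>0\<close>.\<close>

lemma generator_u0_eq_0_iff: "X \<eta> u\<^sub>0 = 0 \<longleftrightarrow> \<eta> = 0"
proof
  assume zero: "X \<eta> u\<^sub>0 = 0"
  have "hamilton_solution D J (\<lambda>u. \<eta> \<bullet> F u) u\<^sub>0 (\<lambda>t. flow \<eta> t u\<^sub>0)"
    using flow_hamiltonian[of \<eta>] u\<^sub>0(1) unfolding hamiltonian_flow_def by blast
  then obtain c' where c': "((\<lambda>t. flow \<eta> t u\<^sub>0) has_vector_derivative c') (at 0)"
      "((\<lambda>u. \<eta> \<bullet> F u) has_derivative J c') (at (flow \<eta> 0 u\<^sub>0))"
    unfolding hamilton_solution_def by blast
  have "c' = 0"
    using vector_derivative_unique_at[OF c'(1) flow_derivative[OF u\<^sub>0(2)]] zero by simp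
  moreover have "((\<lambda>u. \<eta> \<bullet> F u) has_derivative (\<lambda>h. \<eta> \<bullet> F' u\<^sub>0 h)) (at u\<^sub>0)"
    by (intro has_derivative_inner_right F')
  ultimately have "(\<lambda>h. \<eta> \<bullet> F' u\<^sub>0 h) = blinfun_apply (J 0)"
    using c'(2) unfolding flow_0 by (metis has_derivative_unique)
  then show "\<eta> = 0"
    by (intro regular_eq_0) (metis blinfun.zero_right blinfun.zero_left)
qed (simp add: linear_0[OF linear_generator[OF u\<^sub>0(2)]])

text \<open>The generator at \<open>x n\<close> need not converge to the generator at \<open>u\<close>, so the limit is taken in the integrated
condition \<open>F (flow (\<alpha> n) t (x n)) = F (x n)\<close>: as the group acts by isometries, \<open>x n\<close> may be replaced by the fixed
point \<open>u\<close> inside the flow, and the orbit map of \<open>u\<close> is continuous near the identity.\<close>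

lemma isotropy_closed:
  assumes u: "u \<in> V" and lim_u: "x \<longlonglongrightarrow> u" and lim_\<eta>: "\<alpha> \<longlonglongrightarrow> \<eta>"
    and iso: "\<And>n. \<alpha> n \<in> isotropy (x n)"
  shows "\<eta> \<in> isotropy u"
proof -
  obtain U where U: "open U" "0 \<in> U" and C1: "C1_on U (\<lambda>\<eta>. \<Phi> (matrix_exp (\<iota> \<eta>)) u)"
    using C1_orbit_map[OF u] by blast
  have contF: "isCont F v" for v
    using has_derivative_continuous[OF F'] .
  have const: "F (flow \<eta> t u) = F u" if t: "t *\<^sub>R \<eta> \<in> U" for t
  proof -
    have "isCont (\<lambda>\<eta>. \<Phi> (matrix_exp (\<iota> \<eta>)) u) (t *\<^sub>R \<eta>)"
      using C1 t unfolding C1_on_def by (meson has_derivative_continuous)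
    moreover have "(\<lambda>n. t *\<^sub>R \<alpha> n) \<longlonglongrightarrow> t *\<^sub>R \<eta>"
      using lim_\<eta> by (intro tendsto_intros)
    ultimately have "(\<lambda>n. \<Phi> (matrix_exp (\<iota> (t *\<^sub>R \<alpha> n))) u) \<longlonglongrightarrow> \<Phi> (matrix_exp (\<iota> (t *\<^sub>R \<eta>))) u"
      by (rule isCont_tendsto_compose)
    then have 1: "(\<lambda>n. flow (\<alpha> n) t u) \<longlonglongrightarrow> flow \<eta> t u"
      by (simp add: linear_scale[OF linear_\<iota>])
    have "norm (flow (\<alpha> n) t (x n) - flow (\<alpha> n) t u) = norm (x n - u)" for n
      unfolding linear_diff[OF isometric(1)[OF exp_in_G], symmetric] by (rule isometric(3)[OF exp_in_G])
    moreover have "(\<lambda>n. norm (x n - u)) \<longlonglongrightarrow> 0"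
      by (rule tendsto_norm_zero[OF LIM_zero[OF lim_u]])
    ultimately have "(\<lambda>n. norm (flow (\<alpha> n) t (x n) - flow (\<alpha> n) t u)) \<longlonglongrightarrow> 0"
      by (simp only:)
    then have "(\<lambda>n. flow (\<alpha> n) t (x n) - flow (\<alpha> n) t u) \<longlonglongrightarrow> 0"
      by (rule tendsto_norm_zero_cancel)
    from tendsto_add[OF this 1] have "(\<lambda>n. flow (\<alpha> n) t (x n)) \<longlonglongrightarrow> flow \<eta> t u"
      by simp
    then have "(\<lambda>n. F (flow (\<alpha> n) t (x n))) \<longlonglongrightarrow> F (flow \<eta> t u)"
      by (rule isCont_tendsto_compose[OF contF])
    moreover have "F (flow (\<alpha> n) t (x n)) = F (x n)" for n
      using iso by (simp add: isotropy_iff_flow)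
    ultimately have "(\<lambda>n. F (x n)) \<longlonglongrightarrow> F (flow \<eta> t u)"
      by simp
    then show ?thesis
      using isCont_tendsto_compose[OF contF lim_u] by (rule LIMSEQ_unique)
  qed
  define S where "S = {t. t *\<^sub>R \<eta> \<in> U}"
  have "open S"
    unfolding S_def using continuous_open_vimage[OF \<open>open U\<close>, of "\<lambda>t. t *\<^sub>R \<eta>"]
    by (simp add: vimage_def)
  moreover have "0 \<in> S"
    using U(2) by (simp add: S_def)
  ultimately have "((\<lambda>t. F u) has_vector_derivative F' u (X \<eta> u)) (at 0)"
    by (rule has_vector_derivative_transform_within_open[OF momentum_flow_derivative[OF u]])
      (simp add: S_def const)
  then have "F' u (X \<eta> u) = 0"
    using has_vector_derivative_const by (rule vector_derivative_unique_at)
  then show ?thesis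
    using isotropy_iff_derivative[OF u] by blast
qed

text \<open>By compactness of the unit sphere, this is a consequence of the closedness in \<open>isotropy_closed\<close>.\<close>

lemma isotropy_upper_semicontinuous:
  assumes "u \<in> V" and "e > 0"
  shows "\<exists>d>0. \<forall>v\<in>V. dist v u < d \<longrightarrow> (\<forall>\<eta>\<in>isotropy v. \<exists>\<zeta>\<in>isotropy u. norm (\<eta> - \<zeta>) \<le> e * norm \<eta>)"
proof (rule ccontr)
  assume "\<not> ?thesis"
  then have "\<exists>v\<in>V. dist v u < 1 / real (Suc n) \<and>
      (\<exists>\<eta>\<in>isotropy v. \<forall>\<zeta>\<in>isotropy u. norm (\<eta> - \<zeta>) > e * norm \<eta>)" for n
    by (metis divide_pos_pos not_le of_nat_0_less_iff zero_less_Suc zero_less_one)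
  then obtain x \<alpha> where x: "\<And>n. x n \<in> V" "\<And>n. dist (x n) u < 1 / real (Suc n)"
    and \<alpha>: "\<And>n. \<alpha> n \<in> isotropy (x n)" "\<And>n \<zeta>. \<zeta> \<in> isotropy u \<Longrightarrow> norm (\<alpha> n - \<zeta>) > e * norm (\<alpha> n)"
    by metis
  have sub: "subspace (isotropy u)"
    using subspace_isotropy[OF \<open>u \<in> V\<close>] .
  have nz: "norm (\<alpha> n) > 0" for n
    using \<alpha>(2)[OF subspace_0[OF sub], of n] by auto
  define \<beta> where "\<beta> n = (1 / norm (\<alpha> n)) *\<^sub>R \<alpha> n" for n
  have "\<beta> n \<in> sphere 0 1" for n
    using nz[of n] by (simp add: \<beta>_def)
  then obtain \<eta> r where r: "strict_mono (r :: nat \<Rightarrow> nat)" "(\<beta> \<circ> r) \<longlonglongrightarrow> \<eta>"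
    using compact_sphere[of "0 :: real^'m" 1] unfolding compact_def by metis
  have "(\<lambda>n. dist (x n) u) \<longlonglongrightarrow> 0"
    by (rule tendsto_sandwich[OF _ _ tendsto_const LIMSEQ_Suc[OF lim_1_over_n]])
      (use x(2) in \<open>auto intro!: always_eventually less_imp_le simp del: of_nat_Suc\<close>)
  then have "x \<longlonglongrightarrow> u"
    by (rule tendsto_dist_iff[THEN iffD2])
  then have "(x \<circ> r) \<longlonglongrightarrow> u"
    using r(1) by (rule LIMSEQ_subseq_LIMSEQ)
  moreover have "(\<beta> \<circ> r) n \<in> isotropy ((x \<circ> r) n)" for n
    using subspace_scale[OF subspace_isotropy[OF x(1)] \<alpha>(1)] by (simp add: \<beta>_def)
  ultimately have \<eta>: "\<eta> \<in> isotropy u"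
    using isotropy_closed[OF \<open>u \<in> V\<close> _ r(2)] by blast
  have "norm (\<beta> n - \<eta>) > e" for n
  proof -
    have "\<alpha> n - norm (\<alpha> n) *\<^sub>R \<eta> = norm (\<alpha> n) *\<^sub>R (\<beta> n - \<eta>)"
      using nz[of n] by (simp add: \<beta>_def scaleR_diff_right)
    then have "norm (\<alpha> n) * norm (\<beta> n - \<eta>) > e * norm (\<alpha> n)"
      using \<alpha>(2)[OF subspace_scale[OF sub \<eta>], of n "norm (\<alpha> n)"] by simp
    then show ?thesis
      using nz[of n] by (simp add: mult.commute)
  qed
  moreover have "\<forall>\<^sub>F n in sequentially. dist ((\<beta> \<circ> r) n) \<eta> < e"
    using r(2) \<open>e > 0\<close> by (rule tendstoD)
  then obtain n where "dist ((\<beta> \<circ> r) n) \<eta> < e"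
    using eventually_happens' sequentially_bot by blast
  ultimately show False
    by (metis comp_apply dist_norm less_asym)
qed

lemma isotropy_lower_semicontinuous:
  assumes "u \<in> V" and "e > 0"
  shows "\<exists>d>0. \<forall>v\<in>V. dist v u < d \<and> dim (isotropy v) = dim (isotropy u) \<longrightarrow>
    (\<forall>\<zeta>\<in>isotropy u. \<exists>\<eta>\<in>isotropy v. norm (\<eta> - \<zeta>) \<le> e * norm \<zeta>)"
proof -
  define e' where "e' = min (e / 2) (1 / 2)"
  have e': "e' > 0" "e' \<le> 1 / 2" "2 * e' \<le> e"
    using \<open>e > 0\<close> by (auto simp: e'_def)
  obtain d where d: "d > 0" "\<And>v \<eta>. v \<in> V \<Longrightarrow> dist v u < d \<Longrightarrow> \<eta> \<in> isotropy v \<Longrightarrow>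
      \<exists>\<zeta>\<in>isotropy u. norm (\<eta> - \<zeta>) \<le> e' * norm \<eta>"
    using isotropy_upper_semicontinuous[OF \<open>u \<in> V\<close> e'(1)] by metis
  have "\<exists>\<eta>\<in>isotropy v. norm (\<eta> - \<zeta>) \<le> e * norm \<zeta>"
    if "v \<in> V" "dist v u < d" "dim (isotropy v) = dim (isotropy u)" "\<zeta> \<in> isotropy u" for v \<zeta>
  proof -
    have "\<exists>\<eta>\<in>isotropy v. norm (\<eta> - \<zeta>) \<le> 2 * e' * norm \<zeta>"
      using that e' d by (intro subspace_approx_converse[of "isotropy u"] subspace_isotropy \<open>u \<in> V\<close>) auto
    moreover have "2 * e' * norm \<zeta> \<le> e * norm \<zeta>"
      using e'(3) by (rule mult_right_mono) simp
    ultimately show ?thesis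
      using order_trans by blast
  qed
  then show ?thesis
    using d(1) by blast
qed

text \<open>Let \<open>k = X \<zeta> u\<^sub>0\<close> and take \<open>\<eta>\<close> in the isotropy algebra at \<open>v\<close> close to \<open>\<zeta>\<close>. By skew-symmetry,
\<open>0 = sp k (X \<eta> v) = sp k (X \<eta> u\<^sub>0) - sp (X \<eta> k) (v - u\<^sub>0)\<close>. The first term is close to \<open>sp k k\<close>, which is at least
\<open>c * \<parallel>\<zeta>\<parallel>\<^sup>2\<close>, while the second one is at most a constant times \<open>\<parallel>\<zeta>\<parallel>\<^sup>2 * \<parallel>v - u\<^sub>0\<parallel>\<close>; so \<open>\<zeta> = 0\<close>. The
generators act twice here, which is why the tangent vectors have to lie in \<open>V\<close>.\<close>

lemma tangent_orthogonal_to_nearby_orbit_eq_0: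
  assumes K: "(\<lambda>\<eta>. X \<eta> u\<^sub>0) ` isotropy u\<^sub>0 \<subseteq> V"
  shows "\<exists>d>0. \<forall>v\<in>V. dist v u\<^sub>0 < d \<and> dim (isotropy v) = dim (isotropy u\<^sub>0) \<longrightarrow>
    (\<forall>k\<in>(\<lambda>\<eta>. X \<eta> u\<^sub>0) ` isotropy u\<^sub>0. (\<forall>\<eta>\<in>isotropy v. sp k (X \<eta> v) = 0) \<longrightarrow> k = 0)"
proof -
  interpret sp: bounded_bilinear sp
    by (rule bounded_bilinear_sp)
  have lin: "linear (\<lambda>\<eta>. X \<eta> u\<^sub>0)" and blin: "bounded_linear (\<lambda>\<eta>. X \<eta> u\<^sub>0)"
    using linear_generator bounded_linear_generator u\<^sub>0(2) by blast+
  obtain M where M: "M > 0" "\<And>\<eta>. norm (X \<eta> u\<^sub>0) \<le> norm \<eta> * M"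
    using bounded_linear.pos_bounded[OF blin] by blast
  obtain c where c: "c > 0" "\<And>\<eta>. c * (norm \<eta>)\<^sup>2 \<le> sp (X \<eta> u\<^sub>0) (X \<eta> u\<^sub>0)"
  proof -
    have cont: "continuous_on (sphere 0 1) (\<lambda>\<eta>. sp (X \<eta> u\<^sub>0) (X \<eta> u\<^sub>0))"
      by (intro sp.continuous_on linear_continuous_on blin)
    have "sphere (0 :: real^'m) 1 \<noteq> {}"
      by simp
    then obtain \<eta>0 where \<eta>0: "\<eta>0 \<in> sphere 0 1"
        "\<And>\<eta>. \<eta> \<in> sphere 0 1 \<Longrightarrow> sp (X \<eta>0 u\<^sub>0) (X \<eta>0 u\<^sub>0) \<le> sp (X \<eta> u\<^sub>0) (X \<eta> u\<^sub>0)"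
      using continuous_attains_inf[OF compact_sphere _ cont] by blast
    have "\<eta>0 \<noteq> 0"
      using \<eta>0(1) by auto
    then have "sp (X \<eta>0 u\<^sub>0) (X \<eta>0 u\<^sub>0) > 0"
      by (intro sp_pos) (simp add: generator_u0_eq_0_iff)
    moreover have "sp (X \<eta>0 u\<^sub>0) (X \<eta>0 u\<^sub>0) * (norm \<eta>)\<^sup>2 \<le> sp (X \<eta> u\<^sub>0) (X \<eta> u\<^sub>0)" for \<eta>
    proof (cases "\<eta> = 0")
      case False
      define \<theta> where "\<theta> = (1 / norm \<eta>) *\<^sub>R \<eta>"
      have "sp (X \<eta>0 u\<^sub>0) (X \<eta>0 u\<^sub>0) \<le> sp (X \<theta> u\<^sub>0) (X \<theta> u\<^sub>0)"
        using False by (intro \<eta>0(2)) (simp add: \<theta>_def)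
      then have "sp (X \<eta>0 u\<^sub>0) (X \<eta>0 u\<^sub>0) * (norm \<eta>)\<^sup>2 \<le> sp (X \<theta> u\<^sub>0) (X \<theta> u\<^sub>0) * (norm \<eta>)\<^sup>2"
        by (rule mult_right_mono) simp
      also have "\<dots> = sp (X \<eta> u\<^sub>0) (X \<eta> u\<^sub>0)"
        using False by (simp add: \<theta>_def linear_scale[OF lin] sp.scaleR_left sp.scaleR_right power2_eq_square)
      finally show ?thesis .
    qed (simp add: linear_0[OF lin] sp.zero_left)
    ultimately show thesis
      using that by blast
  qed
  have sub: "subspace (isotropy u\<^sub>0)"
    using subspace_isotropy u\<^sub>0(2) by blast
  obtain P where P: "bounded_linear P" "\<And>x. P x \<in> isotropy u\<^sub>0" "\<And>x s. s \<in> isotropy u\<^sub>0 \<Longrightarrow> (x - P x) \<bullet> s = 0"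
    using closed_subspace_projection[OF closed_subspace[OF sub] sub] by blast
  interpret P: bounded_linear P by fact
  have P_id: "P \<zeta> = \<zeta>" if "\<zeta> \<in> isotropy u\<^sub>0" for \<zeta>
  proof -
    have "(\<zeta> - P \<zeta>) \<bullet> (\<zeta> - P \<zeta>) = 0"
      using that P(2) sub by (intro P(3) subspace_diff)
    then show ?thesis
      by (metis inner_eq_zero_iff right_minus_eq)
  qed
  have XP: "X (P \<zeta>) u\<^sub>0 \<in> V" for \<zeta>
    using K P(2) by blast
  \<comment> \<open>Composition with the projection \<open>P\<close> extends \<open>(\<eta>, \<zeta>) \<mapsto> X \<eta> (X \<zeta> u\<^sub>0)\<close> to a bilinear map on the whole
    finite-dimensional space, and such a map is bounded.\<close>
  have "bilinear (\<lambda>\<eta> \<zeta>. X \<eta> (X (P \<zeta>) u\<^sub>0))"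
    unfolding bilinear_def
  proof (intro conjI allI)
    show "linear (\<lambda>\<zeta>. X \<eta> (X (P \<zeta>) u\<^sub>0))" for \<eta>
      by (intro linearI)
        (simp_all add: P.add P.scaleR linear_add[OF lin] linear_scale[OF lin] generator_add generator_scale XP)
    show "linear (\<lambda>\<eta>. X \<eta> (X (P \<zeta>) u\<^sub>0))" for \<zeta>
      by (intro linear_generator XP)
  qed
  then obtain b where b: "b > 0" "\<And>\<eta> \<zeta>. norm (X \<eta> (X (P \<zeta>) u\<^sub>0)) \<le> b * norm \<eta> * norm \<zeta>"
    using bilinear_bounded_pos by metis
  \<comment> \<open>The constants \<open>e\<close> and \<open>d\<close> make each of the two error terms at most a quarter of \<open>c * \<parallel>\<zeta>\<parallel>\<^sup>2\<close>.\<close>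
  define e where "e = min 1 (c / (4 * M * M))"
  have e: "e > 0" "e \<le> 1" "M * M * e \<le> c / 4"
    using M(1) c(1) by (auto simp: e_def min_def field_simps)
  obtain d1 where d1: "d1 > 0" and near: "\<And>v \<zeta>. v \<in> V \<Longrightarrow> dist v u\<^sub>0 < d1 \<Longrightarrow>
      dim (isotropy v) = dim (isotropy u\<^sub>0) \<Longrightarrow> \<zeta> \<in> isotropy u\<^sub>0 \<Longrightarrow>
      \<exists>\<eta>\<in>isotropy v. norm (\<eta> - \<zeta>) \<le> e * norm \<zeta>"
    using isotropy_lower_semicontinuous[OF u\<^sub>0(2) e(1)] by metis
  define d where "d = min d1 (c / (8 * b))"
  have d: "d > 0" "d \<le> d1" "2 * b * d \<le> c / 4"
    using d1 b(1) c(1) by (auto simp: d_def min_def field_simps)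
  have "k = 0" if v: "v \<in> V" "dist v u\<^sub>0 < d" "dim (isotropy v) = dim (isotropy u\<^sub>0)"
    and k: "k \<in> (\<lambda>\<eta>. X \<eta> u\<^sub>0) ` isotropy u\<^sub>0" and orth: "\<And>\<eta>. \<eta> \<in> isotropy v \<Longrightarrow> sp k (X \<eta> v) = 0" for v k
  proof -
    obtain \<zeta> where \<zeta>: "\<zeta> \<in> isotropy u\<^sub>0" "k = X \<zeta> u\<^sub>0"
      using k by blast
    have "k \<in> V"
      using K k by blast
    obtain \<eta> where \<eta>: "\<eta> \<in> isotropy v" "norm (\<eta> - \<zeta>) \<le> e * norm \<zeta>"
      using near[OF v(1) _ v(3) \<zeta>(1)] v(2) d(2) by force
    have "e * norm \<zeta> \<le> norm \<zeta>"
      using e(2) mult_right_mono[of e 1 "norm \<zeta>"] by simp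
    then have \<eta>2: "norm \<eta> \<le> 2 * norm \<zeta>"
      using \<eta>(2) norm_triangle_ineq[of \<zeta> "\<eta> - \<zeta>"] by simp
    have 1: "sp k (X \<eta> u\<^sub>0) = sp (X \<eta> k) (v - u\<^sub>0)"
      using orth[OF \<eta>(1)] generator_skew[OF \<open>k \<in> V\<close> v(1), of \<eta>] generator_skew[OF \<open>k \<in> V\<close> u\<^sub>0(2), of \<eta>]
      by (simp add: sp.diff_right)
    have "\<bar>sp (X \<eta> k) (v - u\<^sub>0)\<bar> \<le> norm (X \<eta> k) * norm (v - u\<^sub>0)"
      by (rule sp_bound)
    also have "\<dots> \<le> (b * (2 * norm \<zeta>) * norm \<zeta>) * d"
    proof (intro mult_mono)
      have "norm (X \<eta> k) \<le> b * norm \<eta> * norm \<zeta>"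
        using b(2)[of \<eta> \<zeta>] by (simp add: P_id \<zeta>)
      also have "\<dots> \<le> b * (2 * norm \<zeta>) * norm \<zeta>"
        using \<eta>2 b(1) by (intro mult_right_mono mult_left_mono) auto
      finally show "norm (X \<eta> k) \<le> b * (2 * norm \<zeta>) * norm \<zeta>" .
      show "norm (v - u\<^sub>0) \<le> d"
        using v(2) by (simp add: dist_norm)
    qed (use b(1) in auto)
    also have "\<dots> = (2 * b * d) * (norm \<zeta>)\<^sup>2"
      by (simp add: power2_eq_square)
    also have "\<dots> \<le> c / 4 * (norm \<zeta>)\<^sup>2"
      using d(3) by (rule mult_right_mono) simp
    finally have 2: "\<bar>sp k (X \<eta> u\<^sub>0)\<bar> \<le> c / 4 * (norm \<zeta>)\<^sup>2"
      by (simp add: 1)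
    have "X \<eta> u\<^sub>0 = k + X (\<eta> - \<zeta>) u\<^sub>0"
      by (simp add: \<zeta>(2) linear_diff[OF lin])
    then have 3: "sp k (X \<eta> u\<^sub>0) = sp k k + sp k (X (\<eta> - \<zeta>) u\<^sub>0)"
      by (simp add: sp.add_right)
    have "\<bar>sp k (X (\<eta> - \<zeta>) u\<^sub>0)\<bar> \<le> norm k * norm (X (\<eta> - \<zeta>) u\<^sub>0)"
      by (rule sp_bound)
    also have "\<dots> \<le> (norm \<zeta> * M) * ((e * norm \<zeta>) * M)"
    proof (rule mult_mono)
      show "norm k \<le> norm \<zeta> * M"
        using M(2) by (simp add: \<zeta>(2))
      show "norm (X (\<eta> - \<zeta>) u\<^sub>0) \<le> (e * norm \<zeta>) * M"
        using order_trans[OF M(2) mult_right_mono[OF \<eta>(2)]] M(1) by simp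
    qed (use M(1) in auto)
    also have "\<dots> = (M * M * e) * (norm \<zeta>)\<^sup>2"
      by (simp add: power2_eq_square)
    also have "\<dots> \<le> c / 4 * (norm \<zeta>)\<^sup>2"
      using e(3) by (rule mult_right_mono) simp
    finally have "sp k k \<le> c / 4 * (norm \<zeta>)\<^sup>2 + c / 4 * (norm \<zeta>)\<^sup>2"
      using 2 3 by linarith
    moreover have "c * (norm \<zeta>)\<^sup>2 \<le> sp k k"
      using c(2)[of \<zeta>] by (simp add: \<zeta>(2))
    ultimately have "c * (norm \<zeta>)\<^sup>2 \<le> 0"
      by (simp add: field_simps)
    then have "\<zeta> = 0"
      using c(1) by (simp add: mult_le_0_iff)
    then show "k = 0"
      by (simp add: \<zeta>(2) linear_0[OF lin])
  qed
  then show ?thesis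
    using d(1) by blast
qed

end

section \<open>Persistence of relative equilibria\<close>

theorem theorem7p1:
  fixes D :: "'e::{real_inner,banach} set"
    and J :: "'e \<Rightarrow>\<^sub>L ('e \<Rightarrow>\<^sub>L real)"
    and sp :: "'e \<Rightarrow> 'e \<Rightarrow> real"
    and j :: "'e \<Rightarrow> 'h::{real_inner,banach}"
    and T2 T :: "'h \<rightharpoonup> 'h"
    and i2 :: "'e2::banach \<Rightarrow> 'e"
    and H :: "'e \<Rightarrow> real"
    and G :: "(complex^'n^'n) set"
    and \<iota> :: "real^'m \<Rightarrow> complex^'n^'n"
    and \<Phi> :: "complex^'n^'n \<Rightarrow> 'e \<Rightarrow> 'e"
    and F :: "'e \<Rightarrow> real^'m"
    and \<xi>\<^sub>s :: "real^'m"
    and u\<^sub>s :: 'e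
  defines "L \<equiv> lagrangian H F"
  assumes "symplectic_triple D J"
    and "continuous_scalar_product sp"
    and "is_completion sp j"
    and "form_operator_sqrt j T2 T"
    and "is_E2 j T2 i2"
    and "C2_on UNIV H" and "H \<in> Dif D J"
    and "matrix_lie_group G" and "connected G"
    and "lie_algebra_coords G \<iota>"
    and "globally_hamiltonian D J G \<iota> \<Phi> F"
    and "Ad_star_equivariant G \<iota> \<Phi> F"
    and "C2_on UNIV F"
    and "\<forall>g\<in>G. H \<circ> \<Phi> g = H"
    and "\<forall>g\<in>G. linear (\<Phi> g) \<and> (\<forall>v w. sp (\<Phi> g v) (\<Phi> g w) = sp v w) \<and>
                (\<forall>v. norm (\<Phi> g v) = norm v)"
    and "u\<^sub>s \<in> D \<inter> range i2"
    and "(L \<xi>\<^sub>s has_derivative (\<lambda>_. 0)) (at u\<^sub>s)"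
    and a: "\<exists>\<epsilon>>0. \<exists>C>0. \<forall>v. second_deriv (L \<xi>\<^sub>s) u\<^sub>s v v
               \<ge> \<epsilon> * (norm v)\<^sup>2 - C * (sqrt (sp v v))\<^sup>2"
    and b: "\<forall>u \<xi>. \<exists>w. \<forall>v. frechet_derivative (L \<xi>) (at (i2 u)) v = w \<bullet> j v"
    and c: "C1_on UNIV (\<lambda>(\<xi>, u). hat_gradient j (L \<xi>) (i2 u))"
    and d: "\<forall>v. C1_on_group G \<iota> (\<lambda>g. \<Phi> g (i2 v))"
    and e: "dim (range (frechet_derivative F (at u\<^sub>s))) = CARD('m)"
    and f: "\<forall>\<^sub>F \<mu> in nhds (F u\<^sub>s).
              dim (isotropy_algebra G \<iota> \<mu>) = dim (isotropy_algebra G \<iota> (F u\<^sub>s))"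
    and i: "dom (hessian_op j (L \<xi>\<^sub>s) u\<^sub>s) = dom T2"
    and ii: "form_kernel (second_deriv (L \<xi>\<^sub>s) u\<^sub>s) = orbit_tangent G \<iota> \<Phi> F u\<^sub>s"
    and iii: "(INF s\<in>op_spectrum (hessian_op j (L \<xi>\<^sub>s) u\<^sub>s) \<inter> {0<..}. ereal s) > 0"
    and iv: "morse_index (second_deriv (L \<xi>\<^sub>s) u\<^sub>s) < \<infinity>"
  shows "\<exists>\<Omega> (U :: real^'m \<Rightarrow> 'e).
           open \<Omega> \<and> \<xi>\<^sub>s \<in> \<Omega> \<and> C1_on \<Omega> U \<and> U \<xi>\<^sub>s = u\<^sub>s \<and>
           (\<forall>\<xi>\<in>\<Omega>. \<forall>v. frechet_derivative H (at (U \<xi>)) v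
                        - \<xi> \<bullet> frechet_derivative F (at (U \<xi>)) v = 0) \<and>
           inj_on U \<Omega> \<and> (\<forall>\<xi>\<in>\<Omega>. inj (frechet_derivative U (at \<xi>)))"
proof -
  note sp = \<open>continuous_scalar_product sp\<close>
  note compl = \<open>is_completion sp j\<close>
  have j: "inj j" "bounded_linear j" and sep: "\<And>w w'. (\<And>v. w \<bullet> j v = w' \<bullet> j v) \<Longrightarrow> w = w'"
    using completion_inclusion[OF sp compl] by blast+
  have j_sp: "j v \<bullet> j w = sp v w" for v w
    using compl by (simp add: is_completion_def)
  have "linear i2" and dom_T2: "dom T2 = range (\<lambda>z. j (i2 z))"
    using \<open>is_E2 j T2 i2\<close> by (auto simp: is_E2_def)
  have i2: "bounded_linear i2"
    by (rule bounded_linear_intro[of _ 1])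
      (simp_all add: linear_add[OF \<open>linear i2\<close>] linear_scale[OF \<open>linear i2\<close>]
        norm_E2_inclusion_le[OF sp compl \<open>form_operator_sqrt j T2 T\<close> \<open>is_E2 j T2 i2\<close>])
  interpret j: bounded_linear j by (rule j(2))
  interpret i2: bounded_linear i2 by (rule i2)
  obtain H' H'' where H': "\<And>x. (H has_derivative blinfun_apply (H' x)) (at x)"
    and H'': "\<And>x. (H' has_derivative blinfun_apply (H'' x)) (at x)"
    using C2_on_UNIV_derivatives[OF \<open>C2_on UNIV H\<close>] by metis
  obtain F' F'' where F': "\<And>x. (F has_derivative blinfun_apply (F' x)) (at x)"
    and F'': "\<And>x. (F' has_derivative blinfun_apply (F'' x)) (at x)"
    using C2_on_UNIV_derivatives[OF \<open>C2_on UNIV F\<close>] by metis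

  define L' where "L' \<xi> u = H' u - (blinfun_inner_right \<xi> o\<^sub>L F' u)" for \<xi> u
  define L'' where "L'' \<xi> u h = H'' u h - (blinfun_inner_right \<xi> o\<^sub>L F'' u h)" for \<xi> u h
  have L'_apply: "L' \<xi> u v = H' u v - \<xi> \<bullet> F' u v" for \<xi> u v
    by (simp add: L'_def blinfun.diff_left)
  have L': "(L \<xi> has_derivative blinfun_apply (L' \<xi> u)) (at u)" for \<xi> u
  proof -
    have "((\<lambda>u. H u - \<xi> \<bullet> F u) has_derivative (\<lambda>h. H' u h - \<xi> \<bullet> F' u h)) (at u)"
      by (intro has_derivative_diff has_derivative_inner_right H' F')
    moreover have "L \<xi> = (\<lambda>u. H u - \<xi> \<bullet> F u)"
      by (simp add: L_def lagrangian_def fun_eq_iff)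
    moreover have "blinfun_apply (L' \<xi> u) = (\<lambda>h. H' u h - \<xi> \<bullet> F' u h)"
      by (simp add: L'_apply fun_eq_iff)
    ultimately show ?thesis
      by simp
  qed
  have L'': "(L' \<xi> has_derivative L'' \<xi> u) (at u)" for \<xi> u
    unfolding L'_def[abs_def] L''_def[abs_def]
    by (intro has_derivative_diff H''
        bounded_linear.has_derivative[OF bounded_bilinear.bounded_linear_right[OF bounded_bilinear_blinfun_compose]] F'')

  define B where "B = second_deriv (L \<xi>\<^sub>s) u\<^sub>s"
  have B_eq: "B v w = L'' \<xi>\<^sub>s u\<^sub>s v w" for v w
    unfolding B_def by (rule second_deriv_eq[OF L' L''])
  have B_sym: "B v w = B w v" for v w
    unfolding B_eq by (rule second_derivative_symmetric[OF L' L''])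
  have B_bilinear: "bilinear B"
  proof -
    interpret L'': bounded_linear "L'' \<xi>\<^sub>s u\<^sub>s"
      by (rule has_derivative_bounded_linear[OF L''])
    show ?thesis
      unfolding bilinear_def B_eq[abs_def]
      by (intro conjI allI linearI)
        (simp_all add: L''.add L''.scaleR blinfun.add_left blinfun.add_right blinfun.scaleR_left blinfun.scaleR_right)
  qed

  define A where "A = hessian_op j (L \<xi>\<^sub>s) u\<^sub>s"
  have A_iff: "A z = Some w \<longleftrightarrow> (\<exists>x. z = j x \<and> (\<forall>v. B x v = w \<bullet> j v))" for z w
    unfolding A_def B_def by (rule hessian_op_eq_Some_iff[OF sp compl])
  have A_domD: "\<exists>x. z = j x \<and> (\<forall>v. B x v = the (A z) \<bullet> j v)" if z: "z \<in> dom A" for z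
  proof -
    obtain w where w: "A z = Some w"
      using z by blast
    then obtain x where "z = j x" "\<forall>v. B x v = w \<bullet> j v"
      using A_iff by blast
    moreover have "the (A z) = w"
      using w by simp
    ultimately show ?thesis
      by blast
  qed
  have A_form: "B x v = the (A (j x)) \<bullet> j v" if x: "j x \<in> dom A" for x v
    using A_domD[OF x] injD[OF j(1)] by metis
  have A_sym: "the (A x) \<bullet> y = x \<bullet> the (A y)" if xy: "x \<in> dom A" "y \<in> dom A" for x y
  proof -
    obtain v w where vw: "x = j v" "y = j w"
      using A_domD xy by metis
    then have "the (A x) \<bullet> y = B v w" "the (A y) \<bullet> x = B w v"
      using A_form xy by auto
    then show ?thesis
      using B_sym[of v w] by (simp add: inner_commute)
  qed
  have A_add: "A (x + y) = Some (the (A x) + the (A y))" if xy: "x \<in> dom A" "y \<in> dom A" for x y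
  proof -
    obtain v w where vw: "x = j v" "y = j w"
      using A_domD xy by metis
    have "B (v + w) h = (the (A x) + the (A y)) \<bullet> j h" for h
      using A_form[of v h] A_form[of w h] xy
      by (simp add: vw bilinear_ladd[OF B_bilinear] inner_add_left)
    moreover have "x + y = j (v + w)"
      by (simp add: vw j.add)
    ultimately show ?thesis
      unfolding A_iff by blast
  qed
  have A_scale: "A (r *\<^sub>R x) = Some (r *\<^sub>R the (A x))" if x: "x \<in> dom A" for r x
  proof -
    obtain v where v: "x = j v"
      using A_domD x by metis
    have "B (r *\<^sub>R v) h = (r *\<^sub>R the (A x)) \<bullet> j h" for h
      using A_form[of v h] x by (simp add: v bilinear_lmul[OF B_bilinear])
    moreover have "r *\<^sub>R x = j (r *\<^sub>R v)"
      by (simp add: v j.scaleR)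
    ultimately show ?thesis
      unfolding A_iff by blast
  qed
  have "A 0 = Some 0"
  proof -
    have "(0 :: 'h) = j 0 \<and> (\<forall>v. B 0 v = 0 \<bullet> j v)"
      by (simp add: j.zero bilinear_lzero[OF B_bilinear])
    then show ?thesis
      unfolding A_iff by blast
  qed
  then have A_linear: "linear_op A"
    unfolding linear_op_def subspace_def using A_add A_scale by (simp add: domI)
  have dom_A: "dom A = range (\<lambda>z. j (i2 z))"
    using i dom_T2 by (simp add: A_def)

  define g where "g \<xi> z = hat_gradient j (L \<xi>) (i2 z)" for \<xi> z
  have g: "L' \<xi> (i2 z) v = g \<xi> z \<bullet> j v" for \<xi> z v
  proof -
    have fd: "frechet_derivative (L \<xi>) (at (i2 z)) = blinfun_apply (L' \<xi> (i2 z))"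
      by (rule frechet_derivative_at[OF L', symmetric])
    obtain w where "\<forall>v. frechet_derivative (L \<xi>) (at (i2 z)) v = w \<bullet> j v"
      using b by blast
    then have w: "L' \<xi> (i2 z) v = w \<bullet> j v" for v
      unfolding fd by blast
    have "g \<xi> z = w"
      unfolding g_def hat_gradient_def fd
    proof (rule the_equality)
      show "\<forall>v. L' \<xi> (i2 z) v = w \<bullet> j v"
        using w by simp
      show "w' = w" if "\<forall>v. L' \<xi> (i2 z) v = w' \<bullet> j v" for w'
        using that w by (intro sep) metis
    qed
    then show ?thesis
      using w by simp
  qed
  obtain g' where g': "\<And>p. ((\<lambda>(\<xi>, z). g \<xi> z) has_derivative blinfun_apply (g' p)) (at p)"
    and g'_cont: "continuous_on UNIV g'"
    using c unfolding C1_on_def g_def by (metis UNIV_I)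
  obtain z\<^sub>s where z\<^sub>s: "i2 z\<^sub>s = u\<^sub>s" and "u\<^sub>s \<in> D"
    using \<open>u\<^sub>s \<in> D \<inter> range i2\<close> by blast
  \<comment> \<open>The Hessian operator is the derivative of the gradient on \<open>E\<^sub>2\<close>: both represent the second derivative.\<close>
  have A_gradient: "A (j (i2 h)) = Some (g' (\<xi>\<^sub>s, z\<^sub>s) (0, h))" for h
  proof -
    have "B (i2 h) v = g' (\<xi>\<^sub>s, z\<^sub>s) (0, h) \<bullet> j v" for v
    proof -
      have "(i2 has_derivative i2) (at z\<^sub>s)"
        by (rule i2.has_derivative[OF has_derivative_ident])
      then have "((\<lambda>z. L' \<xi>\<^sub>s (i2 z)) has_derivative (\<lambda>h. L'' \<xi>\<^sub>s u\<^sub>s (i2 h))) (at z\<^sub>s)"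
        by (rule has_derivative_compose) (simp add: z\<^sub>s L'')
      then have 1: "((\<lambda>z. L' \<xi>\<^sub>s (i2 z) v) has_derivative (\<lambda>h. L'' \<xi>\<^sub>s u\<^sub>s (i2 h) v)) (at z\<^sub>s)"
        by (rule bounded_linear.has_derivative[OF blinfun.bounded_linear_left])
      have "((\<lambda>z. (\<xi>\<^sub>s, z)) has_derivative (\<lambda>h. (0, h))) (at z\<^sub>s)"
        by (intro has_derivative_Pair has_derivative_const has_derivative_ident)
      from has_derivative_compose[OF this g']
      have "((\<lambda>z. g \<xi>\<^sub>s z) has_derivative (\<lambda>h. g' (\<xi>\<^sub>s, z\<^sub>s) (0, h))) (at z\<^sub>s)"
        by simp
      then have "((\<lambda>z. g \<xi>\<^sub>s z \<bullet> j v) has_derivative (\<lambda>h. g' (\<xi>\<^sub>s, z\<^sub>s) (0, h) \<bullet> j v)) (at z\<^sub>s)"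
        by (rule has_derivative_inner_left)
      then have "(\<lambda>h. L'' \<xi>\<^sub>s u\<^sub>s (i2 h) v) = (\<lambda>h. g' (\<xi>\<^sub>s, z\<^sub>s) (0, h) \<bullet> j v)"
        using 1 unfolding g by (rule has_derivative_unique[rotated])
      then show ?thesis
        unfolding B_eq by (rule fun_cong)
    qed
    then show ?thesis
      unfolding A_iff by blast
  qed

  have regular: "range (F' u\<^sub>s) = UNIV"
  proof -
    have "frechet_derivative F (at u\<^sub>s) = blinfun_apply (F' u\<^sub>s)"
      by (rule frechet_derivative_at[OF F', symmetric])
    then have dim: "dim (range (F' u\<^sub>s)) = CARD('m)"
      using e by simp
    have "subspace (range (F' u\<^sub>s))"
      by (rule linear_subspace_image[OF bounded_linear.linear[OF blinfun.bounded_linear_right] subspace_UNIV])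
    moreover have "span (range (F' u\<^sub>s)) = UNIV"
      using dim_eq_full[of "range (F' u\<^sub>s)"] dim by simp
    ultimately show ?thesis
      by (simp add: span_eq_iff[THEN iffD2])
  qed
  interpret isometric_hamiltonian_action D J sp G \<iota> \<Phi> F F' "range i2" u\<^sub>s
  proof (rule isometric_hamiltonian_action.intro)
    show "subspace (range i2)"
      by (rule linear_subspace_image[OF \<open>linear i2\<close> subspace_UNIV])
    show "C1_on_group G \<iota> (\<lambda>g. \<Phi> g v)" if "v \<in> range i2" for v
      using d that by blast
    show "u\<^sub>s \<in> range i2"
      using z\<^sub>s by blast
    show "linear (\<Phi> g)" "sp (\<Phi> g v) (\<Phi> g w) = sp v w" "norm (\<Phi> g v) = norm v" if "g \<in> G" for g v w
      using \<open>\<forall>g\<in>G. linear (\<Phi> g) \<and> (\<forall>v w. sp (\<Phi> g v) (\<Phi> g w) = sp v w) \<and>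
        (\<forall>v. norm (\<Phi> g v) = norm v)\<close> that by auto
  qed (fact F' regular \<open>u\<^sub>s \<in> D\<close> sp \<open>matrix_lie_group G\<close> \<open>lie_algebra_coords G \<iota>\<close>
      \<open>globally_hamiltonian D J G \<iota> \<Phi> F\<close> \<open>Ad_star_equivariant G \<iota> \<Phi> F\<close>)+

  define K where "K = (\<lambda>\<eta>. X \<eta> u\<^sub>s) ` isotropy u\<^sub>s"
  have K_kernel: "K = form_kernel B"
    using ii by (simp add: K_def B_def orbit_tangent_def)
  have ker_iff: "x \<in> j ` K \<longleftrightarrow> x \<in> dom A \<and> the (A x) = 0" for x
  proof
    assume "x \<in> j ` K"
    then obtain k where k: "x = j k" "\<And>w. B k w = 0"
      by (auto simp: K_kernel form_kernel_def)
    then have "A x = Some 0"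
      unfolding A_iff by (intro exI[of _ k]) simp
    then show "x \<in> dom A \<and> the (A x) = 0"
      by (simp add: domI)
  next
    assume x: "x \<in> dom A \<and> the (A x) = 0"
    then obtain k where "x = j k" "\<forall>v. B k v = the (A x) \<bullet> j v"
      using A_domD by blast
    then show "x \<in> j ` K"
      using x by (auto simp: K_kernel form_kernel_def)
  qed
  \<comment> \<open>Elements of the kernel lie in the domain of the Hessian operator, which is that of \<open>T2\<close>.\<close>
  have K_sub: "K \<subseteq> range i2"
  proof
    fix k assume "k \<in> K"
    then have "j k \<in> range (\<lambda>z. j (i2 z))"
      using ker_iff dom_A by blast
    then show "k \<in> range i2"
      using injD[OF j(1)] by blast
  qed
  have lin_gen: "linear (\<lambda>\<eta>. j (X \<eta> u\<^sub>s))"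
    using linear_compose[OF linear_generator[OF u\<^sub>0(2)] j.linear_axioms] by (simp add: comp_def)
  have jK: "j ` K = (\<lambda>\<eta>. j (X \<eta> u\<^sub>s)) ` isotropy u\<^sub>s"
    by (simp add: K_def image_image)
  have "closed (j ` K)" "subspace (j ` K)"
    unfolding jK using lin_gen subspace_isotropy[OF u\<^sub>0(2)]
    by (rule closed_linear_image_subspace, rule linear_subspace_image)
  then obtain P where P: "bounded_linear P" "\<And>x. P x \<in> j ` K" "\<And>x s. s \<in> j ` K \<Longrightarrow> (x - P x) \<bullet> s = 0"
    using closed_subspace_projection by blast
  interpret P: bounded_linear P by (rule P(1))

  obtain \<delta> where \<delta>: "\<delta> > 0" "\<And>s. 0 < s \<Longrightarrow> s < \<delta> \<Longrightarrow> s \<notin> op_spectrum A"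
    using gap_from_INF[OF iii[folded A_def]] by metis
  obtain n where n: "morse_index B = enat n"
    using iv unfolding B_def by (metis enat_ord_simps(4) not_enat_eq)
  have solve: "\<exists>w\<in>dom A. the (A w) = f" if f: "\<And>k. k \<in> j ` K \<Longrightarrow> f \<bullet> k = 0" for f
  proof (rule spectral_gap_finite_index_solvable[OF A_linear A_sym \<delta>(1)])
    show "s \<in> resolvent_set A" if "0 < s" "s < \<delta>" for s
      using \<delta>(2)[OF that] by (simp add: op_spectrum_def)
    show "f \<bullet> k = 0" if "k \<in> dom A" "the (A k) = 0" for k
      using f ker_iff that by blast
    show "card S \<le> n" if S: "finite S" "S \<subseteq> dom A" "\<And>e. e \<in> S \<Longrightarrow> the (A e) \<bullet> e = - 1"
      "\<And>e e'. e \<in> S \<Longrightarrow> e' \<in> S \<Longrightarrow> e \<noteq> e' \<Longrightarrow> the (A e) \<bullet> e' = 0" for S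
    proof -
      define S' where "S' = j -` S"
      have "S \<subseteq> range j"
        using S(2) A_domD by blast
      then have "card S = card S'"
        unfolding S'_def using card_vimage_inj[OF j(1)] by metis
      moreover have "enat (card S') \<le> morse_index B"
      proof (rule card_le_morse_index[OF B_bilinear])
        show "finite S'"
          unfolding S'_def using S(1) j(1) by (intro finite_vimageI)
        show "B e e = - 1" if "e \<in> S'" for e
          using that S(2) S(3)[of "j e"] A_form[of e e] by (auto simp: S'_def)
        show "B e e' = 0" if "e \<in> S'" "e' \<in> S'" "e \<noteq> e'" for e e'
          using that S(2) S(4)[of "j e" "j e'"] A_form[of e e'] by (auto simp: S'_def inj_eq[OF j(1)])
      qed
      ultimately show ?thesis
        by (simp add: n)
    qed
  qed

  \<comment> \<open>The linearisation of the bordered equation in the direction of \<open>E\<^sub>2\<close>.\<close>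
  define \<Lambda> where "\<Lambda> h = g' (\<xi>\<^sub>s, z\<^sub>s) (0, h) + P (j (i2 h))" for h
  have \<Lambda>_A: "\<Lambda> h = the (A (j (i2 h))) + P (j (i2 h))" for h
    by (simp add: \<Lambda>_def A_gradient)
  have "bounded_linear (\<lambda>h. P (j (i2 h)))"
    by (rule bounded_linear_compose[OF P(1) bounded_linear_compose[OF j(2) i2]])
  moreover have "bounded_linear (\<lambda>h. g' (\<xi>\<^sub>s, z\<^sub>s) (0, h))"
    by (rule bounded_linear_compose[OF blinfun.bounded_linear_right
          bounded_linear_Pair[OF bounded_linear_zero bounded_linear_ident]])
  ultimately have \<Lambda>_bounded: "bounded_linear \<Lambda>"
    unfolding \<Lambda>_def[abs_def] by (intro bounded_linear_add)
  have "inj i2"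
  proof -
    have "z = 0" if z: "i2 z = 0" for z
    proof -
      have "norm z = norm (the (T2 (j (i2 z))))"
        using \<open>is_E2 j T2 i2\<close> unfolding is_E2_def by blast
      also have "\<dots> = norm (the (T2 (j (i2 0))))"
        by (simp add: z i2.zero)
      also have "\<dots> = norm (0 :: 'e2)"
        using \<open>is_E2 j T2 i2\<close> unfolding is_E2_def by metis
      finally show ?thesis
        by simp
    qed
    then show ?thesis
      using linear_injective_0[OF \<open>linear i2\<close>] by blast
  qed
  have "bij \<Lambda>"
  proof -
    have "bij_betw (\<lambda>x. the (A x) + P x) (dom A) UNIV"
      by (rule bordered_operator_bij[OF A_linear A_sym ker_iff P.linear_axioms P(2,3) solve])
    moreover have "bij_betw (\<lambda>h. j (i2 h)) UNIV (dom A)"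
      unfolding bij_betw_def dom_A using j(1) \<open>inj i2\<close> by (simp add: inj_def)
    ultimately have "bij_betw ((\<lambda>x. the (A x) + P x) \<circ> (\<lambda>h. j (i2 h))) UNIV UNIV"
      by (rule bij_betw_trans[rotated])
    moreover have "(\<lambda>x. the (A x) + P x) \<circ> (\<lambda>h. j (i2 h)) = \<Lambda>"
      by (simp add: \<Lambda>_A comp_def fun_eq_iff)
    ultimately show ?thesis
      by simp
  qed
  define N where "N = Blinfun (inv \<Lambda>)"
  have N: "blinfun_apply N = inv \<Lambda>"
    unfolding N_def by (rule bounded_linear_Blinfun_apply[OF bounded_inverse[OF \<Lambda>_bounded \<open>bij \<Lambda>\<close>]])

  define S where "S = Blinfun (\<lambda>p :: (real^'m) \<times> 'e2. P (j (i2 (snd p))))"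
  have S: "blinfun_apply S p = P (j (i2 (snd p)))" for p
    unfolding S_def
    by (subst bounded_linear_Blinfun_apply)
      (intro bounded_linear_compose[OF P(1)] bounded_linear_compose[OF j(2)] bounded_linear_compose[OF i2]
        bounded_linear_snd, rule refl)
  \<comment> \<open>The bordered equation is \<open>f (\<xi>, z) = 0\<close>.\<close>
  define f where "f p = (case p of (\<xi>, z) \<Rightarrow> g \<xi> z) + (S p - P (j u\<^sub>s))" for p
  have L'_zero: "L' \<xi>\<^sub>s u\<^sub>s v = 0" for v
  proof -
    have "blinfun_apply (L' \<xi>\<^sub>s u\<^sub>s) = (\<lambda>_. 0)"
      by (rule has_derivative_unique[OF L'  \<open>(L \<xi>\<^sub>s has_derivative (\<lambda>_. 0)) (at u\<^sub>s)\<close>])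
    then show ?thesis
      by simp
  qed
  have "g \<xi>\<^sub>s z\<^sub>s = 0"
    by (rule sep) (simp add: g[symmetric] z\<^sub>s L'_zero)
  have "\<exists>\<Omega> Z. open \<Omega> \<and> \<xi>\<^sub>s \<in> \<Omega> \<and> Z \<xi>\<^sub>s = z\<^sub>s \<and> (\<forall>\<xi>\<in>\<Omega>. f (\<xi>, Z \<xi>) = 0) \<and> C1_on \<Omega> Z"
  proof (rule implicit_function_C1[of f "\<lambda>p. g' p + S" \<xi>\<^sub>s z\<^sub>s N])
    show "(f has_derivative blinfun_apply (g' p + S)) (at p)" for p
    proof -
      have "(f has_derivative (\<lambda>h. g' p h + (S h - 0))) (at p)"
        unfolding f_def[abs_def]
        by (intro has_derivative_add has_derivative_diff g' has_derivative_const
            bounded_linear.has_derivative[OF blinfun.bounded_linear_right has_derivative_ident])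
      then show ?thesis
        by (simp add: blinfun.add_left[abs_def])
    qed
    show "continuous_on UNIV (\<lambda>p. g' p + S)"
      by (intro continuous_on_add g'_cont continuous_on_const)
    show "f (\<xi>\<^sub>s, z\<^sub>s) = 0"
      by (simp add: f_def S z\<^sub>s \<open>g \<xi>\<^sub>s z\<^sub>s = 0\<close>)
    show "N ((g' (\<xi>\<^sub>s, z\<^sub>s) + S) (0, h)) = h" for h
    proof -
      have "(g' (\<xi>\<^sub>s, z\<^sub>s) + S) (0, h) = \<Lambda> h"
        by (simp add: blinfun.add_left S \<Lambda>_def)
      then show ?thesis
        by (simp add: N inv_f_f[OF bij_is_inj[OF \<open>bij \<Lambda>\<close>]])
    qed
    show "inj (blinfun_apply N)"
      unfolding N using bij_imp_bij_inv[OF \<open>bij \<Lambda>\<close>] by (rule bij_is_inj)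
  qed
  then obtain \<Omega>0 Z where \<Omega>0: "open \<Omega>0" "\<xi>\<^sub>s \<in> \<Omega>0" and Z: "Z \<xi>\<^sub>s = z\<^sub>s" "C1_on \<Omega>0 Z"
    and fZ: "\<And>\<xi>. \<xi> \<in> \<Omega>0 \<Longrightarrow> f (\<xi>, Z \<xi>) = 0"
    by blast
  define U where "U \<xi> = i2 (Z \<xi>)" for \<xi>
  have U: "C1_on \<Omega>0 U" "U \<xi>\<^sub>s = u\<^sub>s"
    unfolding U_def[abs_def] using C1_on_bounded_linear_compose[OF i2 Z(2)] by (simp_all add: Z(1) z\<^sub>s)

  obtain d where d: "d > 0" and orth_zero: "\<And>v k. v \<in> range i2 \<Longrightarrow> dist v u\<^sub>s < d \<Longrightarrow>
      dim (isotropy v) = dim (isotropy u\<^sub>s) \<Longrightarrow> k \<in> K \<Longrightarrow> (\<And>\<eta>. \<eta> \<in> isotropy v \<Longrightarrow> sp k (X \<eta> v) = 0) \<Longrightarrow> k = 0"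
    using tangent_orthogonal_to_nearby_orbit_eq_0 K_sub unfolding K_def by metis
  have "isCont F u\<^sub>s" "isCont F' u\<^sub>s"
    using has_derivative_continuous[OF F'] has_derivative_continuous[OF F''] .
  then have "\<forall>\<^sub>F u in nhds u\<^sub>s. dim (isotropy u) = dim (isotropy u\<^sub>s)"
    using eventually_compose_filterlim[OF f] tendsto_at_iff_tendsto_nhds by (metis isCont_def)
  moreover have "\<forall>\<^sub>F u in nhds u\<^sub>s. \<forall>\<eta>. (\<forall>h. \<eta> \<bullet> F' u h = 0) \<longrightarrow> \<eta> = 0"
    using regular \<open>isCont F' u\<^sub>s\<close> by (rule regularity_open)
  moreover have "\<forall>\<^sub>F u in nhds u\<^sub>s. dist u u\<^sub>s < d"
    using d by (rule eventually_nhds_metric[THEN iffD2, OF exI, OF conjI]) simp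
  ultimately have "\<forall>\<^sub>F u in nhds u\<^sub>s. dim (isotropy u) = dim (isotropy u\<^sub>s) \<and>
      (\<forall>\<eta>. (\<forall>h. \<eta> \<bullet> F' u h = 0) \<longrightarrow> \<eta> = 0) \<and> dist u u\<^sub>s < d"
    by (intro eventually_conj)
  \<comment> \<open>Near \<open>u\<^sub>s\<close> the isotropy dimension is constant, the momentum map is regular, and tangent vectors orthogonal to
    the orbit vanish; the parameter set is shrunk so that the solutions stay there.\<close>
  then obtain W where W: "open W" "u\<^sub>s \<in> W" and W_dim: "\<And>u. u \<in> W \<Longrightarrow> dim (isotropy u) = dim (isotropy u\<^sub>s)"
    and W_reg: "\<And>u \<eta>. u \<in> W \<Longrightarrow> (\<And>h. \<eta> \<bullet> F' u h = 0) \<Longrightarrow> \<eta> = 0"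
    and W_dist: "\<And>u. u \<in> W \<Longrightarrow> dist u u\<^sub>s < d"
    unfolding eventually_nhds by metis
  define \<Omega> where "\<Omega> = \<Omega>0 \<inter> U -` W"
  have \<Omega>: "open \<Omega>" "\<xi>\<^sub>s \<in> \<Omega>"
    using continuous_on_open_vimage[OF \<Omega>0(1)] C1_on_continuous_on[OF U(1)] W \<Omega>0(2) U(2)
    by (auto simp: \<Omega>_def Int_commute)
  have critical: "L' \<xi> (U \<xi>) v = 0" if \<xi>: "\<xi> \<in> \<Omega>" for \<xi> v
  proof -
    have "\<xi> \<in> \<Omega>0" "U \<xi> \<in> W"
      using \<xi> by (auto simp: \<Omega>_def)
    have U_range: "U \<xi> \<in> range i2"
      by (simp add: U_def)
    have "g \<xi> (Z \<xi>) = P (j (u\<^sub>s - U \<xi>))"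
      using fZ[OF \<open>\<xi> \<in> \<Omega>0\<close>] by (simp add: f_def S U_def j.diff P.diff algebra_simps)
    then obtain k where k: "k \<in> K" "g \<xi> (Z \<xi>) = j k"
      using P(2) by auto
    \<comment> \<open>The gradient pairs to zero with the orbit directions of the isotropy group, along which both \<open>H\<close> and \<open>F\<close>
      are constant.\<close>
    have "k = 0"
    proof (rule orth_zero[OF U_range W_dist W_dim k(1)])
      fix \<eta> assume \<eta>: "\<eta> \<in> isotropy (U \<xi>)"
      have "sp k (X \<eta> (U \<xi>)) = L' \<xi> (U \<xi>) (X \<eta> (U \<xi>))"
        unfolding U_def g k(2) j_sp ..
      also have "\<dots> = H' (U \<xi>) (X \<eta> (U \<xi>)) - \<xi> \<bullet> F' (U \<xi>) (X \<eta> (U \<xi>))"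
        by (rule L'_apply)
      also have "\<dots> = 0"
        using invariant_derivative_generator[OF _ H' U_range] \<open>\<forall>g\<in>G. H \<circ> \<Phi> g = H\<close>
          isotropy_iff_derivative[OF U_range] \<eta> by simp
      finally show "sp k (X \<eta> (U \<xi>)) = 0" .
    qed (rule \<open>U \<xi> \<in> W\<close>)+
    then show ?thesis
      unfolding U_def g k(2) by (simp add: j.zero)
  qed
  have C1: "C1_on \<Omega> U"
    using U(1) by (rule C1_on_subset) (auto simp: \<Omega>_def)
  have crit: "H' (U \<xi>) h - \<xi> \<bullet> F' (U \<xi>) h = 0" if "\<xi> \<in> \<Omega>" for \<xi> h
    using critical[OF that] by (simp add: L'_apply)
  have reg: "\<eta> = 0" if "\<xi> \<in> \<Omega>" "\<And>h. \<eta> \<bullet> F' (U \<xi>) h = 0" for \<xi> \<eta>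
    using W_reg[of "U \<xi>" \<eta>] that by (auto simp: \<Omega>_def)
  have imm: "inj_on U \<Omega>" "\<forall>\<xi>\<in>\<Omega>. inj (frechet_derivative U (at \<xi>))"
    by (rule critical_family_injective_immersion[OF H'' F'' C1 \<Omega>(1) crit reg]; assumption)+
  show ?thesis
  proof (intro exI conjI)
    show "\<forall>\<xi>\<in>\<Omega>. \<forall>v. frechet_derivative H (at (U \<xi>)) v - \<xi> \<bullet> frechet_derivative F (at (U \<xi>)) v = 0"
      using crit by (simp add: frechet_derivative_at[OF H', symmetric] frechet_derivative_at[OF F', symmetric])
  qed (fact \<Omega> C1 U(2) imm)+
qed

end
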